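(* For $i=1,\dots,n$ let $K_i$ be a finite simplicial complex with Alexandrov topology $\mathcal{T}^i$, $F_i$ a combinatorial dynamical system on $K_i$, and $\mathcal{M}_i$ a Morse decomposition of $F_i$. For $i=1,\dots,n-1$ let $f_i:K_i\to K_{i+1}$ be a simplicial map such that $f_i(F_i(\sigma))\subseteq F_{i+1}(f_i(\sigma))$ for all $\sigma\in K_i$ and such that every $f_i(M)$, $M\in\mathcal{M}_i$, is contained in some $M'\in\mathcal{M}_{i+1}$. Let $\bar f_i:(\langle\mathcal{M}_i\rangle,\mathcal{T}^i_{\mathcal{M}_i})\to(\langle\mathcal{M}_{i+1}\rangle,\mathcal{T}^{i+1}_{\mathcal{M}_{i+1}})$ be the continuous map $\sigma\mapsto f_i(\sigma)$. Let $\mathcal{O}^i$ be the metric topology of the polytope $|K_i|$, let $\mathcal{M}_i^{\parallel}:=\{|M| : M\in\mathcal{M}_i\}$ be the family of solids of the Morse sets in $\mathcal{M}_i$, and let $\nu_i:(\langle\mathcal{M}_i^{\parallel}\rangle,\mathcal{O}^i_{\mathcal{M}_i^{\parallel}})\to(\langle\mathcal{M}_{i+1}^{\parallel}\rangle,\mathcal{O}^{i+1}_{\mathcal{M}_{i+1}^{\parallel}})$ be the continuous map $x\mapsto|f_i|(x)$. Then the persistence diagram of the persistence module $$H(\langle\mathcal{M}_1\rangle,\mathcal{T}^1_{\mathcal{M}_1})\xrightarrow{H(\bar f_1)}H(\langle\mathcal{M}_2\rangle,\mathcal{T}^2_{\mathcal{M}_2})\xrightarrow{H(\bar f_2)}\cdots\xrightarrow{H(\bar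 f_{n-1})}H(\langle\mathcal{M}_n\rangle,\mathcal{T}^n_{\mathcal{M}_n})$$ is the same as the persistence diagram of the persistence module $$H(\langle\mathcal{M}_1^{\parallel}\rangle,\mathcal{O}^1_{\mathcal{M}_1^{\parallel}})\xrightarrow{H(\nu_1)}H(\langle\mathcal{M}_2^{\parallel}\rangle,\mathcal{O}^2_{\mathcal{M}_2^{\parallel}})\xrightarrow{H(\nu_2)}\cdots\xrightarrow{H(\nu_{n-1})}H(\langle\mathcal{M}_n^{\parallel}\rangle,\mathcal{O}^n_{\mathcal{M}_n^{\parallel}}).$$
   Context: $H$ denotes singular homology with coefficients in a fixed field (taken in each degree). A finite simplicial complex $K$ is regarded as the finite set of its (non-empty) simplices, partially ordered by the face relation. Its Alexandrov topology is the $T_0$ topology whose open sets are the upper sets for the face relation (a set is closed iff it contains all faces of its elements). A simplicial map is a map of the sets of simplices induced by a vertex map; it is continuous for the Alexandrov topologies. $|K|$ denotes the polytope of (a fixed geometric realization of) $K$, and for a simplicial map $f:K\to K'$, $|f|:|K|\to|K'|$ is its linear extension. The open cell $\mathring{\sigma}$ of $\sigma\in K$ is the set of points $x\in|\sigma|$ in the polytope with strictly positive barycentric coordinates $t_v(x)$ for every vertex $v$ of $\sigma$ (i.e. the relative interior of the geometric simplex $\sigma$). The solid of a set $A\subseteq K$ is $|A|:=\bigcup\{\mathring{\sigma} : \sigma\in A\}\subseteq|K|$. A combinatorial dynamical system on $K$ is a multivalued map $F:K\multimap K$, assigning to each $\sigma\in K$ a non-empty set $F(\sigma)\subseteq K$.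 A solution of $F$ in $A\subseteq K$ is a map $\rho:D\to A$, where $D=\mathbb{Z}$ (full) or $D=\mathbb{Z}\cap[m,n]$ (partial, with left endpoint $\rho(m)$ and right endpoint $\rho(n)$), such that $\rho(i+1)\in F(\rho(i))$ whenever $i,i+1\in D$. A set $A$ is invariant if each $\sigma\in A$ is a value of a full solution in $A$. An invariant set $S$ is isolated if there is a closed set $N\supseteq S$ such that every partial solution in $N$ with endpoints in $S$ has all values in $S$. $S(F)$ is the set of all values of full solutions in $K$. A connection from an isolated invariant set $S_1$ to an isolated invariant set $S_2$ is a partial solution with left endpoint in $S_1$ and right endpoint in $S_2$. A Morse decomposition of $F$ is a family $\mathcal{M}$ of mutually disjoint, non-empty isolated invariant subsets of $S(F)$ admitting a partial order $\leq$ such that any connection between elements of $\mathcal{M}$ either has all values in a single element of $\mathcal{M}$ or originates in some $M\in\mathcal{M}$ and terminates in some $M'\in\mathcal{M}$ with $M>M'$. For a finite family $\mathcal{A}$ of mutually disjoint non-empty subsets of a topological space $(X,\mathcal{T})$, $\langle\mathcal{A}\rangle:=\bigcup\mathcal{A}$, and $\mathcal{T}_{\mathcal{A}}$ is the topology on $\langle\mathcal{A}\rangle$ consisting of all unions of sets $A\cap U$ with $A\in\mathcal{A}$, $U\in\mathcal{T}$; this notation is used both with $\mathcal{T}=\mathcal{T}^i$ and with $\mathcal{T}=\mathcal{O}^i$. The persistence diagram of a persistence module of finite-dimensional vector spaces is the multiset of intervals in its interval decomposition. *)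

theory Defs
  imports
    "HOL-Analysis.Abstract_Metric_Spaces"
    "HOL-Homology.Homology"
    "HOL-Library.Multiset"
    "Jordan_Normal_Form.VS_Connect"
begin

section \<open>Singular homology with coefficients in a field\<close>

text \<open>
  \<open>HOL-Homology\<close> provides singular simplices, their faces and their images under maps, but only
  integral chains.  Here chains have coefficients in a field \<open>'k\<close>, and homology is a vector space
  over \<open>class_ring :: 'k ring\<close>, the type \<open>'k\<close> viewed as a ring structure.
\<close>

type_synonym ('x, 'k) field_chain = "((nat \<Rightarrow> real) \<Rightarrow> 'x) \<Rightarrow>\<^sub>0 'k"

definition field_chains :: "nat \<Rightarrow> 'x topology \<Rightarrow> ('x, 'k::field) field_chain set" where
  "field_chains p X = {c. Poly_Mapping.keys c \<subseteq> singular_simplex_set p X}"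

definition field_boundary :: "nat \<Rightarrow> ('x, 'k::field) field_chain \<Rightarrow> ('x, 'k) field_chain" where
  "field_boundary p c =
     (if p = 0 then 0
      else \<Sum>s\<in>Poly_Mapping.keys c. \<Sum>k\<le>p.
             Poly_Mapping.single (singular_face p k s) ((-1) ^ k * Poly_Mapping.lookup c s))"

definition field_chain_map ::
    "nat \<Rightarrow> ('x \<Rightarrow> 'y) \<Rightarrow> ('x, 'k::field) field_chain \<Rightarrow> ('y, 'k) field_chain" where
  "field_chain_map p g c =
     (\<Sum>s\<in>Poly_Mapping.keys c. Poly_Mapping.single (simplex_map p g s) (Poly_Mapping.lookup c s))"

text \<open>The ring multiplication and unit that the record type of modules carries along play no role
  for a module; they are left unspecified below.\<close>

definition cycle_module :: "nat \<Rightarrow> 'x topology \<Rightarrow> ('k::field, ('x, 'k) field_chain) module" where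
  "cycle_module p X =
     \<lparr>carrier = {z \<in> field_chains p X. field_boundary p z = 0},
      mult = undefined, one = undefined, zero = 0, add = (+),
      smult = (\<lambda>a. Poly_Mapping.map ((*) a))\<rparr>"

definition field_boundaries :: "nat \<Rightarrow> 'x topology \<Rightarrow> ('x, 'k::field) field_chain set" where
  "field_boundaries p X = field_boundary (Suc p) ` field_chains (Suc p) X"

definition quotient_module :: "('k, 'v, 'm) module_scheme \<Rightarrow> 'v set \<Rightarrow> ('k, 'v set) module" where
  "quotient_module M N =
     \<lparr>carrier = a_rcosets\<^bsub>M\<^esub> N, mult = undefined, one = undefined, zero = N, add = set_add M,
      smult = (\<lambda>a A. \<Union>x\<in>A. N +>\<^bsub>M\<^esub> (a \<odot>\<^bsub>M\<^esub> x))\<rparr>"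

definition homology_space :: "nat \<Rightarrow> 'x topology \<Rightarrow> ('k::field, ('x, 'k) field_chain set) module" where
  "homology_space p X = quotient_module (cycle_module p X) (field_boundaries p X)"

text \<open>The class of a cycle \<open>c\<close> is sent to the class of its image; for continuous \<open>g\<close> all members of
  the union below coincide.\<close>

definition homology_map ::
    "nat \<Rightarrow> 'y topology \<Rightarrow> ('x \<Rightarrow> 'y) \<Rightarrow> ('x, 'k::field) field_chain set \<Rightarrow> ('y, 'k) field_chain set"
  where
  "homology_map p Y g C =
     (\<Union>c\<in>C. field_boundaries p Y +>\<^bsub>cycle_module p Y\<^esub> field_chain_map p g c)"


section \<open>Persistence modules and their diagrams\<close>

text \<open>A persistence module of length \<open>n\<close> consists of the spaces \<open>pspace V i\<close> for \<open>1 \<le> i \<le> n\<close> and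
  the maps \<open>pmap V i\<close> from \<open>pspace V i\<close> to \<open>pspace V (i + 1)\<close> for \<open>1 \<le> i < n\<close>; the values at other
  indices are irrelevant.\<close>

record ('k, 'v) pmodule =
  pspace :: "nat \<Rightarrow> ('k, 'v) module"
  pmap :: "nat \<Rightarrow> 'v \<Rightarrow> 'v"

definition fin_dim_persistence_module :: "nat \<Rightarrow> ('k::field, 'v) pmodule \<Rightarrow> bool" where
  "fin_dim_persistence_module n V \<longleftrightarrow>
     (\<forall>i\<in>{1..n}. vectorspace class_ring (pspace V i) \<and> vectorspace.fin_dim class_ring (pspace V i)) \<and>
     (\<forall>i\<in>{1..<n}. linear_map class_ring (pspace V i) (pspace V (i + 1)) (pmap V i))"

definition pmodule_isomorphic ::
    "nat \<Rightarrow> ('k::field, 'v) pmodule \<Rightarrow> ('k, 'w) pmodule \<Rightarrow> bool" where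
  "pmodule_isomorphic n V W \<longleftrightarrow>
     (\<exists>h. (\<forall>i\<in>{1..n}. linear_map class_ring (pspace V i) (pspace W i) (h i) \<and>
                       bij_betw (h i) (carrier (pspace V i)) (carrier (pspace W i))) \<and>
          (\<forall>i\<in>{1..<n}. \<forall>x\<in>carrier (pspace V i). h (i + 1) (pmap V i x) = pmap W i (h i x)))"

definition interval_pmodule :: "nat set \<Rightarrow> ('k::field, 'k) pmodule" where
  "interval_pmodule I =
     \<lparr>pspace = (\<lambda>i. \<lparr>carrier = (if i \<in> I then UNIV else {0}),
                     mult = undefined, one = undefined, zero = 0, add = (+), smult = (*)\<rparr>),
      pmap = (\<lambda>i x. if i \<in> I \<and> i + 1 \<in> I then x else 0)\<rparr>"

definition direct_sum_pmodule :: "nat \<Rightarrow> (nat \<Rightarrow> ('k::field, 'v) pmodule) \<Rightarrow> ('k, nat \<Rightarrow> 'v) pmodule"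
  where
  "direct_sum_pmodule m V =
     \<lparr>pspace = (\<lambda>i.
        \<lparr>carrier = \<Pi>\<^sub>E j\<in>{..<m}. carrier (pspace (V j) i),
         mult = undefined, one = undefined,
         zero = (\<lambda>j\<in>{..<m}. \<zero>\<^bsub>pspace (V j) i\<^esub>),
         add = (\<lambda>x y. \<lambda>j\<in>{..<m}. x j \<oplus>\<^bsub>pspace (V j) i\<^esub> y j),
         smult = (\<lambda>a x. \<lambda>j\<in>{..<m}. a \<odot>\<^bsub>pspace (V j) i\<^esub> x j)\<rparr>),
      pmap = (\<lambda>i x. \<lambda>j\<in>{..<m}. pmap (V j) i (x j))\<rparr>"

text \<open>\<open>D\<close> is the multiset of intervals of an interval decomposition of \<open>V\<close>.\<close>

definition interval_decomposition :: "nat \<Rightarrow> ('k::field, 'v) pmodule \<Rightarrow> nat set multiset \<Rightarrow> bool" where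
  "interval_decomposition n V D \<longleftrightarrow>
     (\<forall>I\<in>#D. \<exists>b d. 1 \<le> b \<and> b \<le> d \<and> d \<le> n \<and> I = {b..d}) \<and>
     (\<exists>Is. mset Is = D \<and>
           pmodule_isomorphic n V (direct_sum_pmodule (length Is) (\<lambda>j. interval_pmodule (Is ! j))))"

text \<open>Every finite-dimensional persistence module has exactly one such multiset
  (Gabriel, Krull--Remak--Schmidt--Azumaya).\<close>

definition persistence_diagram :: "nat \<Rightarrow> ('k::field, 'v) pmodule \<Rightarrow> nat set multiset" where
  "persistence_diagram n V = (THE D. interval_decomposition n V D)"

definition homology_pmodule ::
    "nat \<Rightarrow> (nat \<Rightarrow> 'x topology) \<Rightarrow> (nat \<Rightarrow> 'x \<Rightarrow> 'x) \<Rightarrow> ('k::field, ('x, 'k) field_chain set) pmodule"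
  where
  "homology_pmodule p X g =
     \<lparr>pspace = (\<lambda>i. homology_space p (X i)), pmap = (\<lambda>i. homology_map p (X (i + 1)) (g i))\<rparr>"


section \<open>Finite simplicial complexes\<close>

definition finite_simplicial_complex :: "'a set set \<Rightarrow> bool" where
  "finite_simplicial_complex K \<longleftrightarrow>
     finite K \<and> (\<forall>\<sigma>\<in>K. finite \<sigma> \<and> \<sigma> \<noteq> {} \<and> (\<forall>\<tau>. \<tau> \<noteq> {} \<and> \<tau> \<subseteq> \<sigma> \<longrightarrow> \<tau> \<in> K))"

definition alexandrov_topology :: "'a set set \<Rightarrow> 'a set topology" where
  "alexandrov_topology K = topology (\<lambda>U. U \<subseteq> K \<and> (\<forall>\<sigma>\<in>U. \<forall>\<tau>\<in>K. \<sigma> \<subseteq> \<tau> \<longrightarrow> \<tau> \<in> U))"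

lemma openin_alexandrov_topology:
  "openin (alexandrov_topology K) U \<longleftrightarrow> U \<subseteq> K \<and> (\<forall>\<sigma>\<in>U. \<forall>\<tau>\<in>K. \<sigma> \<subseteq> \<tau> \<longrightarrow> \<tau> \<in> U)"
proof -
  have "istopology (\<lambda>U. U \<subseteq> K \<and> (\<forall>\<sigma>\<in>U. \<forall>\<tau>\<in>K. \<sigma> \<subseteq> \<tau> \<longrightarrow> \<tau> \<in> U))"
    unfolding istopology_def by blast
  then show ?thesis
    by (simp add: alexandrov_topology_def)
qed

text \<open>A simplicial map is represented by its vertex map \<open>\<phi>\<close>; the induced map of simplices
  is \<open>(`) \<phi>\<close>.\<close>

definition simplicial_map :: "'a set set \<Rightarrow> 'b set set \<Rightarrow> ('a \<Rightarrow> 'b) \<Rightarrow> bool" where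
  "simplicial_map K L \<phi> \<longleftrightarrow> (\<forall>\<sigma>\<in>K. \<phi> ` \<sigma> \<in> L)"

text \<open>The geometric realization is the standard one, with the vertices as unit vectors: a point of
  the polytope is given by its barycentric coordinates \<open>x v\<close>.\<close>

definition closed_simplex :: "'a set \<Rightarrow> ('a \<Rightarrow> real) set" where
  "closed_simplex \<sigma> = {x. (\<forall>v\<in>\<sigma>. 0 \<le> x v) \<and> (\<forall>v. v \<notin> \<sigma> \<longrightarrow> x v = 0) \<and> (\<Sum>v\<in>\<sigma>. x v) = 1}"

definition open_cell :: "'a set \<Rightarrow> ('a \<Rightarrow> real) set" where
  "open_cell \<sigma> = {x \<in> closed_simplex \<sigma>. \<forall>v\<in>\<sigma>. 0 < x v}"

definition polytope_of :: "'a set set \<Rightarrow> ('a \<Rightarrow> real) set" where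
  "polytope_of K = (\<Union>\<sigma>\<in>K. closed_simplex \<sigma>)"

definition polytope_dist :: "'a set set \<Rightarrow> ('a \<Rightarrow> real) \<Rightarrow> ('a \<Rightarrow> real) \<Rightarrow> real" where
  "polytope_dist K x y = L2_set (\<lambda>v. x v - y v) (\<Union>K)"

lemma Metric_space_polytope:
  assumes "finite_simplicial_complex K"
  shows "Metric_space (polytope_of K) (polytope_dist K)"
proof
  fix x y z :: "'a \<Rightarrow> real"
  have fin: "finite (\<Union>K)"
    using assms by (auto simp: finite_simplicial_complex_def)
  show "0 \<le> polytope_dist K x y"
    by (simp add: polytope_dist_def L2_set_nonneg)
  show "polytope_dist K x y = polytope_dist K y x"
    by (simp add: polytope_dist_def L2_set_def power2_commute)
  show "polytope_dist K x z \<le> polytope_dist K x y + polytope_dist K y z"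
    using L2_set_triangle_ineq[of "\<lambda>v. x v - y v" "\<lambda>v. y v - z v" "\<Union>K"]
    by (simp add: polytope_dist_def)
  assume x: "x \<in> polytope_of K" and y: "y \<in> polytope_of K"
  have "x = y" if "\<forall>v\<in>\<Union>K. x v = y v"
  proof
    fix v
    show "x v = y v"
    proof (cases "v \<in> \<Union>K")
      case False
      then have "x v = 0" "y v = 0"
        using x y by (auto simp: polytope_of_def closed_simplex_def)
      then show ?thesis by simp
    qed (use that in blast)
  qed
  then show "polytope_dist K x y = 0 \<longleftrightarrow> x = y"
    using fin by (auto simp: polytope_dist_def L2_set_eq_0_iff)
qed

definition polytope_topology :: "'a set set \<Rightarrow> ('a \<Rightarrow> real) topology" where
  "polytope_topology K = Metric_space.mtopology (polytope_of K) (polytope_dist K)"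

text \<open>The linear extension of a simplicial map on the vertex set \<open>\<Union>K\<close>.\<close>

definition polytope_map :: "'a set set \<Rightarrow> ('a \<Rightarrow> 'b) \<Rightarrow> ('a \<Rightarrow> real) \<Rightarrow> 'b \<Rightarrow> real" where
  "polytope_map K \<phi> x = (\<lambda>w. \<Sum>v\<in>{v \<in> \<Union>K. \<phi> v = w}. x v)"

definition solid :: "'a set set \<Rightarrow> ('a \<Rightarrow> real) set" where
  "solid A = (\<Union>\<sigma>\<in>A. open_cell \<sigma>)"


section \<open>Combinatorial dynamics\<close>

definition combinatorial_dynamical_system :: "'a set set \<Rightarrow> ('a set \<Rightarrow> 'a set set) \<Rightarrow> bool" where
  "combinatorial_dynamical_system K F \<longleftrightarrow> (\<forall>\<sigma>\<in>K. F \<sigma> \<noteq> {} \<and> F \<sigma> \<subseteq> K)"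

text \<open>Solutions are total functions on \<open>int\<close> of which only the values on the domain \<open>D\<close> matter;
  \<open>D\<close> is either \<open>UNIV\<close> or \<open>{m..n}\<close>.\<close>

definition solution :: "('s \<Rightarrow> 's set) \<Rightarrow> int set \<Rightarrow> 's set \<Rightarrow> (int \<Rightarrow> 's) \<Rightarrow> bool" where
  "solution F D A \<rho> \<longleftrightarrow> \<rho> ` D \<subseteq> A \<and> (\<forall>i. i \<in> D \<and> i + 1 \<in> D \<longrightarrow> \<rho> (i + 1) \<in> F (\<rho> i))"

definition invariant_set :: "('s \<Rightarrow> 's set) \<Rightarrow> 's set \<Rightarrow> bool" where
  "invariant_set F A \<longleftrightarrow> (\<forall>\<sigma>\<in>A. \<exists>\<rho>. solution F UNIV A \<rho> \<and> \<sigma> \<in> range \<rho>)"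

definition isolated_invariant_set ::
    "'a set set \<Rightarrow> ('a set \<Rightarrow> 'a set set) \<Rightarrow> 'a set set \<Rightarrow> bool" where
  "isolated_invariant_set K F S \<longleftrightarrow>
     S \<subseteq> K \<and> invariant_set F S \<and>
     (\<exists>N. closedin (alexandrov_topology K) N \<and> S \<subseteq> N \<and>
          (\<forall>m n \<rho>. m \<le> n \<and> solution F {m..n} N \<rho> \<and> \<rho> m \<in> S \<and> \<rho> n \<in> S \<longrightarrow> \<rho> ` {m..n} \<subseteq> S))"

definition full_solution_values :: "'s set \<Rightarrow> ('s \<Rightarrow> 's set) \<Rightarrow> 's set" where
  "full_solution_values K F = \<Union>{range \<rho> |\<rho>. solution F UNIV K \<rho>}"

definition connection ::
    "'s set \<Rightarrow> ('s \<Rightarrow> 's set) \<Rightarrow> 's set \<Rightarrow> 's set \<Rightarrow> int \<Rightarrow> int \<Rightarrow> (int \<Rightarrow> 's) \<Rightarrow> bool" where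
  "connection K F S\<^sub>1 S\<^sub>2 m n \<rho> \<longleftrightarrow>
     m \<le> n \<and> solution F {m..n} K \<rho> \<and> \<rho> m \<in> S\<^sub>1 \<and> \<rho> n \<in> S\<^sub>2"

text \<open>The partial order is the relation \<open>r\<close>, where \<open>(M', M) \<in> r\<close> reads \<open>M' \<le> M\<close>.\<close>

definition morse_decomposition ::
    "'a set set \<Rightarrow> ('a set \<Rightarrow> 'a set set) \<Rightarrow> 'a set set set \<Rightarrow> bool" where
  "morse_decomposition K F \<M> \<longleftrightarrow>
     disjoint \<M> \<and>
     (\<forall>M\<in>\<M>. M \<noteq> {} \<and> isolated_invariant_set K F M \<and> M \<subseteq> full_solution_values K F) \<and>
     (\<exists>r. partial_order_on \<M> r \<and>
          (\<forall>M\<^sub>1\<in>\<M>. \<forall>M\<^sub>2\<in>\<M>. \<forall>m n \<rho>. connection K F M\<^sub>1 M\<^sub>2 m n \<rho> \<longrightarrow>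
             (\<exists>M\<in>\<M>. \<rho> ` {m..n} \<subseteq> M) \<or>
             (\<exists>M\<in>\<M>. \<exists>M'\<in>\<M>. \<rho> m \<in> M \<and> \<rho> n \<in> M' \<and> (M', M) \<in> r \<and> M' \<noteq> M)))"


section \<open>The topology of a disjoint family\<close>

definition family_topology :: "'x topology \<Rightarrow> 'x set set \<Rightarrow> 'x topology" where
  "family_topology X \<A> =
     topology (arbitrary union_of (\<lambda>S. \<exists>A\<in>\<A>. \<exists>U. openin X U \<and> S = A \<inter> U))"

lemma openin_family_topology:
  assumes "disjoint \<A>"
  shows "openin (family_topology X \<A>) =
           arbitrary union_of (\<lambda>S. \<exists>A\<in>\<A>. \<exists>U. openin X U \<and> S = A \<inter> U)"
proof -
  let ?P = "\<lambda>S. \<exists>A\<in>\<A>. \<exists>U. openin X U \<and> S = A \<inter> U"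
  have "?P (S \<inter> T)" if S: "?P S" and T: "?P T" for S T
  proof -
    obtain A U B W where *: "A \<in> \<A>" "openin X U" "S = A \<inter> U" "B \<in> \<A>" "openin X W" "T = B \<inter> W"
      using S T by blast
    have "S \<inter> T = A \<inter> (U \<inter> W) \<or> S \<inter> T = A \<inter> {}"
      using * assms by (auto simp: disjoint_def)
    moreover have "openin X (U \<inter> W)" "openin X {}"
      using * by auto
    ultimately show "?P (S \<inter> T)"
      using \<open>A \<in> \<A>\<close> by blast
  qed
  then have "istopology (arbitrary union_of ?P)"
    by (rule istopology_base)
  then show ?thesis
    by (simp add: family_topology_def)
qed

lemma topspace_family_topology:
  assumes "disjoint \<A>" "\<Union>\<A> \<subseteq> topspace X"
  shows "topspace (family_topology X \<A>) = \<Union>\<A>"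
proof
  show "topspace (family_topology X \<A>) \<subseteq> \<Union>\<A>"
    by (auto simp: topspace_def openin_family_topology[OF assms(1)] union_of_def)
  have "openin (family_topology X \<A>) A" if "A \<in> \<A>" for A
  proof -
    have "A = A \<inter> topspace X"
      using that assms(2) by blast
    then show ?thesis
      unfolding openin_family_topology[OF assms(1)]
      by (intro arbitrary_union_of_inc) (use that in blast)
  qed
  then show "\<Union>\<A> \<subseteq> topspace (family_topology X \<A>)"
    by (meson Union_least openin_subset)
qed

end

theory Submission
  imports Defs
begin

text \<open>
  Both persistence modules are compared through the map \<open>support\<close> that sends a point of a solid to
  the simplex whose open cell contains it.  It is continuous from the solids to the cells, and it
  intertwines the linear extension of a simplicial map with the map of simplices, because barycentric
  coordinates are nonnegative and cannot cancel.  Hence it induces a morphism of persistence modules,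
  and everything reduces to a single pair of spaces: \<open>support\<close> must induce isomorphisms in homology,
  and the homology must be finite-dimensional.

  The space of cells is finite, so every point \<open>\<sigma>\<close> has a smallest open neighbourhood, namely the
  cofaces of \<open>\<sigma>\<close> in its Morse set.  This neighbourhood is contractible like every smallest
  neighbourhood in a finite space (\<open>contractible_minimal_open\<close>), and its preimage in the solids is
  contractible because it contracts along straight lines to the barycentre of \<open>\<sigma>\<close>
  (\<open>contractible_open_star\<close>).  So \<open>support\<close> is an isomorphism over each smallest neighbourhood, and
  by Mayer--Vietoris and induction over the open sets of the finite space it is one globally: this is
  the homological form of McCord's theorem (\<open>mapping_cone_acyclic_finite_space\<close>).  The same
  induction yields finite-dimensionality (\<open>finite_dim_homology_over_finite_space\<close>).

  The Mayer--Vietoris step is carried out with the algebraic mapping cone of the induced chain map: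
  the map is an isomorphism in homology once the cone is acyclic, and acyclicity passes from two open
  sets and their intersection to the union by a short diagram chase
  (\<open>mapping_cone_acyclic_union\<close>).  The chase needs chains subordinate to a cover and chain
  contractions with coefficients in a field.  Both come from integral singular chains: an operator
  given by integral chains on generators extends linearly to field coefficients, and identities
  between such operators extend with it (\<open>chain_extend_chain_extend\<close>).

  Finally, isomorphic persistence modules have the same interval decompositions, so their diagrams
  coincide.
\<close>

section \<open>Extending integral chain operators to field coefficients\<close>

lemma lookup_scale: "Poly_Mapping.lookup (Poly_Mapping.map ((*) (a::'k::field)) c) s = a * Poly_Mapping.lookup c s"
  by (simp add: Poly_Mapping.map.rep_eq when_def)

interpretation chain_space: vector_space "\<lambda>a::'k::field. Poly_Mapping.map ((*) a) :: ('s \<Rightarrow>\<^sub>0 'k) \<Rightarrow> 's \<Rightarrow>\<^sub>0 'k"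
  by unfold_locales (auto intro!: poly_mapping_eqI simp: lookup_scale lookup_add algebra_simps)

text \<open>Change of coefficients along \<open>\<int> \<rightarrow> 'k\<close> for the linear operator whose values on generators are the
  integral chains \<open>E s\<close>.\<close>

definition chain_extend :: "('s \<Rightarrow> 't \<Rightarrow>\<^sub>0 int) \<Rightarrow> ('s \<Rightarrow>\<^sub>0 'k::field) \<Rightarrow> 't \<Rightarrow>\<^sub>0 'k" where
  "chain_extend E c =
     (\<Sum>s\<in>Poly_Mapping.keys c. Poly_Mapping.map (\<lambda>m. of_int m * Poly_Mapping.lookup c s) (E s))"

text \<open>The finite index set is left free, so that operators applied to chains with different supports can
  be compared term by term.\<close>

lemma lookup_chain_extend:
  assumes "finite S" "Poly_Mapping.keys c \<subseteq> S"
  shows "Poly_Mapping.lookup (chain_extend E c) t =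
           (\<Sum>s\<in>S. of_int (Poly_Mapping.lookup (E s) t) * Poly_Mapping.lookup c s)"
proof -
  have "Poly_Mapping.lookup (chain_extend E c) t =
          (\<Sum>s\<in>Poly_Mapping.keys c. of_int (Poly_Mapping.lookup (E s) t) * Poly_Mapping.lookup c s)"
    by (simp add: chain_extend_def lookup_sum Poly_Mapping.map.rep_eq when_def if_distrib cong: if_cong)
       (auto intro!: sum.cong)
  also have "\<dots> = (\<Sum>s\<in>S. of_int (Poly_Mapping.lookup (E s) t) * Poly_Mapping.lookup c s)"
    by (rule sum.mono_neutral_left) (use assms in \<open>auto simp: in_keys_iff\<close>)
  finally show ?thesis .
qed

lemma chain_extend_add:
  "chain_extend E (c + d) = chain_extend E c + (chain_extend E d :: 't \<Rightarrow>\<^sub>0 'k::field)"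
proof (rule poly_mapping_eqI)
  fix t
  let ?S = "Poly_Mapping.keys c \<union> Poly_Mapping.keys d"
  have "finite ?S" "Poly_Mapping.keys (c + d) \<subseteq> ?S"
    by (auto simp: keys_add subset_iff in_keys_iff lookup_add)
  then show "Poly_Mapping.lookup (chain_extend E (c + d)) t =
               Poly_Mapping.lookup (chain_extend E c + chain_extend E d) t"
    by (simp add: lookup_chain_extend[where S = ?S] lookup_add algebra_simps sum.distrib)
qed

lemma chain_extend_scale:
  "chain_extend E (Poly_Mapping.map ((*) a) c) = Poly_Mapping.map ((*) a) (chain_extend E c)"
proof (rule poly_mapping_eqI)
  fix t
  have "Poly_Mapping.keys (Poly_Mapping.map ((*) a) c) \<subseteq> Poly_Mapping.keys c"
    by (auto simp: in_keys_iff lookup_scale)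
  then show "Poly_Mapping.lookup (chain_extend E (Poly_Mapping.map ((*) a) c)) t =
               Poly_Mapping.lookup (Poly_Mapping.map ((*) a) (chain_extend E c)) t"
    by (simp add: lookup_chain_extend[where S = "Poly_Mapping.keys c"] lookup_scale sum_distrib_left
          mult.left_commute)
qed

lemma chain_extend_zero [simp]: "chain_extend E 0 = 0"
  by (simp add: chain_extend_def)

lemma chain_extend_uminus: "chain_extend E (- c) = - chain_extend E c"
  by (metis add.right_inverse add_eq_0_iff chain_extend_add chain_extend_zero)

lemma chain_extend_diff: "chain_extend E (c - d) = chain_extend E c - chain_extend E d"
  by (metis add_uminus_conv_diff chain_extend_add chain_extend_uminus)

lemma chain_extend_cong:
  "(\<And>s. s \<in> Poly_Mapping.keys c \<Longrightarrow> E s = G s) \<Longrightarrow> chain_extend E c = chain_extend G c"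
  by (simp add: chain_extend_def)

lemma chain_extend_kernel_add:
  "chain_extend (\<lambda>s. E s + G s) c = chain_extend E c + chain_extend G c"
  by (rule poly_mapping_eqI)
     (simp add: lookup_chain_extend[OF finite_keys order.refl] lookup_add algebra_simps sum.distrib)

lemma chain_extend_kernel_diff:
  "chain_extend (\<lambda>s. E s - G s) c = chain_extend E c - chain_extend G c"
  by (rule poly_mapping_eqI)
     (simp add: lookup_chain_extend[OF finite_keys order.refl] lookup_minus algebra_simps sum_subtractf)

lemma chain_extend_kernel_zero [simp]: "chain_extend (\<lambda>s. 0) c = 0"
  by (rule poly_mapping_eqI) (simp add: lookup_chain_extend[OF finite_keys order.refl])

lemma chain_extend_frag_of [simp]: "chain_extend frag_of c = c"
proof (rule poly_mapping_eqI)
  fix t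
  let ?S = "insert t (Poly_Mapping.keys c)"
  have "Poly_Mapping.lookup (chain_extend frag_of c) t =
          (\<Sum>s\<in>?S. of_int (Poly_Mapping.lookup (frag_of s) t) * Poly_Mapping.lookup c s)"
    by (rule lookup_chain_extend) auto
  also have "\<dots> = (\<Sum>s\<in>?S. if t = s then Poly_Mapping.lookup c s else 0)"
    by (rule sum.cong) auto
  finally show "Poly_Mapping.lookup (chain_extend frag_of c) t = Poly_Mapping.lookup c t"
    by (simp only: sum.delta' finite_insert finite_keys insertI1 if_True)
qed

lemma keys_chain_extend:
  "Poly_Mapping.keys (chain_extend E c) \<subseteq> (\<Union>s\<in>Poly_Mapping.keys c. Poly_Mapping.keys (E s))"
proof
  fix t assume "t \<in> Poly_Mapping.keys (chain_extend E c)"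
  then have "(\<Sum>s\<in>Poly_Mapping.keys c. of_int (Poly_Mapping.lookup (E s) t) * Poly_Mapping.lookup c s) \<noteq> 0"
    by (simp add: in_keys_iff lookup_chain_extend[OF finite_keys order.refl])
  then obtain s where "s \<in> Poly_Mapping.keys c"
      "of_int (Poly_Mapping.lookup (E s) t) * Poly_Mapping.lookup c s \<noteq> 0"
    by (meson sum.neutral)
  then show "t \<in> (\<Union>s\<in>Poly_Mapping.keys c. Poly_Mapping.keys (E s))"
    by (auto simp: in_keys_iff intro!: bexI[of _ s])
qed

lemma lookup_frag_extend:
  assumes "finite S" "Poly_Mapping.keys c \<subseteq> S"
  shows "Poly_Mapping.lookup (frag_extend E c) t =
           (\<Sum>s\<in>S. Poly_Mapping.lookup c s * Poly_Mapping.lookup (E s) t)"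
  unfolding frag_extend_def lookup_sum lookup_frag_cmul
  by (rule sum.mono_neutral_left) (use assms in \<open>auto simp: in_keys_iff\<close>)

text \<open>Composites are computed integrally, one generator at a time.  An identity between integral
  operators on generators therefore holds for the operators on field chains.\<close>

lemma chain_extend_chain_extend:
  "chain_extend E (chain_extend G c) = chain_extend (\<lambda>s. frag_extend E (G s)) c"
proof (rule poly_mapping_eqI)
  fix u
  let ?T = "\<Union>s\<in>Poly_Mapping.keys c. Poly_Mapping.keys (G s)"
  have "Poly_Mapping.lookup (chain_extend E (chain_extend G c)) u =
          (\<Sum>t\<in>?T. of_int (Poly_Mapping.lookup (E t) u) *
             (\<Sum>s\<in>Poly_Mapping.keys c. of_int (Poly_Mapping.lookup (G s) t) * Poly_Mapping.lookup c s))"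
    by (subst lookup_chain_extend[where S = ?T])
       (simp_all add: lookup_chain_extend[where S = "Poly_Mapping.keys c"] keys_chain_extend)
  also have "\<dots> = (\<Sum>s\<in>Poly_Mapping.keys c. \<Sum>t\<in>?T.
               of_int (Poly_Mapping.lookup (G s) t * Poly_Mapping.lookup (E t) u) * Poly_Mapping.lookup c s)"
    by (subst sum.swap) (simp add: sum_distrib_left algebra_simps)
  also have "\<dots> = (\<Sum>s\<in>Poly_Mapping.keys c.
               of_int (Poly_Mapping.lookup (frag_extend E (G s)) u) * Poly_Mapping.lookup c s)"
  proof (intro sum.cong refl)
    fix s assume s: "s \<in> Poly_Mapping.keys c"
    have "Poly_Mapping.lookup (frag_extend E (G s)) u =
            (\<Sum>t\<in>?T. Poly_Mapping.lookup (G s) t * Poly_Mapping.lookup (E t) u)"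
      by (rule lookup_frag_extend) (use s in auto)
    then show "(\<Sum>t\<in>?T. of_int (Poly_Mapping.lookup (G s) t * Poly_Mapping.lookup (E t) u) *
                 Poly_Mapping.lookup c s) =
               of_int (Poly_Mapping.lookup (frag_extend E (G s)) u) * Poly_Mapping.lookup c s"
      by (simp add: sum_distrib_right)
  qed
  also have "\<dots> = Poly_Mapping.lookup (chain_extend (\<lambda>s. frag_extend E (G s)) c) u"
    by (simp add: lookup_chain_extend[OF finite_keys order.refl])
  finally show "Poly_Mapping.lookup (chain_extend E (chain_extend G c)) u =
                  Poly_Mapping.lookup (chain_extend (\<lambda>s. frag_extend E (G s)) c) u" .
qed

lemma map_of_int_frag_of:
  "Poly_Mapping.map (\<lambda>m. of_int m * (a::'k::field)) (frag_cmul n (frag_of t)) = Poly_Mapping.single t (of_int n * a)"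
  by (rule poly_mapping_eqI) (auto simp: Poly_Mapping.map.rep_eq when_def lookup_single)

lemma map_of_int_sum:
  "Poly_Mapping.map (\<lambda>m. of_int m * (a::'k::field)) (\<Sum>k\<in>A. g k) =
     (\<Sum>k\<in>A. Poly_Mapping.map (\<lambda>m. of_int m * a) (g k))"
proof (rule poly_mapping_eqI)
  fix t
  have *: "Poly_Mapping.lookup (Poly_Mapping.map (\<lambda>m. of_int m * a) d) t = of_int (Poly_Mapping.lookup d t) * a"
    for d :: "'a \<Rightarrow>\<^sub>0 int"
    by (simp add: Poly_Mapping.map.rep_eq when_def)
  show "Poly_Mapping.lookup (Poly_Mapping.map (\<lambda>m. of_int m * a) (\<Sum>k\<in>A. g k)) t =
        Poly_Mapping.lookup (\<Sum>k\<in>A. Poly_Mapping.map (\<lambda>m. of_int m * a) (g k)) t"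
    by (simp add: * lookup_sum sum_distrib_right)
qed

lemma field_boundary_eq_chain_extend:
  "field_boundary p = chain_extend (\<lambda>s. chain_boundary p (frag_of s))"
proof
  fix c :: "('a, 'b) field_chain"
  show "field_boundary p c = chain_extend (\<lambda>s. chain_boundary p (frag_of s)) c"
  proof (cases "p = 0")
    case True
    then have "chain_extend (\<lambda>s. chain_boundary p (frag_of s)) c = chain_extend (\<lambda>s. 0) c"
      by (intro chain_extend_cong) (simp add: chain_boundary_def)
    then show ?thesis
      using True by (simp add: field_boundary_def)
  qed (simp add: field_boundary_def chain_extend_def chain_boundary_of map_of_int_sum map_of_int_frag_of)
qed

lemma field_chain_map_eq_chain_extend:
  "field_chain_map p g = chain_extend (\<lambda>s. chain_map p g (frag_of s))"
  using map_of_int_frag_of[where n = 1]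
  by (simp add: fun_eq_iff field_chain_map_def chain_extend_def)

lemma frag_extend_chain_boundary:
  "frag_extend (\<lambda>s. chain_boundary p (frag_of s)) c = chain_boundary p c"
  by (cases "p = 0") (simp_all add: chain_boundary_def frag_extend_eq_0)

lemma frag_extend_chain_map:
  "frag_extend (\<lambda>s. chain_map p g (frag_of s)) c = chain_map p g c"
  by (simp add: chain_map_def comp_def)

lemmas field_boundary_add = chain_extend_add[of "\<lambda>s. chain_boundary p (frag_of s)" for p, folded field_boundary_eq_chain_extend]
lemmas field_boundary_diff = chain_extend_diff[of "\<lambda>s. chain_boundary p (frag_of s)" for p, folded field_boundary_eq_chain_extend]
lemmas field_boundary_uminus = chain_extend_uminus[of "\<lambda>s. chain_boundary p (frag_of s)" for p, folded field_boundary_eq_chain_extend]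
lemmas field_boundary_scale = chain_extend_scale[of "\<lambda>s. chain_boundary p (frag_of s)" for p, folded field_boundary_eq_chain_extend]
lemma field_boundary_zero [simp]: "field_boundary p 0 = 0"
  by (simp add: field_boundary_def)
lemma field_boundary_degree_0 [simp]: "field_boundary 0 c = 0"
  by (simp add: field_boundary_def)

lemmas field_chain_map_add = chain_extend_add[of "\<lambda>s. chain_map p g (frag_of s)" for p g, folded field_chain_map_eq_chain_extend]
lemmas field_chain_map_diff = chain_extend_diff[of "\<lambda>s. chain_map p g (frag_of s)" for p g, folded field_chain_map_eq_chain_extend]
lemmas field_chain_map_scale = chain_extend_scale[of "\<lambda>s. chain_map p g (frag_of s)" for p g, folded field_chain_map_eq_chain_extend]
lemma field_chain_map_zero [simp]: "field_chain_map p g 0 = 0"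
  by (simp add: field_chain_map_def)

lemma field_chains_add: "c \<in> field_chains p X \<Longrightarrow> d \<in> field_chains p X \<Longrightarrow> c + d \<in> field_chains p X"
  using keys_add[of c d] by (auto simp: field_chains_def)
lemma field_chains_uminus: "- c \<in> field_chains p X \<longleftrightarrow> c \<in> field_chains p X"
  by (auto simp: field_chains_def)
lemma field_chains_diff: "c \<in> field_chains p X \<Longrightarrow> d \<in> field_chains p X \<Longrightarrow> c - d \<in> field_chains p X"
  using keys_diff[of c d] by (auto simp: field_chains_def)
lemma field_chains_zero [simp]: "0 \<in> field_chains p X"
  by (simp add: field_chains_def)
lemma field_chains_scale: "c \<in> field_chains p X \<Longrightarrow> Poly_Mapping.map ((*) a) c \<in> field_chains p X"
  by (auto simp: field_chains_def in_keys_iff lookup_scale subset_iff)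

lemma chain_extend_in_field_chains:
  assumes "\<And>s. s \<in> Poly_Mapping.keys c \<Longrightarrow> singular_chain q Y (E s)"
  shows "chain_extend E c \<in> field_chains q Y"
  using keys_chain_extend[of E c] assms unfolding field_chains_def singular_chain_def by blast

lemma field_boundary_in_field_chains:
  assumes "c \<in> field_chains p X"
  shows "field_boundary p c \<in> field_chains (p - Suc 0) X"
  unfolding field_boundary_eq_chain_extend
  by (rule chain_extend_in_field_chains, rule singular_chain_boundary)
     (use assms in \<open>auto simp: field_chains_def singular_chain_of\<close>)

lemma field_chain_map_in_field_chains:
  assumes "c \<in> field_chains p X" "continuous_map X Y g"
  shows "field_chain_map p g c \<in> field_chains p Y"
  unfolding field_chain_map_eq_chain_extend
  by (rule chain_extend_in_field_chains, rule singular_chain_chain_map[OF _ assms(2)])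
     (use assms(1) in \<open>auto simp: field_chains_def singular_chain_of\<close>)

lemma field_boundary_boundary:
  assumes "c \<in> field_chains p X"
  shows "field_boundary (p - Suc 0) (field_boundary p c) = 0"
proof -
  have "field_boundary (p - Suc 0) (field_boundary p c) = chain_extend (\<lambda>s. 0) c"
    unfolding field_boundary_eq_chain_extend chain_extend_chain_extend frag_extend_chain_boundary
  proof (rule chain_extend_cong)
    fix s assume "s \<in> Poly_Mapping.keys c"
    then have "singular_chain p X (frag_of s)"
      using assms by (auto simp: field_chains_def singular_chain_of)
    then show "chain_boundary (p - Suc 0) (chain_boundary p (frag_of s)) = 0"
      by (rule chain_boundary_boundary)
  qed
  then show ?thesis by simp
qed

lemma field_boundary_chain_map:
  assumes "c \<in> field_chains p X"
  shows "field_boundary p (field_chain_map p g c) = field_chain_map (p - Suc 0) g (field_boundary p c)"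
  unfolding field_boundary_eq_chain_extend field_chain_map_eq_chain_extend chain_extend_chain_extend
    frag_extend_chain_boundary frag_extend_chain_map
  by (rule chain_extend_cong, rule chain_boundary_chain_map)
     (use assms in \<open>auto simp: field_chains_def singular_chain_of\<close>)

lemma field_chain_map_compose:
  "field_chain_map p h (field_chain_map p g c) = field_chain_map p (h \<circ> g) c"
  unfolding field_chain_map_eq_chain_extend chain_extend_chain_extend frag_extend_chain_map
  by (rule chain_extend_cong) (metis chain_map_compose comp_apply)

lemma field_chain_map_cong:
  assumes "c \<in> field_chains p X" "\<And>x. x \<in> topspace X \<Longrightarrow> g x = h x"
  shows "field_chain_map p g c = field_chain_map p h c"
  unfolding field_chain_map_eq_chain_extend
  by (rule chain_extend_cong, rule chain_map_eq[OF _ assms(2)])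
     (use assms(1) in \<open>auto simp: field_chains_def singular_chain_of\<close>)

lemma field_chains_mono:
  "c \<in> field_chains p (subtopology X S) \<Longrightarrow> S \<subseteq> T \<Longrightarrow> c \<in> field_chains p (subtopology X T)"
  using singular_simplex_mono by (fastforce simp: field_chains_def)

lemma field_chains_subtopology_imp: "c \<in> field_chains p (subtopology X S) \<Longrightarrow> c \<in> field_chains p X"
  by (auto simp: field_chains_def singular_simplex_subtopology)

lemma field_chains_Int:
  "c \<in> field_chains p (subtopology X S) \<Longrightarrow> c \<in> field_chains p (subtopology X T) \<Longrightarrow>
     c \<in> field_chains p (subtopology X (S \<inter> T))"
  unfolding field_chains_def by (fastforce simp: singular_simplex_subtopology)

section \<open>Chains subordinate to a cover by two open sets\<close>

text \<open>The homotopies provided by existence theorems are only known to be additive; this brings them into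
  the form to which \<open>chain_extend\<close> applies.\<close>

lemma frag_extend_generators:
  assumes "L 0 = 0" "\<And>c d. L (c - d) = L c - L d"
  shows "frag_extend (\<lambda>s. L (frag_of s)) c = L c"
  using subset_UNIV[of "Poly_Mapping.keys c"]
  by (induction c rule: frag_induction) (simp_all add: assms frag_extend_diff)

lemma split_chain:
  assumes "Poly_Mapping.keys c \<subseteq> A \<union> B"
  obtains c1 c2 where "c = c1 + (c2 :: 's \<Rightarrow>\<^sub>0 'k::field)" "Poly_Mapping.keys c1 \<subseteq> A" "Poly_Mapping.keys c2 \<subseteq> B"
proof
  let ?E = "\<lambda>s. if s \<in> A then frag_of s else 0" and ?G = "\<lambda>s. if s \<in> A then 0 else frag_of s"
  have "chain_extend ?E c + chain_extend ?G c = chain_extend frag_of c"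
    unfolding chain_extend_kernel_add[symmetric] by (rule chain_extend_cong) auto
  then show "c = chain_extend ?E c + chain_extend ?G c"
    by simp
  show "Poly_Mapping.keys (chain_extend ?E c) \<subseteq> A"
    by (rule order.trans[OF keys_chain_extend]) (auto split: if_splits)
  show "Poly_Mapping.keys (chain_extend ?G c) \<subseteq> B"
    by (rule order.trans[OF keys_chain_extend]) (use assms in \<open>auto split: if_splits\<close>)
qed

text \<open>The number of subdivisions is found on generators, since a chain with coefficients in \<open>'k\<close> has no
  integral chain behind it.\<close>

lemma subordinate_subdivision_exists:
  assumes "openin X U" "openin X V" "topspace X \<subseteq> U \<union> V" "c \<in> field_chains p X"
  obtains N where "\<And>s. s \<in> Poly_Mapping.keys c \<Longrightarrow>
      Poly_Mapping.keys ((singular_subdivision p ^^ N) (frag_of s)) \<subseteq>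
        singular_simplex_set p (subtopology X U) \<union> singular_simplex_set p (subtopology X V)"
proof -
  have "\<exists>n. \<forall>m\<ge>n. Poly_Mapping.keys ((singular_subdivision p ^^ m) (frag_of s)) \<subseteq>
        singular_simplex_set p (subtopology X U) \<union> singular_simplex_set p (subtopology X V)"
    if "s \<in> Poly_Mapping.keys c" for s
  proof -
    have s: "singular_chain p X (frag_of s)"
      using assms(4) that by (auto simp: field_chains_def singular_chain_of)
    obtain n where n: "\<And>m f. n \<le> m \<Longrightarrow> f \<in> Poly_Mapping.keys ((singular_subdivision p ^^ m) (frag_of s)) \<Longrightarrow>
        \<exists>W\<in>{U, V}. f \<in> standard_simplex p \<rightarrow> W"
      by (rule sufficient_iterated_singular_subdivision_exists[of "{U, V}" X p "frag_of s"])
         (use assms s in auto)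
    have "singular_chain p X ((singular_subdivision p ^^ m) (frag_of s))" for m
      by (induction m) (simp_all add: s singular_chain_singular_subdivision)
    then have simplex: "singular_simplex p X f" if "f \<in> Poly_Mapping.keys ((singular_subdivision p ^^ m) (frag_of s))" for m f
      using that by (auto simp: singular_chain_def)
    show ?thesis
    proof (intro exI[of _ n] allI impI subsetI)
      fix m f assume m: "n \<le> m" and f: "f \<in> Poly_Mapping.keys ((singular_subdivision p ^^ m) (frag_of s))"
      obtain W where "W = U \<or> W = V" "f ` standard_simplex p \<subseteq> W"
        using n[OF m f] by blast
      then show "f \<in> singular_simplex_set p (subtopology X U) \<union> singular_simplex_set p (subtopology X V)"
        using simplex[OF f] by (auto simp: singular_simplex_subtopology)
    qed
  qed
  then obtain n where n: "\<And>s m. s \<in> Poly_Mapping.keys c \<Longrightarrow> m \<ge> n s \<Longrightarrow>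
      Poly_Mapping.keys ((singular_subdivision p ^^ m) (frag_of s)) \<subseteq>
        singular_simplex_set p (subtopology X U) \<union> singular_simplex_set p (subtopology X V)"
    by metis
  \<comment> \<open>Finer subdivisions stay subordinate, so a common bound of the individual numbers serves.\<close>
  have "n s \<le> sum n (Poly_Mapping.keys c)" if "s \<in> Poly_Mapping.keys c" for s
    using that by (simp add: member_le_sum)
  then show ?thesis
    using n that by blast
qed

text \<open>Iterated subdivision is chain homotopic to the identity.  The homotopy preserves chains of any
  subspace, so it takes a subordinate boundary to a subordinate chain, and the remaining error is a
  boundary.  Requiring the boundary to be subordinate, rather than zero, is what makes the lemma
  applicable to the second component of a cycle in a mapping cone.\<close>

lemma small_chain_approximation:
  fixes z :: "('x, 'k::field) field_chain"
  assumes U: "openin X U" and V: "openin X V" and cover: "topspace X \<subseteq> U \<union> V"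
    and z: "z \<in> field_chains p X"
    and bz: "field_boundary p z = x + y"
    and x: "x \<in> field_chains (p - Suc 0) (subtopology X U)"
    and y: "y \<in> field_chains (p - Suc 0) (subtopology X V)"
  obtains b z1 z2 where "b \<in> field_chains (Suc p) X"
    "z1 \<in> field_chains p (subtopology X U)" "z2 \<in> field_chains p (subtopology X V)"
    "z = z1 + z2 + field_boundary (Suc p) b"
proof -
  obtain N where N: "\<And>s. s \<in> Poly_Mapping.keys z \<Longrightarrow>
      Poly_Mapping.keys ((singular_subdivision p ^^ N) (frag_of s)) \<subseteq>
        singular_simplex_set p (subtopology X U) \<union> singular_simplex_set p (subtopology X V)"
    by (rule subordinate_subdivision_exists[OF U V cover z]) blast
  obtain h :: "nat \<Rightarrow> 'x chain \<Rightarrow> 'x chain" where h0: "\<And>p. h p 0 = 0"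
    and hd: "\<And>p c d. h p (c - d) = h p c - h p d"
    and hX: "\<And>p X c. singular_chain p X c \<Longrightarrow> singular_chain (Suc p) X (h p c)"
    and hb: "\<And>p X c. singular_chain p X c \<Longrightarrow>
        chain_boundary (Suc p) (h p c) + h (p - Suc 0) (chain_boundary p c) = (singular_subdivision p ^^ N) c - c"
    by (rule chain_homotopic_iterated_singular_subdivision[of N]) blast
  define H :: "nat \<Rightarrow> ('x, 'k) field_chain \<Rightarrow> ('x, 'k) field_chain"
    where "H q = chain_extend (\<lambda>s. h q (frag_of s))" for q
  define sd where "sd = chain_extend (\<lambda>s. (singular_subdivision p ^^ N) (frag_of s)) z"
  have H: "H q c \<in> field_chains (Suc q) T" if "c \<in> field_chains q T" for q c and T :: "'x topology"
    unfolding H_def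
    by (rule chain_extend_in_field_chains, rule hX)
       (use that in \<open>auto simp: field_chains_def singular_chain_of\<close>)
  have "field_boundary (Suc p) (H p z) + H (p - Suc 0) (field_boundary p z) = sd - chain_extend frag_of z"
    unfolding H_def sd_def field_boundary_eq_chain_extend chain_extend_chain_extend
      frag_extend_chain_boundary frag_extend_generators[of "h q" for q, OF h0 hd]
      chain_extend_kernel_add[symmetric] chain_extend_kernel_diff[symmetric]
    by (rule chain_extend_cong, rule hb)
       (use z in \<open>auto simp: field_chains_def singular_chain_of\<close>)
  then have homotopy: "z = sd - H (p - Suc 0) (field_boundary p z) - field_boundary (Suc p) (H p z)"
    by (simp add: algebra_simps)
  have "Poly_Mapping.keys sd \<subseteq>
      singular_simplex_set p (subtopology X U) \<union> singular_simplex_set p (subtopology X V)"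
    unfolding sd_def by (rule order.trans[OF keys_chain_extend]) (use N in blast)
  then obtain s1 s2 where s: "sd = s1 + s2" "s1 \<in> field_chains p (subtopology X U)"
      "s2 \<in> field_chains p (subtopology X V)"
    unfolding field_chains_def by (rule split_chain) blast
  obtain x' y' where xy: "H (p - Suc 0) (field_boundary p z) = x' + y'"
      "x' \<in> field_chains p (subtopology X U)" "y' \<in> field_chains p (subtopology X V)"
  proof (cases p)
    case 0
    \<comment> \<open>Truncated subtraction would give this term degree 1, but the boundary it is applied to vanishes.\<close>
    then have "H (p - Suc 0) (field_boundary p z) = 0 + 0"
      by (simp add: H_def)
    then show ?thesis
      using that field_chains_zero by blast
  next
    case (Suc q)
    have "H (p - Suc 0) (field_boundary p z) = H q x + H q y"
      unfolding bz by (simp add: Suc H_def chain_extend_add)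
    then show ?thesis
      by (rule that) (use H[of x q] H[of y q] x y Suc in simp_all)
  qed
  show ?thesis
  proof
    show "- H p z \<in> field_chains (Suc p) X"
      using H z by (simp add: field_chains_uminus)
    show "s1 - x' \<in> field_chains p (subtopology X U)" "s2 - y' \<in> field_chains p (subtopology X V)"
      using s xy by (simp_all add: field_chains_diff)
    show "z = (s1 - x') + (s2 - y') + field_boundary (Suc p) (- H p z)"
      using homotopy unfolding xy(1) s(1) field_boundary_uminus
      by (simp add: algebra_simps)
  qed
qed

section \<open>Acyclic mapping cones\<close>

text \<open>A chain of degree \<open>p\<close> in the mapping cone of the chain map induced by \<open>q\<close> is a pair of chains
  \<open>w\<close> of \<open>X\<close> in degree \<open>p - 1\<close> and \<open>z\<close> of \<open>Y\<close> in degree \<open>p\<close>, with boundary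
  \<open>(\<partial> w, q w - \<partial> z)\<close>.  The condition says that every cycle is the boundary of a pair \<open>(a, - b)\<close>.
  In degree 0 the first component has degree \<open>-1\<close>, hence is required to vanish.  The type argument
  fixes the field of coefficients.\<close>

definition mapping_cone_acyclic :: "'k::field itself \<Rightarrow> 'x topology \<Rightarrow> 'y topology \<Rightarrow> ('x \<Rightarrow> 'y) \<Rightarrow> bool" where
  "mapping_cone_acyclic _ X Y q \<longleftrightarrow>
     (\<forall>p. \<forall>w\<in>field_chains (p - Suc 0) X. \<forall>z\<in>field_chains p Y.
        (p = 0 \<longrightarrow> w = 0) \<and> field_boundary (p - Suc 0) w = 0 \<and>
        field_boundary p z = field_chain_map (p - Suc 0) q w \<longrightarrow>
        (\<exists>a\<in>field_chains p X. \<exists>b\<in>field_chains (Suc p) Y.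
           field_boundary p a = w \<and> z = field_chain_map p q a + field_boundary (Suc p) (b :: ('y, 'k) field_chain)))"

lemma mapping_cone_acyclicE:
  fixes z :: "('y, 'k::field) field_chain"
  assumes "mapping_cone_acyclic TYPE('k) X Y q" "w \<in> field_chains (p - Suc 0) X" "z \<in> field_chains p Y"
    "p = 0 \<Longrightarrow> w = 0" "field_boundary (p - Suc 0) w = 0" "field_boundary p z = field_chain_map (p - Suc 0) q w"
  obtains a b where "a \<in> field_chains p X" "b \<in> field_chains (Suc p) Y" "field_boundary p a = w"
    "z = field_chain_map p q a + field_boundary (Suc p) b"
proof -
  have "\<exists>a\<in>field_chains p X. \<exists>b\<in>field_chains (Suc p) Y.
          field_boundary p a = w \<and> z = field_chain_map p q a + field_boundary (Suc p) b"
    by (rule assms(1)[unfolded mapping_cone_acyclic_def, rule_format, OF assms(2,3)])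
       (intro conjI impI assms(4-))
  then show ?thesis
    using that by (elim bexE conjE)
qed

lemma mapping_cone_acyclic_empty:
  fixes X :: "'x topology" and Y :: "'y topology"
  assumes "topspace X = {}" "topspace Y = {}"
  shows "mapping_cone_acyclic TYPE('k::field) X Y q"
proof -
  have *: "singular_simplex_set p X = {}" "singular_simplex_set p Y = {}" for p
    using assms singular_simplex_empty by blast+
  have "field_chains p X = ({0} :: ('x, 'k) field_chain set)" "field_chains p Y = ({0} :: ('y, 'k) field_chain set)" for p
    by (simp_all add: field_chains_def *)
  then show ?thesis
    by (simp add: mapping_cone_acyclic_def)
qed

lemma diff_eq_diff_if_add_eq:
  fixes a b c d :: "'g::ab_group_add"
  assumes "a + b = c + d"
  shows "c - a = b - d"
proof -
  have "c = a + b - d"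
    by (simp add: assms)
  then show ?thesis
    by simp
qed

text \<open>The Mayer--Vietoris step.  A cycle of the cone may be taken subordinate to the cover, as a sum
  \<open>c + d\<close> of parts over the two sets.  Their boundaries are opposite, so they lie over the
  intersection, where acyclicity provides \<open>e\<close> with the same boundary as \<open>c\<close>.  Then \<open>c - e\<close> and
  \<open>d + e\<close> are cycles over the two sets, and they bound there.\<close>

lemma mapping_cone_acyclic_union:
  fixes X :: "'x topology" and Y :: "'y topology"
  assumes Y: "openin Y U" "openin Y V" "topspace Y \<subseteq> U \<union> V"
    and X: "openin X U'" "openin X V'" "topspace X \<subseteq> U' \<union> V'"
    and q: "continuous_map X Y q"
    and qU: "continuous_map (subtopology X U') (subtopology Y U) q"
    and qV: "continuous_map (subtopology X V') (subtopology Y V) q"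
    and acU: "mapping_cone_acyclic TYPE('k::field) (subtopology X U') (subtopology Y U) q"
    and acV: "mapping_cone_acyclic TYPE('k) (subtopology X V') (subtopology Y V) q"
    and acI: "mapping_cone_acyclic TYPE('k) (subtopology X (U' \<inter> V')) (subtopology Y (U \<inter> V)) q"
  shows "mapping_cone_acyclic TYPE('k) X Y q"
  unfolding mapping_cone_acyclic_def
proof (intro allI ballI impI, elim conjE)
  fix p and w :: "('x, 'k) field_chain" and z :: "('y, 'k) field_chain"
  assume w: "w \<in> field_chains (p - Suc 0) X" and z: "z \<in> field_chains p Y" and w0: "p = 0 \<longrightarrow> w = 0"
    and bw: "field_boundary (p - Suc 0) w = 0" and bz: "field_boundary p z = field_chain_map (p - Suc 0) q w"
  \<comment> \<open>The two components are made subordinate one after the other: correcting \<open>w\<close> by the boundary of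
    \<open>a0\<close> changes \<open>z\<close> by the image of \<open>a0\<close>, and only then is the boundary of the second component
    subordinate.\<close>
  obtain a0 w1 w2 where a0: "a0 \<in> field_chains p X" and w1: "w1 \<in> field_chains (p - Suc 0) (subtopology X U')"
      and w2: "w2 \<in> field_chains (p - Suc 0) (subtopology X V')" and w_eq: "w = w1 + w2 + field_boundary p a0"
      and w12: "p = 0 \<Longrightarrow> w1 = 0 \<and> w2 = 0"
  proof (cases p)
    case 0
    show ?thesis
      by (rule that[of 0 0 0]) (use w0 0 in auto)
  next
    case (Suc r)
    have "w \<in> field_chains r X" "field_boundary r w = 0 + 0"
      using w bw Suc by simp_all
    then obtain b z1 z2 where "b \<in> field_chains (Suc r) X" "z1 \<in> field_chains r (subtopology X U')"
        "z2 \<in> field_chains r (subtopology X V')" "w = z1 + z2 + field_boundary (Suc r) b"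
      by (rule small_chain_approximation[OF X _ _ field_chains_zero field_chains_zero])
    then show ?thesis
      using that[of b z1 z2] Suc by simp
  qed
  define z' where "z' = z - field_chain_map p q a0"
  have z': "z' \<in> field_chains p Y"
    unfolding z'_def by (intro field_chains_diff z field_chain_map_in_field_chains[OF a0 q])
  have bz': "field_boundary p z' = field_chain_map (p - Suc 0) q w1 + field_chain_map (p - Suc 0) q w2"
    unfolding z'_def field_boundary_diff bz field_boundary_chain_map[OF a0]
    by (simp add: w_eq field_chain_map_add)
  obtain b0 z1 z2 where b0: "b0 \<in> field_chains (Suc p) Y" and z1: "z1 \<in> field_chains p (subtopology Y U)"
      and z2: "z2 \<in> field_chains p (subtopology Y V)" and z'_eq: "z' = z1 + z2 + field_boundary (Suc p) b0"
    by (rule small_chain_approximation[OF Y z' bz' field_chain_map_in_field_chains[OF w1 qU]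
      field_chain_map_in_field_chains[OF w2 qV]])
  \<comment> \<open>\<open>(s, t)\<close> is the boundary in the cone of the part \<open>(w1, z1)\<close> over the first set; \<open>s2\<close> and \<open>t2\<close>
    express it through the part over the second set.\<close>
  define s t where "s = field_boundary (p - Suc 0) w1"
    and "t = field_chain_map (p - Suc 0) q w1 - field_boundary p z1"
  have "field_boundary (p - Suc 0) (field_boundary p a0) = 0"
    by (rule field_boundary_boundary[OF a0])
  then have s2: "s = - field_boundary (p - Suc 0) w2"
    using bw by (simp add: s_def w_eq field_boundary_add eq_neg_iff_add_eq_0)
  have "field_boundary p (field_boundary (Suc p) b0) = 0"
    using field_boundary_boundary[OF b0] by simp
  then have "field_boundary p z1 + field_boundary p z2 = field_chain_map (p - Suc 0) q w1 + field_chain_map (p - Suc 0) q w2"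
    using bz' by (simp add: z'_eq field_boundary_add)
  then have t2: "t = field_boundary p z2 - field_chain_map (p - Suc 0) q w2"
    unfolding t_def by (rule diff_eq_diff_if_add_eq)
  have s: "s \<in> field_chains (p - Suc 0 - Suc 0) (subtopology X (U' \<inter> V'))"
  proof (rule field_chains_Int)
    show "s \<in> field_chains (p - Suc 0 - Suc 0) (subtopology X U')"
      unfolding s_def by (rule field_boundary_in_field_chains[OF w1])
    show "s \<in> field_chains (p - Suc 0 - Suc 0) (subtopology X V')"
      unfolding s2 field_chains_uminus by (rule field_boundary_in_field_chains[OF w2])
  qed
  have t: "t \<in> field_chains (p - Suc 0) (subtopology Y (U \<inter> V))"
  proof (rule field_chains_Int)
    show "t \<in> field_chains (p - Suc 0) (subtopology Y U)"
      unfolding t_def by (intro field_chains_diff field_chain_map_in_field_chains[OF w1 qU] field_boundary_in_field_chains z1)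
    show "t \<in> field_chains (p - Suc 0) (subtopology Y V)"
      unfolding t2 by (intro field_chains_diff field_chain_map_in_field_chains[OF w2 qV] field_boundary_in_field_chains z2)
  qed
  have bs: "field_boundary (p - Suc 0 - Suc 0) s = 0"
    unfolding s_def by (rule field_boundary_boundary[OF w1])
  have bt: "field_boundary (p - Suc 0) t = field_chain_map (p - Suc 0 - Suc 0) q s"
    unfolding t_def s_def field_boundary_diff field_boundary_chain_map[OF w1] by (simp add: field_boundary_boundary[OF z1])
  obtain e f where e: "e \<in> field_chains (p - Suc 0) (subtopology X (U' \<inter> V'))"
      and f: "f \<in> field_chains p (subtopology Y (U \<inter> V))"
      and se: "field_boundary (p - Suc 0) e = s" and tf: "t = field_chain_map (p - Suc 0) q e + field_boundary p f"
      and e0: "p = 0 \<Longrightarrow> e = 0"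
  proof (cases p)
    case 0
    show ?thesis
      by (rule that[of 0 0]) (use 0 w12 in \<open>auto simp: s_def t_def\<close>)
  next
    case (Suc r)
    obtain a b where "a \<in> field_chains (p - Suc 0) (subtopology X (U' \<inter> V'))"
        "b \<in> field_chains (Suc (p - Suc 0)) (subtopology Y (U \<inter> V))" "field_boundary (p - Suc 0) a = s"
        "t = field_chain_map (p - Suc 0) q a + field_boundary (Suc (p - Suc 0)) b"
      by (rule mapping_cone_acyclicE[OF acI s t _ bs bt]) (auto simp: s_def)
    then show ?thesis
      using that Suc by simp
  qed
  have bf: "field_boundary p f = t - field_chain_map (p - Suc 0) q e"
    by (simp add: tf)
  have eU: "e \<in> field_chains (p - Suc 0) (subtopology X U')" and eV: "e \<in> field_chains (p - Suc 0) (subtopology X V')"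
    using e by (auto elim: field_chains_mono)
  have fU: "f \<in> field_chains p (subtopology Y U)" and fV: "f \<in> field_chains p (subtopology Y V)"
    using f by (auto elim: field_chains_mono)
  obtain a1 b1 where a1: "a1 \<in> field_chains p (subtopology X U')" "b1 \<in> field_chains (Suc p) (subtopology Y U)"
      "field_boundary p a1 = w1 - e" "z1 + f = field_chain_map p q a1 + field_boundary (Suc p) b1"
  proof (rule mapping_cone_acyclicE[OF acU])
    show "w1 - e \<in> field_chains (p - Suc 0) (subtopology X U')" by (intro field_chains_diff w1 eU)
    show "z1 + f \<in> field_chains p (subtopology Y U)" by (intro field_chains_add z1 fU)
    show "field_boundary (p - Suc 0) (w1 - e) = 0" by (simp add: field_boundary_diff se s_def)
    show "field_boundary p (z1 + f) = field_chain_map (p - Suc 0) q (w1 - e)"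
      by (simp add: bf t_def field_boundary_add field_chain_map_diff)
  qed (simp_all add: w12 e0)
  obtain a2 b2 where a2: "a2 \<in> field_chains p (subtopology X V')" "b2 \<in> field_chains (Suc p) (subtopology Y V)"
      "field_boundary p a2 = w2 + e" "z2 - f = field_chain_map p q a2 + field_boundary (Suc p) b2"
  proof (rule mapping_cone_acyclicE[OF acV])
    show "w2 + e \<in> field_chains (p - Suc 0) (subtopology X V')" by (intro field_chains_add w2 eV)
    show "z2 - f \<in> field_chains p (subtopology Y V)" by (intro field_chains_diff z2 fV)
    show "field_boundary (p - Suc 0) (w2 + e) = 0" by (simp add: field_boundary_add se s2)
    show "field_boundary p (z2 - f) = field_chain_map (p - Suc 0) q (w2 + e)"
      by (simp add: bf t2 field_boundary_diff field_chain_map_add)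
  qed (simp_all add: w12 e0)
  show "\<exists>a\<in>field_chains p X. \<exists>b\<in>field_chains (Suc p) Y.
          field_boundary p a = w \<and> z = field_chain_map p q a + field_boundary (Suc p) b"
  proof (intro bexI conjI)
    show "field_boundary p (a0 + a1 + a2) = w"
      by (simp add: field_boundary_add a1(3) a2(3) w_eq)
    have "z = field_chain_map p q a0 + (z1 + f) + (z2 - f) + field_boundary (Suc p) b0"
      using z'_eq by (simp add: z'_def diff_eq_eq add_ac)
    then show "z = field_chain_map p q (a0 + a1 + a2) + field_boundary (Suc p) (b0 + b1 + b2)"
      unfolding a1(4) a2(4) field_chain_map_add field_boundary_add by (simp add: add_ac)
    show "a0 + a1 + a2 \<in> field_chains p X"
      using a0 a1(1) a2(1) by (intro field_chains_add) (auto dest: field_chains_subtopology_imp)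
    show "b0 + b1 + b2 \<in> field_chains (Suc p) Y"
      using b0 a1(2) a2(2) by (intro field_chains_add) (auto dest: field_chains_subtopology_imp)
  qed
qed

section \<open>Contractible spaces\<close>

lemma chain_boundary_frag_extend:
  "chain_boundary p (frag_extend f c) = frag_extend (\<lambda>t. chain_boundary p (f t)) c"
  by (simp add: frag_extend_def chain_boundary_sum chain_boundary_cmul)

lemma frag_extend_frag_extend:
  "frag_extend f (frag_extend g c) = frag_extend (\<lambda>t. frag_extend f (g t)) c"
proof -
  have "frag_extend f (frag_extend g c) =
          (\<Sum>t\<in>Poly_Mapping.keys c. frag_extend f (frag_cmul (Poly_Mapping.lookup c t) (g t)))"
    unfolding frag_extend_def[of g] by (subst frag_extend_sum) (simp_all add: comp_def)
  then show ?thesis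
    unfolding frag_extend_cmul by (simp only: frag_extend_def[of "\<lambda>t. frag_extend f (g t)"])
qed

lemma frag_extend_kernel_diff:
  "frag_extend (\<lambda>t. f t - g t) c = frag_extend f c - frag_extend g c"
  using subset_UNIV[of "Poly_Mapping.keys c"]
  by (induction c rule: frag_induction) (simp_all add: frag_extend_diff)

lemma homologous_to_constant:
  assumes hom: "homotopic_with (\<lambda>x. True) X X id (\<lambda>x. a)" and c: "singular_relcycle p X {} c"
  obtains d where "singular_chain (Suc p) X d" "chain_boundary (Suc p) d = c - chain_map p (\<lambda>x. a) c"
proof -
  have "homologous_rel p X {} (chain_map p id c) (chain_map p (\<lambda>x. a) c)"
    by (rule homotopic_imp_homologous_rel_chain_maps[OF _ c]) (use hom in simp)
  moreover have "chain_map p id c = c"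
    using c by (intro chain_map_ident[of p X]) (simp add: singular_cycle)
  ultimately show ?thesis
    using that by (auto simp: homologous_rel_def singular_boundary)
qed

text \<open>The cycle is homologous to its image under a constant map, and cycles of positive degree in a
  one-point space bound.\<close>

lemma contractible_cycle_bounds:
  assumes hom: "homotopic_with (\<lambda>x. True) X X id (\<lambda>x. a)" and a: "a \<in> topspace X"
    and c: "singular_chain (Suc p) X c" "chain_boundary (Suc p) c = 0"
  shows "\<exists>d. singular_chain (Suc (Suc p)) X d \<and> chain_boundary (Suc (Suc p)) d = c"
proof -
  let ?P = "subtopology X {a}"
  have cyc: "singular_relcycle (Suc p) X {} c"
    using c by (simp add: singular_cycle)
  obtain d where d: "singular_chain (Suc (Suc p)) X d"
      "chain_boundary (Suc (Suc p)) d = c - chain_map (Suc p) (\<lambda>x. a) c"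
    using homologous_to_constant[OF hom cyc] .
  have "singular_relcycle (Suc p) ?P {} (chain_map (Suc p) (\<lambda>x. a) c)"
    by (rule singular_relcycle_chain_map[OF cyc]) (use a in \<open>auto simp: continuous_map_in_subtopology\<close>)
  then have "singular_relboundary (Suc p) ?P {} (chain_map (Suc p) (\<lambda>x. a) c)"
    using a by (subst singular_boundary_eq_cycle_singleton[where a = a]) auto
  then obtain e where e: "singular_chain (Suc (Suc p)) ?P e"
      "chain_boundary (Suc (Suc p)) e = chain_map (Suc p) (\<lambda>x. a) c"
    by (auto simp: singular_boundary)
  have "singular_chain (Suc (Suc p)) X (d + e)"
    using d(1) e(1) by (intro singular_chain_add) (auto simp: singular_chain_subtopology)
  moreover have "chain_boundary (Suc (Suc p)) (d + e) = c"
    by (simp add: chain_boundary_add d e)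
  ultimately show ?thesis
    by blast
qed

text \<open>The vanishing of integral homology says nothing directly about a cycle with coefficients in a
  field, which need not come from integral cycles; a contracting homotopy extends to it.  It is built by recursion on the degree, choosing a chain that bounds the cycle \<open>\<sigma> - h (\<partial> \<sigma>)\<close> for every
  simplex \<open>\<sigma>\<close>.\<close>

lemma integral_contraction:
  fixes X :: "'x topology"
  assumes hom: "homotopic_with (\<lambda>x. True) X X id (\<lambda>x. a)" and a: "a \<in> topspace X"
  obtains h :: "nat \<Rightarrow> ((nat \<Rightarrow> real) \<Rightarrow> 'x) \<Rightarrow> 'x chain" where
    "\<And>p s. singular_simplex p X s \<Longrightarrow> singular_chain (Suc p) X (h p s)"
    "\<And>s. singular_simplex 0 X s \<Longrightarrow> chain_boundary 1 (h 0 s) = frag_of s - chain_map 0 (\<lambda>x. a) (frag_of s)"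
    "\<And>p s. singular_simplex (Suc p) X s \<Longrightarrow>
       chain_boundary (Suc (Suc p)) (h (Suc p) s) = frag_of s - frag_extend (h p) (chain_boundary (Suc p) (frag_of s))"
proof -
  define pick :: "nat \<Rightarrow> 'x chain \<Rightarrow> 'x chain"
    where "pick p c = (SOME d. singular_chain (Suc p) X d \<and> chain_boundary (Suc p) d = c)" for p c
  define h :: "nat \<Rightarrow> ((nat \<Rightarrow> real) \<Rightarrow> 'x) \<Rightarrow> 'x chain"
    where "h = rec_nat (\<lambda>s. pick 0 (frag_of s - chain_map 0 (\<lambda>x. a) (frag_of s)))
      (\<lambda>p hp s. pick (Suc p) (frag_of s - frag_extend hp (chain_boundary (Suc p) (frag_of s))))"
  \<comment> \<open>The values of \<open>id - \<partial> h\<close>: the homotopy contracts onto the constant map in degree 0.\<close>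
  define K where "K p s = (case p of 0 \<Rightarrow> chain_map 0 (\<lambda>x. a) (frag_of s)
      | Suc r \<Rightarrow> frag_extend (h r) (chain_boundary p (frag_of s)))" for p s
  have K_0: "K 0 = (\<lambda>s. chain_map 0 (\<lambda>x. a) (frag_of s))"
    and K_Suc: "K (Suc r) = (\<lambda>s. frag_extend (h r) (chain_boundary (Suc r) (frag_of s)))" for r
    by (simp_all add: K_def fun_eq_iff)
  have h_eq: "h p s = pick p (frag_of s - K p s)" for p s
    by (cases p) (simp_all add: h_def K_def)
  have main: "\<forall>s. singular_simplex p X s \<longrightarrow>
      singular_chain (Suc p) X (h p s) \<and> chain_boundary (Suc p) (h p s) = frag_of s - K p s" for p
  proof (induction p)
    case 0
    show ?case
    proof (intro allI impI)
      fix s assume "singular_simplex 0 X s"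
      then have "singular_relcycle 0 X {} (frag_of s)"
        by (simp add: singular_cycle singular_chain_of chain_boundary_def)
      then obtain d where "singular_chain (Suc 0) X d" "chain_boundary (Suc 0) d = frag_of s - K 0 s"
        unfolding K_0 by (rule homologous_to_constant[OF hom])
      then have "\<exists>d. singular_chain (Suc 0) X d \<and> chain_boundary (Suc 0) d = frag_of s - K 0 s"
        by blast
      then show "singular_chain (Suc 0) X (h 0 s) \<and> chain_boundary (Suc 0) (h 0 s) = frag_of s - K 0 s"
        unfolding h_eq[of 0] pick_def by (rule someI_ex)
    qed
  next
    case (Suc p)
    show ?case
    proof (intro allI impI)
      fix s assume "singular_simplex (Suc p) X s"
      then have s: "singular_chain (Suc p) X (frag_of s)"
        by (simp add: singular_chain_of)
      let ?e = "chain_boundary (Suc p) (frag_of s)"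
      have e: "singular_chain p X ?e"
        using singular_chain_boundary_alt[OF s] .
      then have face: "singular_simplex p X t" if "t \<in> Poly_Mapping.keys ?e" for t
        using that by (auto simp: singular_chain_def)
      \<comment> \<open>This makes \<open>s - K (Suc p) s\<close> a cycle, so that it can be filled.\<close>
      have K_e: "frag_extend (K p) ?e = 0"
      proof (cases p)
        case 0
        have "frag_extend (K p) ?e = chain_map 0 (\<lambda>x. a) ?e"
          unfolding 0 K_0 by (rule frag_extend_chain_map)
        also have "\<dots> = chain_boundary 1 (chain_map 1 (\<lambda>x. a) (frag_of s))"
          using chain_boundary_chain_map[OF s, where g = "\<lambda>x. a"] 0 by simp
        also have "\<dots> = 0"
        proof -
          have "singular_chain 1 (subtopology X {a}) (chain_map 1 (\<lambda>x. a) (frag_of s))"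
            using s 0 a by (intro singular_chain_chain_map[of 1 X]) (auto simp: continuous_map_in_subtopology)
          then show ?thesis
            using a by (subst chain_boundary_of_singleton[where a = a]) auto
        qed
        finally show ?thesis .
      next
        case (Suc r)
        have "frag_extend (K p) ?e = frag_extend (h r) (chain_boundary p ?e)"
          unfolding Suc K_Suc frag_extend_frag_extend[symmetric] frag_extend_chain_boundary ..
        also have "chain_boundary p ?e = 0"
          using chain_boundary_boundary[OF s] by simp
        finally show ?thesis by simp
      qed
      have "chain_boundary (Suc p) (K (Suc p) s) = frag_extend (\<lambda>t. chain_boundary (Suc p) (h p t)) ?e"
        by (simp add: K_def chain_boundary_frag_extend)
      also have "\<dots> = frag_extend (\<lambda>t. frag_of t - K p t) ?e"
        by (rule frag_extend_eq) (use Suc.IH face in blast)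
      also have "\<dots> = ?e"
        by (simp add: frag_extend_kernel_diff K_e flip: frag_expansion)
      finally have "chain_boundary (Suc p) (frag_of s - K (Suc p) s) = 0"
        by (simp add: chain_boundary_diff)
      moreover have "singular_chain (Suc p) X (frag_of s - K (Suc p) s)"
        using Suc.IH face by (auto simp: K_def intro!: singular_chain_diff s singular_chain_extend)
      ultimately have "\<exists>d. singular_chain (Suc (Suc p)) X d \<and> chain_boundary (Suc (Suc p)) d = frag_of s - K (Suc p) s"
        using contractible_cycle_bounds[OF hom a] by blast
      then show "singular_chain (Suc (Suc p)) X (h (Suc p) s) \<and>
          chain_boundary (Suc (Suc p)) (h (Suc p) s) = frag_of s - K (Suc p) s"
        unfolding h_eq[of "Suc p"] pick_def by (rule someI_ex)
    qed
  qed
  show ?thesis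
  proof (rule that[of h])
    show "singular_chain (Suc p) X (h p s)" if "singular_simplex p X s" for p s
      using main that by blast
    show "chain_boundary 1 (h 0 s) = frag_of s - chain_map 0 (\<lambda>x. a) (frag_of s)" if "singular_simplex 0 X s" for s
      using main[of 0] that by (simp add: K_def)
    show "chain_boundary (Suc (Suc p)) (h (Suc p) s) = frag_of s - frag_extend (h p) (chain_boundary (Suc p) (frag_of s))"
      if "singular_simplex (Suc p) X s" for p s
      using main[of "Suc p"] that by (simp add: K_def)
  qed
qed

lemma field_contraction:
  fixes X :: "'x topology"
  assumes "contractible_space X" and a: "a \<in> topspace X"
  obtains H :: "nat \<Rightarrow> ('x, 'k::field) field_chain \<Rightarrow> ('x, 'k) field_chain" where
    "\<And>p c. c \<in> field_chains p X \<Longrightarrow> H p c \<in> field_chains (Suc p) X"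
    "\<And>c. c \<in> field_chains 0 X \<Longrightarrow> c = field_boundary 1 (H 0 c) + field_chain_map 0 (\<lambda>x. a) c"
    "\<And>p c. c \<in> field_chains p X \<Longrightarrow> p > 0 \<Longrightarrow> field_boundary p c = 0 \<Longrightarrow> c = field_boundary (Suc p) (H p c)"
proof -
  have hom: "homotopic_with (\<lambda>x. True) X X id (\<lambda>x. a)"
    using assms(1)[unfolded contractible_space_alt] a by (rule bspec)
  obtain h :: "nat \<Rightarrow> ((nat \<Rightarrow> real) \<Rightarrow> 'x) \<Rightarrow> 'x chain" where
    h: "\<And>p s. singular_simplex p X s \<Longrightarrow> singular_chain (Suc p) X (h p s)"
    and h0: "\<And>s. singular_simplex 0 X s \<Longrightarrow> chain_boundary 1 (h 0 s) = frag_of s - chain_map 0 (\<lambda>x. a) (frag_of s)"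
    and hS: "\<And>p s. singular_simplex (Suc p) X s \<Longrightarrow>
       chain_boundary (Suc (Suc p)) (h (Suc p) s) = frag_of s - frag_extend (h p) (chain_boundary (Suc p) (frag_of s))"
    by (rule integral_contraction[OF hom a]) (rule that)
  have key: "singular_simplex p X s" if "c \<in> field_chains p X" "s \<in> Poly_Mapping.keys c"
    for p s and c :: "('x, 'k) field_chain"
    using that by (auto simp: field_chains_def)
  let ?H = "\<lambda>p. chain_extend (h p) :: ('x, 'k) field_chain \<Rightarrow> _"
  show ?thesis
  proof (rule that[of ?H])
    show "?H p c \<in> field_chains (Suc p) X" if "c \<in> field_chains p X" for p c
      by (rule chain_extend_in_field_chains) (rule h[OF key[OF that]])
    show "c = field_boundary 1 (?H 0 c) + field_chain_map 0 (\<lambda>x. a) c" if "c \<in> field_chains 0 X" for c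
    proof -
      have "field_boundary 1 (?H 0 c) = chain_extend (\<lambda>s. frag_of s - chain_map 0 (\<lambda>x. a) (frag_of s)) c"
        unfolding field_boundary_eq_chain_extend chain_extend_chain_extend frag_extend_chain_boundary
        by (rule chain_extend_cong) (rule h0[OF key[OF that]])
      then show ?thesis
        by (simp add: chain_extend_kernel_diff field_chain_map_eq_chain_extend)
    qed
    show "c = field_boundary (Suc p) (?H p c)"
      if c: "c \<in> field_chains p X" and p: "p > 0" and bc: "field_boundary p c = 0" for p c
    proof -
      obtain r where r: "p = Suc r"
        using p by (cases p) auto
      have "field_boundary (Suc p) (?H p c) =
              chain_extend (\<lambda>s. frag_of s - frag_extend (h r) (chain_boundary p (frag_of s))) c"
        unfolding field_boundary_eq_chain_extend chain_extend_chain_extend frag_extend_chain_boundary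
        unfolding r by (rule chain_extend_cong) (rule hS, rule key[OF c[unfolded r]])
      also have "\<dots> = c - ?H r (field_boundary p c)"
        by (simp add: chain_extend_kernel_diff field_boundary_eq_chain_extend chain_extend_chain_extend)
      finally show ?thesis
        by (simp add: bc)
    qed
  qed
qed

text \<open>Above degree 1 both components can be filled by contracting homotopies.  In low degrees the
  constant map \<open>Y \<rightarrow> X\<close> takes over: up to a boundary, a 0-chain of \<open>Y\<close> is the image of its image in
  \<open>X\<close>, and a 0-chain of \<open>X\<close> is its own image under \<open>X \<rightarrow> Y \<rightarrow> X\<close>, which bounds as soon as the image
  in \<open>Y\<close> does.\<close>

lemma mapping_cone_acyclic_contractible:
  fixes X :: "'x topology" and Y :: "'y topology"
  assumes X: "contractible_space X" "topspace X \<noteq> {}" and Y: "contractible_space Y"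
    and q: "continuous_map X Y q"
  shows "mapping_cone_acyclic TYPE('k::field) X Y q"
  unfolding mapping_cone_acyclic_def
proof (intro allI ballI impI, elim conjE)
  fix p and w :: "('x, 'k) field_chain" and z :: "('y, 'k) field_chain"
  assume w: "w \<in> field_chains (p - Suc 0) X" and z: "z \<in> field_chains p Y" and w0: "p = 0 \<longrightarrow> w = 0"
    and bw: "field_boundary (p - Suc 0) w = 0" and bz: "field_boundary p z = field_chain_map (p - Suc 0) q w"
  obtain a where a: "a \<in> topspace X"
    using X(2) by blast
  have qa: "q a \<in> topspace Y"
    using q a continuous_map_image_subset_topspace by fastforce
  obtain H :: "nat \<Rightarrow> ('x, 'k::field) field_chain \<Rightarrow> ('x, 'k) field_chain" where
    H: "\<And>p c. c \<in> field_chains p X \<Longrightarrow> H p c \<in> field_chains (Suc p) X"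
    "\<And>c. c \<in> field_chains 0 X \<Longrightarrow> c = field_boundary 1 (H 0 c) + field_chain_map 0 (\<lambda>x. a) c"
    "\<And>p c. c \<in> field_chains p X \<Longrightarrow> p > 0 \<Longrightarrow> field_boundary p c = 0 \<Longrightarrow> c = field_boundary (Suc p) (H p c)"
    by (rule field_contraction[OF X(1) a]) (rule that)
  obtain G :: "nat \<Rightarrow> ('y, 'k::field) field_chain \<Rightarrow> ('y, 'k) field_chain" where
    G: "\<And>p c. c \<in> field_chains p Y \<Longrightarrow> G p c \<in> field_chains (Suc p) Y"
    "\<And>c. c \<in> field_chains 0 Y \<Longrightarrow> c = field_boundary 1 (G 0 c) + field_chain_map 0 (\<lambda>x. q a) c"
    "\<And>p c. c \<in> field_chains p Y \<Longrightarrow> p > 0 \<Longrightarrow> field_boundary p c = 0 \<Longrightarrow> c = field_boundary (Suc p) (G p c)"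
    by (rule field_contraction[OF Y qa]) (rule that)
  let ?r = "\<lambda>_::'y. a"
  have r: "continuous_map Y X ?r"
    using a by simp
  show "\<exists>a\<in>field_chains p X. \<exists>b\<in>field_chains (Suc p) Y.
          field_boundary p a = w \<and> z = field_chain_map p q a + field_boundary (Suc p) b"
  proof (cases "p = 0")
    case True
    have "z = field_chain_map 0 q (field_chain_map 0 ?r z) + field_boundary (Suc 0) (G 0 z)"
      using G(2)[of z] z True by (simp add: field_chain_map_compose add.commute)
    then show ?thesis
      using True w0 G(1)[of z 0] field_chain_map_in_field_chains[OF z r] z
      by (intro bexI[of _ "field_chain_map 0 ?r z"] bexI[of _ "G 0 z"]) auto
  next
    case p: False
    have "\<exists>x\<in>field_chains p X. field_boundary p x = w"
    proof (cases "p = 1")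
      case True
      have "field_chain_map 0 (\<lambda>x. a) w = field_chain_map 0 (?r \<circ> q) w"
        by (simp add: comp_def)
      also have "\<dots> = field_chain_map 0 ?r (field_boundary 1 z)"
        using bz True by (simp add: field_chain_map_compose)
      also have "\<dots> = field_boundary 1 (field_chain_map 1 ?r z)"
        using field_boundary_chain_map[of z 1 Y ?r] z True by simp
      finally have "w = field_boundary 1 (H 0 w + field_chain_map 1 ?r z)"
        using H(2)[of w] w True by (simp add: field_boundary_add)
      moreover have "H 0 w + field_chain_map 1 ?r z \<in> field_chains 1 X"
        using H(1)[of w 0] w z True field_chain_map_in_field_chains[OF _ r] by (intro field_chains_add) auto
      ultimately show ?thesis
        using True by metis
    next
      case False
      then have "p - Suc 0 > 0" "Suc (p - Suc 0) = p"
        using p by auto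
      then show ?thesis
        using H(1,3)[OF w] bw by metis
    qed
    then obtain x where x: "x \<in> field_chains p X" "field_boundary p x = w" ..
    let ?d = "z - field_chain_map p q x"
    have d: "?d \<in> field_chains p Y" "field_boundary p ?d = 0"
      using x z bz q by (simp_all add: field_chains_diff field_chain_map_in_field_chains field_boundary_diff
          field_boundary_chain_map[OF x(1)])
    have "z = field_chain_map p q x + field_boundary (Suc p) (G p ?d)"
      using G(3)[OF d(1) _ d(2)] p by (metis add_diff_cancel_left' diff_add_cancel add.commute neq0_conv)
    then show ?thesis
      using x G(1)[OF d(1)] by blast
  qed
qed

section \<open>Finite-dimensional homology\<close>

definition field_cycles :: "nat \<Rightarrow> 'x topology \<Rightarrow> ('x, 'k::field) field_chain set" where
  "field_cycles p X = {z \<in> field_chains p X. field_boundary p z = 0}"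

text \<open>Stated with cycles and boundaries instead of quotients, so that representatives can be spliced in
  the Mayer--Vietoris argument.\<close>

definition finite_dim_homology :: "'k::field itself \<Rightarrow> 'x topology \<Rightarrow> bool" where
  "finite_dim_homology _ X \<longleftrightarrow>
     (\<forall>p. \<exists>B. finite B \<and> (field_cycles p X :: ('x, 'k) field_chain set) \<subseteq> chain_space.span (B \<union> field_boundaries p X))"

lemma finite_dim_homology_contractible:
  fixes X :: "'x topology"
  assumes "contractible_space X"
  shows "finite_dim_homology TYPE('k::field) X"
proof (cases "topspace X = {}")
  case True
  have *: "singular_simplex_set p X = {}" for p
    using True singular_simplex_empty by blast
  have "field_cycles p X \<subseteq> ({0} :: ('x, 'k) field_chain set)" for p
    by (auto simp add: field_cycles_def field_chains_def *)
  then show ?thesis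
    using chain_space.span_zero by (auto simp: finite_dim_homology_def intro!: exI[of _ "{}"])
next
  case False
  then obtain a where a: "a \<in> topspace X" by blast
  obtain H :: "nat \<Rightarrow> ('x, 'k::field) field_chain \<Rightarrow> ('x, 'k) field_chain" where
    H: "\<And>p c. c \<in> field_chains p X \<Longrightarrow> H p c \<in> field_chains (Suc p) X"
    "\<And>c. c \<in> field_chains 0 X \<Longrightarrow> c = field_boundary 1 (H 0 c) + field_chain_map 0 (\<lambda>x. a) c"
    "\<And>p c. c \<in> field_chains p X \<Longrightarrow> p > 0 \<Longrightarrow> field_boundary p c = 0 \<Longrightarrow> c = field_boundary (Suc p) (H p c)"
    by (rule field_contraction[OF assms a]) (rule that)
  let ?e = "Poly_Mapping.single (\<lambda>x\<in>standard_simplex 0. a) (1::'k)"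
  have const: "field_chain_map 0 (\<lambda>x. a) c \<in> chain_space.span {?e}" for c :: "('x, 'k) field_chain"
  proof -
    have single: "Poly_Mapping.single (simplex_map 0 (\<lambda>x. a) s) k = Poly_Mapping.map ((*) k) ?e" for s k
      by (rule poly_mapping_eqI) (auto simp: lookup_scale lookup_single simplex_map_def comp_def when_def)
    show ?thesis
      unfolding field_chain_map_def single
      by (intro chain_space.span_sum chain_space.span_scale chain_space.span_base) simp
  qed
  have "field_cycles p X \<subseteq> chain_space.span ({?e} \<union> field_boundaries p X)" for p
  proof
    fix c :: "('x, 'k) field_chain" assume "c \<in> field_cycles p X"
    then have c: "c \<in> field_chains p X" "field_boundary p c = 0"
      by (auto simp: field_cycles_def)
    have bdry: "field_boundary (Suc p) (H p c) \<in> chain_space.span ({?e} \<union> field_boundaries p X)"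
      using H(1)[OF c(1)] by (intro chain_space.span_base) (auto simp: field_boundaries_def)
    show "c \<in> chain_space.span ({?e} \<union> field_boundaries p X)"
    proof (cases "p = 0")
      case True
      have "field_chain_map 0 (\<lambda>x. a) c \<in> chain_space.span ({?e} \<union> field_boundaries p X)"
        using const chain_space.span_mono[of "{?e}" "{?e} \<union> field_boundaries p X"] by blast
      then show ?thesis
        using H(2)[of c] c True bdry chain_space.span_add by fastforce
    next
      case False
      then show ?thesis
        using H(3)[OF c(1) _ c(2)] bdry by simp
    qed
  qed
  then show ?thesis
    unfolding finite_dim_homology_def by (meson finite.emptyI finite.insertI)
qed

text \<open>For \<open>T / Q\<close> this says that a subspace of a finitely generated space is finitely generated.\<close>

lemma spanning_set_within_subspace:
  fixes B Q T :: "('s \<Rightarrow>\<^sub>0 'k::field) set"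
  assumes "finite B" "chain_space.subspace T" "Q \<subseteq> T" "T \<subseteq> chain_space.span (B \<union> Q)"
  shows "\<exists>Y. finite Y \<and> Y \<subseteq> T \<and> T \<subseteq> chain_space.span (Y \<union> Q)"
  using assms(1,3,4)
proof (induction B arbitrary: Q rule: finite_induct)
  case empty
  then show ?case
    by (intro exI[of _ "{}"]) simp
next
  case (insert b B)
  show ?case
  proof (cases "T \<subseteq> chain_space.span (B \<union> Q)")
    case True
    then show ?thesis
      using insert by blast
  next
    case False
    then obtain t where t: "t \<in> T" "t \<notin> chain_space.span (B \<union> Q)"
      by blast
    have "t \<in> chain_space.span (insert b (B \<union> Q))"
      using t insert.prems(2) by auto
    \<comment> \<open>The exchange lemma trades the generator for an element of the subspace.\<close>
    then have "b \<in> chain_space.span (insert t (B \<union> Q))"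
      using chain_space.in_span_insert t(2) by blast
    then have "chain_space.span (insert b (B \<union> Q)) \<subseteq> chain_space.span (B \<union> insert t Q)"
      by (intro chain_space.span_minimal) (auto intro: chain_space.span_base)
    then have "T \<subseteq> chain_space.span (B \<union> insert t Q)"
      using insert.prems(2) by auto
    then obtain Y where Y: "finite Y" "Y \<subseteq> T" "T \<subseteq> chain_space.span (Y \<union> insert t Q)"
      using insert.IH[of "insert t Q"] t(1) insert.prems(1) by blast
    then show ?thesis
      using t(1) by (intro exI[of _ "insert t Y"]) simp
  qed
qed

lemma subspace_field_cycles: "chain_space.subspace (field_cycles p X)"
  by (auto simp: chain_space.subspace_def field_cycles_def field_chains_add field_chains_scale
      field_boundary_add field_boundary_scale)

lemma subspace_field_boundaries:
  fixes X :: "'x topology"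
  shows "chain_space.subspace (field_boundaries p X :: ('x, 'k::field) field_chain set)"
proof (rule chain_space.subspaceI)
  show "(0 :: ('x, 'k) field_chain) \<in> field_boundaries p X"
    unfolding field_boundaries_def by (rule image_eqI[of _ _ 0]) simp_all
  fix x y :: "('x, 'k) field_chain" assume "x \<in> field_boundaries p X" "y \<in> field_boundaries p X"
  then obtain a b where "a \<in> field_chains (Suc p) X" "b \<in> field_chains (Suc p) X"
      "x = field_boundary (Suc p) a" "y = field_boundary (Suc p) b"
    by (auto simp: field_boundaries_def)
  then show "x + y \<in> field_boundaries p X"
    unfolding field_boundaries_def
    by (intro image_eqI[of _ _ "a + b"]) (simp_all add: field_boundary_add field_chains_add)
next
  fix k :: 'k and x :: "('x, 'k) field_chain" assume "x \<in> field_boundaries p X"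
  then obtain a where "a \<in> field_chains (Suc p) X" "x = field_boundary (Suc p) a"
    by (auto simp: field_boundaries_def)
  then show "Poly_Mapping.map ((*) k) x \<in> field_boundaries p X"
    unfolding field_boundaries_def
    by (intro image_eqI[of _ _ "Poly_Mapping.map ((*) k) a"]) (simp_all add: field_boundary_scale field_chains_scale)
qed

lemma field_boundaries_subset_cycles: "field_boundaries p X \<subseteq> field_cycles p X"
  using field_boundary_in_field_chains[of _ "Suc p" X] field_boundary_boundary[of _ "Suc p" X]
  by (auto simp: field_boundaries_def field_cycles_def)

lemma field_boundaries_subtopology: "field_boundaries p (subtopology X S) \<subseteq> field_boundaries p X"
  by (auto simp: field_boundaries_def dest: field_chains_subtopology_imp)

text \<open>The homology of the union is caught between that of the two sets and that of the intersection:
  a cycle splits as \<open>x + y\<close>, where \<open>\<partial> x\<close> represents its image under the connecting homomorphism.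
  Finitely many such boundaries span this image, and subtracting lifts of them leaves a sum of cycles
  of the two sets.\<close>

lemma finite_dim_homology_union:
  fixes X :: "'x topology"
  assumes U: "openin X U" and V: "openin X V" and cover: "topspace X \<subseteq> U \<union> V"
    and fdU: "finite_dim_homology TYPE('k::field) (subtopology X U)"
    and fdV: "finite_dim_homology TYPE('k) (subtopology X V)"
    and fdI: "finite_dim_homology TYPE('k) (subtopology X (U \<inter> V))"
  shows "finite_dim_homology TYPE('k) X"
  unfolding finite_dim_homology_def
proof
  fix p
  let ?U = "subtopology X U" and ?V = "subtopology X V" and ?I = "subtopology X (U \<inter> V)"
  obtain BU where BU: "finite BU"
      "(field_cycles p ?U :: ('x, 'k) field_chain set) \<subseteq> chain_space.span (BU \<union> field_boundaries p ?U)"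
    using fdU unfolding finite_dim_homology_def by meson
  obtain BV where BV: "finite BV"
      "(field_cycles p ?V :: ('x, 'k) field_chain set) \<subseteq> chain_space.span (BV \<union> field_boundaries p ?V)"
    using fdV unfolding finite_dim_homology_def by meson
  \<comment> \<open>\<open>t\<close> represents the image of the cycle \<open>x + y\<close> under the connecting homomorphism.\<close>
  define split where "split t x y \<longleftrightarrow> x \<in> field_chains p ?U \<and> y \<in> field_chains p ?V \<and>
      field_boundary p x = t \<and> field_boundary p y = - t" for t :: "('x, 'k) field_chain" and x y
  have split_zero: "split 0 0 0"
    by (simp add: split_def)
  have split_add: "split (t + t') (x + x') (y + y')" if "split t x y" "split t' x' y'" for t t' x x' y y'
    using that by (simp add: split_def field_chains_add field_boundary_add)
  have split_scale: "split (Poly_Mapping.map ((*) k) t) (Poly_Mapping.map ((*) k) x) (Poly_Mapping.map ((*) k) y)"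
    if "split t x y" for k t x y
    using that by (simp add: split_def field_chains_scale field_boundary_scale chain_space.scale_minus_right)
  define T where "T = {t. \<exists>x y. split t x y}"
  have T: "chain_space.subspace T"
    unfolding T_def by (rule chain_space.subspaceI) (use split_zero split_add split_scale in blast)+
  \<comment> \<open>In degree 0 the connecting homomorphism vanishes, while \<open>p - Suc 0\<close> would again be 0.\<close>
  define Q where "Q = (if p = 0 then {} else field_boundaries (p - Suc 0) ?I :: ('x, 'k) field_chain set)"
  have Q: "\<exists>x. split t x (- x)" if "t \<in> Q" for t
  proof -
    obtain x where "x \<in> field_chains p ?I" "t = field_boundary p x"
      using \<open>t \<in> Q\<close> by (auto simp: Q_def field_boundaries_def split: if_splits)
    then have "split t x (- x)"
      by (auto simp: split_def field_chains_uminus field_boundary_uminus elim: field_chains_mono)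
    then show ?thesis ..
  qed
  have "\<exists>Y. finite Y \<and> Y \<subseteq> T \<and> T \<subseteq> chain_space.span (Y \<union> Q)"
  proof (cases "p = 0")
    case True
    then have "T \<subseteq> {0}"
      by (auto simp: T_def split_def)
    then show ?thesis
      using chain_space.span_zero by (intro exI[of _ "{}"]) auto
  next
    case False
    have "T \<subseteq> field_cycles (p - Suc 0) ?I"
    proof
      fix t assume "t \<in> T"
      then obtain x y where t: "split t x y"
        by (auto simp: T_def)
      have "t \<in> field_chains (p - Suc 0) ?U"
        using t field_boundary_in_field_chains by (auto simp: split_def)
      moreover have "t \<in> field_chains (p - Suc 0) ?V"
        using t field_boundary_in_field_chains[of y p ?V] by (auto simp: split_def field_chains_uminus)
      moreover have "field_boundary (p - Suc 0) t = 0"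
        using t field_boundary_boundary by (auto simp: split_def)
      ultimately show "t \<in> field_cycles (p - Suc 0) ?I"
        by (simp add: field_cycles_def field_chains_Int)
    qed
    moreover obtain BI where "finite BI"
        "(field_cycles (p - Suc 0) ?I :: ('x, 'k) field_chain set) \<subseteq>
           chain_space.span (BI \<union> field_boundaries (p - Suc 0) ?I)"
      using fdI unfolding finite_dim_homology_def by meson
    ultimately have "finite BI" "T \<subseteq> chain_space.span (BI \<union> Q)"
      using False by (auto simp: Q_def)
    moreover have "Q \<subseteq> T"
      using Q unfolding T_def by blast
    ultimately show ?thesis
      by (intro spanning_set_within_subspace[OF _ T])
  qed
  then obtain Y where Y: "finite Y" "Y \<subseteq> T" "T \<subseteq> chain_space.span (Y \<union> Q)"
    by blast
  have "\<forall>t\<in>Y. \<exists>x y. split t x y"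
    using Y(2) unfolding T_def by blast
  then obtain gx gy where g: "\<And>t. t \<in> Y \<Longrightarrow> split t (gx t) (gy t)"
    by metis
  define Y' where "Y' = (\<lambda>t. gx t + gy t) ` Y"
  \<comment> \<open>The lifts can be chosen such that the resulting cycles lie in one finite-dimensional space.\<close>
  have lift: "\<exists>x y. split t x y \<and> x + y \<in> chain_space.span Y'" if "t \<in> chain_space.span (Y \<union> Q)" for t
    using that
  proof (induction rule: chain_space.span_induct)
    case base
    show ?case
    proof (rule chain_space.subspaceI, unfold mem_Collect_eq)
      show "\<exists>x y. split 0 x y \<and> x + y \<in> chain_space.span Y'"
        using split_zero chain_space.span_zero by (metis add_0)
      show "\<exists>x y. split (t + t') x y \<and> x + y \<in> chain_space.span Y'"
        if t: "\<exists>x y. split t x y \<and> x + y \<in> chain_space.span Y'"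
        and t': "\<exists>x y. split t' x y \<and> x + y \<in> chain_space.span Y'" for t t'
      proof -
        obtain x y x' y' where "split t x y" "x + y \<in> chain_space.span Y'"
            "split t' x' y'" "x' + y' \<in> chain_space.span Y'"
          using t t' by blast
        then have "split (t + t') (x + x') (y + y')" "(x + x') + (y + y') \<in> chain_space.span Y'"
          using split_add chain_space.span_add[of "x + y" Y' "x' + y'"] by (simp_all add: add_ac)
        then show ?thesis by blast
      qed
      show "\<exists>x y. split (Poly_Mapping.map ((*) k) t) x y \<and> x + y \<in> chain_space.span Y'"
        if t: "\<exists>x y. split t x y \<and> x + y \<in> chain_space.span Y'" for k t
      proof -
        obtain x y where "split t x y" "x + y \<in> chain_space.span Y'"
          using t by blast
        then have "split (Poly_Mapping.map ((*) k) t) (Poly_Mapping.map ((*) k) x) (Poly_Mapping.map ((*) k) y)"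
            "Poly_Mapping.map ((*) k) x + Poly_Mapping.map ((*) k) y \<in> chain_space.span Y'"
          using split_scale chain_space.span_scale[of "x + y" Y' k]
          by (simp_all add: chain_space.scale_right_distrib)
        then show ?thesis by blast
      qed
    qed
  next
    case (step t)
    show ?case
    proof (cases "t \<in> Y")
      case True
      then show ?thesis
        using g[OF True] chain_space.span_base[of "gx t + gy t" Y']
        by (intro exI[of _ "gx t"] exI[of _ "gy t"]) (simp add: Y'_def)
    next
      case False
      then obtain x where "split t x (- x)"
        using Q step by blast
      moreover have "x + - x \<in> chain_space.span Y'"
        by (simp add: chain_space.span_zero)
      ultimately show ?thesis by blast
    qed
  qed
  let ?B = "BU \<union> BV \<union> Y'" and ?S = "BU \<union> BV \<union> Y' \<union> field_boundaries p X"
  have "field_cycles p X \<subseteq> chain_space.span ?S"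
  proof
    fix z :: "('x, 'k) field_chain" assume "z \<in> field_cycles p X"
    then have z: "z \<in> field_chains p X" "field_boundary p z = 0 + 0"
      by (simp_all add: field_cycles_def)
    obtain b z1 z2 where b: "b \<in> field_chains (Suc p) X" and z1: "z1 \<in> field_chains p ?U"
        and z2: "z2 \<in> field_chains p ?V" and z_eq: "z = z1 + z2 + field_boundary (Suc p) b"
      by (rule small_chain_approximation[OF U V cover z field_chains_zero field_chains_zero])
    have "field_boundary p z1 + field_boundary p z2 = 0"
      using z(2) field_boundary_boundary[OF b] by (simp add: z_eq field_boundary_add)
    then have sp: "split (field_boundary p z1) z1 z2"
      using z1 z2 by (simp add: split_def eq_neg_iff_add_eq_0 add.commute)
    then have "field_boundary p z1 \<in> T"
      unfolding T_def by blast
    then obtain x y where xy: "split (field_boundary p z1) x y" "x + y \<in> chain_space.span Y'"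
      using lift[OF subsetD[OF Y(3)]] by blast
    have cyc: "z1 - x \<in> field_cycles p ?U" "z2 - y \<in> field_cycles p ?V"
      using xy(1) sp by (simp_all add: split_def field_cycles_def field_chains_diff field_boundary_diff)
    have spU: "z1 - x \<in> chain_space.span (BU \<union> field_boundaries p ?U)"
      and spV: "z2 - y \<in> chain_space.span (BV \<union> field_boundaries p ?V)"
      using subsetD[OF BU(2) cyc(1)] subsetD[OF BV(2) cyc(2)] .
    have sub: "BU \<union> field_boundaries p ?U \<subseteq> ?S" "BV \<union> field_boundaries p ?V \<subseteq> ?S" "Y' \<subseteq> ?S"
      using field_boundaries_subtopology by blast+
    have "z1 - x \<in> chain_space.span ?S" "z2 - y \<in> chain_space.span ?S" "x + y \<in> chain_space.span ?S"
      using subsetD[OF chain_space.span_mono[OF sub(1)] spU] subsetD[OF chain_space.span_mono[OF sub(2)] spV]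
        subsetD[OF chain_space.span_mono[OF sub(3)] xy(2)] .
    moreover have "field_boundary (Suc p) b \<in> chain_space.span ?S"
      using b by (intro chain_space.span_base) (simp add: field_boundaries_def)
    ultimately have "(z1 - x) + (z2 - y) + (x + y) + field_boundary (Suc p) b \<in> chain_space.span ?S"
      by (rule chain_space.span_add[OF chain_space.span_add[OF chain_space.span_add]])
    moreover have "(z1 - x) + (z2 - y) + (x + y) + field_boundary (Suc p) b = z"
      by (simp add: z_eq)
    ultimately show "z \<in> chain_space.span ?S"
      by simp
  qed
  moreover have "finite ?B"
    using BU(1) BV(1) Y(1) by (simp add: Y'_def)
  ultimately show "\<exists>B. finite B \<and> (field_cycles p X :: ('x, 'k) field_chain set) \<subseteq>
      chain_space.span (B \<union> field_boundaries p X)"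
    by (intro exI[of _ ?B] conjI)
qed

section \<open>Finite spaces\<close>

definition minimal_open :: "'y topology \<Rightarrow> 'y \<Rightarrow> 'y set \<Rightarrow> bool" where
  "minimal_open Y y U \<longleftrightarrow> openin Y U \<and> y \<in> U \<and> (\<forall>W. openin Y W \<and> y \<in> W \<longrightarrow> U \<subseteq> W)"

lemma minimal_open_exists:
  assumes "finite (topspace Y)" "y \<in> topspace Y"
  obtains U where "minimal_open Y y U"
proof
  let ?W = "{W. openin Y W \<and> y \<in> W}"
  have "finite ?W"
    by (rule finite_subset[of _ "Pow (topspace Y)"]) (use assms openin_subset in auto)
  moreover have "?W \<noteq> {}"
    using assms(2) by (metis (mono_tags) empty_iff mem_Collect_eq openin_topspace)
  ultimately have "openin Y (\<Inter>?W)"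
    by (intro openin_Inter) auto
  then show "minimal_open Y y (\<Inter>?W)"
    by (auto simp: minimal_open_def)
qed

text \<open>An open set \<open>A\<close> is the union of the smallest neighbourhoods of its points.  These are added one
  at a time; the intersection of the next one with the union so far is either smaller than \<open>A\<close>, or
  the next one is all of \<open>A\<close> and has been dealt with as a smallest neighbourhood.\<close>

lemma finite_space_open_induct:
  assumes fin: "finite (topspace Y)" and "openin Y A"
    and P_empty: "P {}"
    and minimal: "\<And>y U. minimal_open Y y U \<Longrightarrow> P U"
    and union: "\<And>U V. openin Y U \<Longrightarrow> openin Y V \<Longrightarrow> P U \<Longrightarrow> P V \<Longrightarrow> P (U \<inter> V) \<Longrightarrow> P (U \<union> V)"
  shows "P A"
  using assms(2)
proof (induction "card A" arbitrary: A rule: less_induct)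
  case less
  have finA: "finite A"
    by (rule finite_subset[OF openin_subset[OF less.prems] fin])
  have "\<exists>U. minimal_open Y y U" if "y \<in> A" for y
    using minimal_open_exists[OF fin subsetD[OF openin_subset[OF less.prems] that]] by blast
  then obtain m where m: "\<And>y. y \<in> A \<Longrightarrow> minimal_open Y y (m y)"
    using that[of "\<lambda>y. SOME U. minimal_open Y y U"] someI_ex[of "minimal_open Y _"] by blast
  have mo: "openin Y (m y)" and my: "y \<in> m y" if "y \<in> A" for y
    using m[OF that] by (simp_all only: minimal_open_def)
  have mA: "m y \<subseteq> A" if "y \<in> A" for y
    using m[OF that] less.prems that by (simp only: minimal_open_def)
  have unions: "P (\<Union>(m ` S))" if "finite S" "S \<subseteq> A" for S
    using that
  proof (induction S rule: finite_induct)
    case empty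
    show ?case
      by (simp only: image_empty Union_empty P_empty)
  next
    case (insert s S)
    let ?V = "\<Union>(m ` S)"
    have s: "s \<in> A" "S \<subseteq> A"
      using insert.prems by auto
    have V: "openin Y ?V"
      using mo[OF subsetD[OF s(2)]] by (intro openin_Union) auto
    have "P (m s \<union> ?V)"
    proof (cases "m s \<inter> ?V = A")
      case True
      moreover have "?V \<subseteq> A"
        by (rule UN_least) (rule mA[OF subsetD[OF s(2)]])
      ultimately have "m s \<union> ?V = m s"
        by blast
      then show ?thesis
        using minimal[OF m[OF s(1)]] by (simp only:)
    next
      case False
      then have "m s \<inter> ?V \<subset> A"
        using mA[OF s(1)] by blast
      then have "card (m s \<inter> ?V) < card A"
        by (rule psubset_card_mono[OF finA])
      then have "P (m s \<inter> ?V)"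
        by (intro less.hyps openin_Int mo[OF s(1)] V)
      then show ?thesis
        by (intro union mo[OF s(1)] V minimal[OF m[OF s(1)]] insert.IH[OF s(2)])
    qed
    then show ?case
      by (simp only: image_insert Union_insert)
  qed
  have "P (\<Union>(m ` A))"
    by (rule unions[OF finA order.refl])
  moreover have "\<Union>(m ` A) = A"
  proof
    show "\<Union>(m ` A) \<subseteq> A"
      by (rule UN_least) (rule mA)
    show "A \<subseteq> \<Union>(m ` A)"
    proof
      fix y assume "y \<in> A"
      then show "y \<in> \<Union>(m ` A)"
        using my[of y] by (intro UN_I[of y])
    qed
  qed
  ultimately show ?case
    by (simp only:)
qed

text \<open>The homotopy rests until time 1 and then jumps to \<open>y\<close>.  It is continuous because the only open
  subset of \<open>U\<close> that contains \<open>y\<close> is \<open>U\<close> itself.\<close>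

lemma contractible_minimal_open:
  assumes "minimal_open Y y U"
  shows "contractible_space (subtopology Y U)"
  unfolding contractible_space_def homotopic_with_def
proof (intro exI[of _ y] exI[of _ "\<lambda>(t, x). if t < (1::real) then x else y"] conjI)
  let ?Z = "subtopology Y U" and ?h = "\<lambda>(t, x). if t < (1::real) then x else y"
  let ?P = "prod_topology (top_of_set {0..1::real}) ?Z"
  have U: "openin Y U" "y \<in> U"
    using assms by (auto simp: minimal_open_def)
  then have topZ: "topspace ?Z = U"
    using openin_subset by fastforce
  show "continuous_map ?P ?Z ?h"
    unfolding continuous_map_def
  proof (intro conjI allI impI)
    show "?h \<in> topspace ?P \<rightarrow> topspace ?Z"
      unfolding topspace_prod_topology topZ using U by auto
    fix W assume W: "openin ?Z W"
    then have W': "openin Y W" "W \<subseteq> U"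
      using U(1) by (auto simp: openin_open_subtopology)
    show "openin ?P {x \<in> topspace ?P. ?h x \<in> W}"
    proof (cases "y \<in> W")
      case True
      then have "W = U"
        using W' assms by (auto simp: minimal_open_def)
      then have "{x \<in> topspace ?P. ?h x \<in> W} = topspace ?P"
        unfolding topspace_prod_topology topZ using U by auto
      then show ?thesis
        by (simp only: openin_topspace)
    next
      case False
      have "{x \<in> topspace ?P. ?h x \<in> W} = {0..<1} \<times> W"
        unfolding topspace_prod_topology topZ using False W' by (auto split: if_splits)
      moreover have "openin (top_of_set {0..1::real}) {0..<1}"
        unfolding openin_open by (intro exI[of _ "{..<1}"]) auto
      ultimately show ?thesis
        using W by (simp add: openin_prod_Times_iff)
    qed
  qed
qed auto

section \<open>Maps to finite spaces with contractible fibres over minimal open sets\<close>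

lemma subtopology_subtopology_subset:
  "T \<subseteq> S \<Longrightarrow> subtopology (subtopology X S) T = subtopology X T"
  by (simp add: subtopology_subtopology inf_absorb2)

lemma openin_subtopology_preimage:
  assumes q: "continuous_map X Y q" and A: "openin Y A" "A \<subseteq> W"
  shows "openin (subtopology X {x \<in> topspace X. q x \<in> W}) {x \<in> topspace X. q x \<in> A}"
proof -
  have "openin X {x \<in> topspace X. q x \<in> A}"
    by (rule openin_continuous_map_preimage[OF q A(1)])
  moreover have "{x \<in> topspace X. q x \<in> A} \<subseteq> {x \<in> topspace X. q x \<in> W}"
    using A(2) by auto
  ultimately show ?thesis
    by (auto simp: openin_subtopology)
qed

text \<open>McCord's theorem for homology: both sides are contractible over every smallest neighbourhood, so the
  cone is acyclic there, and the Mayer--Vietoris step spreads this to all open sets.\<close>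

theorem mapping_cone_acyclic_finite_space:
  fixes X :: "'x topology" and Y :: "'y topology"
  assumes fin: "finite (topspace Y)" and q: "continuous_map X Y q"
    and fibre: "\<And>y U. minimal_open Y y U \<Longrightarrow> contractible_space (subtopology X {x \<in> topspace X. q x \<in> U})"
    and surj: "\<And>y. y \<in> topspace Y \<Longrightarrow> \<exists>x\<in>topspace X. q x = y"
  shows "mapping_cone_acyclic TYPE('k::field) X Y q"
proof -
  define pre where "pre U = {x \<in> topspace X. q x \<in> U}" for U
  have pre_Int: "pre U \<inter> pre V = pre (U \<inter> V)" and pre_Un: "pre U \<union> pre V = pre (U \<union> V)"
    and pre_mono: "U \<subseteq> V \<Longrightarrow> pre U \<subseteq> pre V" for U V
    by (auto simp: pre_def)
  have qU: "continuous_map (subtopology X (pre U)) (subtopology Y U) q" for U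
    using q by (auto simp: pre_def continuous_map_in_subtopology continuous_map_from_subtopology)
  have "mapping_cone_acyclic TYPE('k) (subtopology X (pre (topspace Y))) (subtopology Y (topspace Y)) q"
  proof (induction rule: finite_space_open_induct[OF fin openin_topspace])
    case 1
    show ?case
      by (rule mapping_cone_acyclic_empty) (auto simp: pre_def)
  next
    case (2 y U)
    then have "y \<in> U" "y \<in> topspace Y"
      using openin_subset by (auto simp: minimal_open_def)
    then obtain x where "x \<in> topspace X" "q x \<in> U"
      using surj by blast
    then have "topspace (subtopology X (pre U)) \<noteq> {}"
      unfolding pre_def topspace_subtopology by blast
    then show ?case
      by (intro mapping_cone_acyclic_contractible contractible_minimal_open[OF 2] qU)
         (auto simp only: pre_def intro!: fibre[OF 2])
  next
    case (3 U V)
    let ?X = "subtopology X (pre (U \<union> V))" and ?Y = "subtopology Y (U \<union> V)"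
    have X: "subtopology ?X (pre A) = subtopology X (pre A)" and Y: "subtopology ?Y A = subtopology Y A"
      if "A \<subseteq> U \<union> V" for A
      using that pre_mono by (simp_all add: subtopology_subtopology_subset)
    note XU = X[OF Un_upper1] and XV = X[OF Un_upper2] and YU = Y[OF Un_upper1] and YV = Y[OF Un_upper2]
    show ?case
    proof (rule mapping_cone_acyclic_union[of ?Y U V ?X "pre U" "pre V"])
      show "openin ?Y U" "openin ?Y V"
        using 3(1,2) by (auto simp: openin_open_subtopology openin_Un)
      show "openin ?X (pre U)" "openin ?X (pre V)"
        unfolding pre_def by (intro openin_subtopology_preimage[OF q] 3(1,2) Un_upper1 Un_upper2)+
      show "topspace ?Y \<subseteq> U \<union> V" "topspace ?X \<subseteq> pre U \<union> pre V"
        unfolding pre_Un topspace_subtopology by auto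
      show "continuous_map ?X ?Y q"
        by (rule qU)
      show "continuous_map (subtopology ?X (pre U)) (subtopology ?Y U) q"
        unfolding XU YU by (rule qU)
      show "continuous_map (subtopology ?X (pre V)) (subtopology ?Y V) q"
        unfolding XV YV by (rule qU)
      show "mapping_cone_acyclic TYPE('k) (subtopology ?X (pre U)) (subtopology ?Y U) q"
        unfolding XU YU by (rule 3)
      show "mapping_cone_acyclic TYPE('k) (subtopology ?X (pre V)) (subtopology ?Y V) q"
        unfolding XV YV by (rule 3)
      have "U \<inter> V \<subseteq> U \<union> V" by blast
      then show "mapping_cone_acyclic TYPE('k) (subtopology ?X (pre U \<inter> pre V)) (subtopology ?Y (U \<inter> V)) q"
        unfolding pre_Int by (simp only: X Y 3)
    qed
  qed
  moreover have "pre (topspace Y) = topspace X"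
    using q by (auto simp: pre_def continuous_map_def)
  ultimately show ?thesis
    by (simp only: subtopology_topspace)
qed

theorem finite_dim_homology_over_finite_space:
  fixes X :: "'x topology" and Y :: "'y topology"
  assumes fin: "finite (topspace Y)" and q: "continuous_map X Y q"
    and fibre: "\<And>y U. minimal_open Y y U \<Longrightarrow> contractible_space (subtopology X {x \<in> topspace X. q x \<in> U})"
  shows "finite_dim_homology TYPE('k::field) X"
proof -
  define pre where "pre U = {x \<in> topspace X. q x \<in> U}" for U
  have pre_Int: "pre U \<inter> pre V = pre (U \<inter> V)" and pre_Un: "pre U \<union> pre V = pre (U \<union> V)"
    and pre_mono: "U \<subseteq> V \<Longrightarrow> pre U \<subseteq> pre V" for U V
    by (auto simp: pre_def)
  have "finite_dim_homology TYPE('k) (subtopology X (pre (topspace Y)))"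
  proof (induction rule: finite_space_open_induct[OF fin openin_topspace])
    case 1
    have "contractible_space (subtopology X (pre {}))"
      by (simp add: pre_def)
    then show ?case
      by (rule finite_dim_homology_contractible)
  next
    case (2 y U)
    show ?case
      unfolding pre_def by (intro finite_dim_homology_contractible fibre[OF 2])
  next
    case (3 U V)
    let ?X = "subtopology X (pre (U \<union> V))"
    have X: "subtopology ?X (pre A) = subtopology X (pre A)" if "A \<subseteq> U \<union> V" for A
      using that pre_mono by (simp add: subtopology_subtopology_subset)
    show ?case
    proof (rule finite_dim_homology_union[of ?X "pre U" "pre V"])
      show "openin ?X (pre U)" "openin ?X (pre V)"
        unfolding pre_def by (intro openin_subtopology_preimage[OF q] 3(1,2) Un_upper1 Un_upper2)+
      show "topspace ?X \<subseteq> pre U \<union> pre V"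
        unfolding pre_Un topspace_subtopology by auto
      show "finite_dim_homology TYPE('k) (subtopology ?X (pre U))"
        unfolding X[OF Un_upper1] by (rule 3)
      show "finite_dim_homology TYPE('k) (subtopology ?X (pre V))"
        unfolding X[OF Un_upper2] by (rule 3)
      have "U \<inter> V \<subseteq> U \<union> V" by blast
      then show "finite_dim_homology TYPE('k) (subtopology ?X (pre U \<inter> pre V))"
        unfolding pre_Int by (simp only: X 3)
    qed
  qed
  moreover have "pre (topspace Y) = topspace X"
    using q by (auto simp: pre_def continuous_map_def)
  ultimately show ?thesis
    by (simp only: subtopology_topspace)
qed

section \<open>Homology as a vector space\<close>

text \<open>The coset of \<open>z\<close>, written such that membership and equality of classes reduce to membership in the
  space of boundaries.\<close>

definition homology_class :: "nat \<Rightarrow> 'x topology \<Rightarrow> ('x, 'k::field) field_chain \<Rightarrow> ('x, 'k) field_chain set" where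
  "homology_class p X z = {c. c - z \<in> field_boundaries p X}"

lemma boundaries_zero: "0 \<in> field_boundaries p X"
  by (rule chain_space.subspace_0[OF subspace_field_boundaries])

lemma boundaries_add: "x \<in> field_boundaries p X \<Longrightarrow> y \<in> field_boundaries p X \<Longrightarrow> x + y \<in> field_boundaries p X"
  by (rule chain_space.subspace_add[OF subspace_field_boundaries])

lemma boundaries_diff: "x \<in> field_boundaries p X \<Longrightarrow> y \<in> field_boundaries p X \<Longrightarrow> x - y \<in> field_boundaries p X"
  by (rule chain_space.subspace_diff[OF subspace_field_boundaries])

lemma boundaries_scale: "x \<in> field_boundaries p X \<Longrightarrow> Poly_Mapping.map ((*) k) x \<in> field_boundaries p X"
  by (rule chain_space.subspace_scale[OF subspace_field_boundaries])

lemma cycles_zero: "0 \<in> field_cycles p X"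
  by (rule chain_space.subspace_0[OF subspace_field_cycles])

lemma cycles_add: "x \<in> field_cycles p X \<Longrightarrow> y \<in> field_cycles p X \<Longrightarrow> x + y \<in> field_cycles p X"
  by (rule chain_space.subspace_add[OF subspace_field_cycles])

lemma cycles_scale: "x \<in> field_cycles p X \<Longrightarrow> Poly_Mapping.map ((*) k) x \<in> field_cycles p X"
  by (rule chain_space.subspace_scale[OF subspace_field_cycles])

lemma cycles_uminus: "x \<in> field_cycles p X \<Longrightarrow> - x \<in> field_cycles p X"
  by (rule chain_space.subspace_neg[OF subspace_field_cycles])

lemma homology_class_self: "z \<in> homology_class p X z"
  by (simp add: homology_class_def boundaries_zero)

lemma homology_class_eq_iff: "homology_class p X x = homology_class p X y \<longleftrightarrow> x - y \<in> field_boundaries p X"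
proof
  assume "homology_class p X x = homology_class p X y"
  then have "x \<in> homology_class p X y"
    using homology_class_self by blast
  then show "x - y \<in> field_boundaries p X"
    by (simp add: homology_class_def)
next
  assume xy: "x - y \<in> field_boundaries p X"
  have "c - x \<in> field_boundaries p X \<longleftrightarrow> c - y \<in> field_boundaries p X" for c
    using boundaries_add[OF _ xy, of "c - x"] boundaries_diff[OF _ xy, of "c - y"] by auto
  then show "homology_class p X x = homology_class p X y"
    by (simp add: homology_class_def)
qed

lemma coset_eq_homology_class: "field_boundaries p X +>\<^bsub>cycle_module q Y\<^esub> z = homology_class p X z"
proof -
  have "field_boundaries p X +>\<^bsub>cycle_module q Y\<^esub> z = (\<Union>b\<in>field_boundaries p X. {b + z})"
    by (simp add: a_r_coset_def' cycle_module_def)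
  also have "\<dots> = homology_class p X z"
    unfolding homology_class_def by (auto intro!: bexI[of _ "c - z" for c])
  finally show ?thesis .
qed

lemma carrier_homology_space: "carrier (homology_space p X) = homology_class p X ` field_cycles p X"
  unfolding homology_space_def quotient_module_def
  by (auto simp: A_RCOSETS_def' coset_eq_homology_class) (auto simp: cycle_module_def field_cycles_def)

lemma zero_homology_space: "\<zero>\<^bsub>homology_space p X\<^esub> = homology_class p X 0"
  by (simp add: homology_space_def quotient_module_def homology_class_def)

lemma add_homology_space:
  "homology_class p X x \<oplus>\<^bsub>homology_space p X\<^esub> homology_class p X y = homology_class p X (x + y)"
proof -
  have "homology_class p X x \<oplus>\<^bsub>homology_space p X\<^esub> homology_class p X y =
          (\<Union>h\<in>homology_class p X x. \<Union>k\<in>homology_class p X y. {h + k})"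
    by (simp add: homology_space_def quotient_module_def set_add_def' cycle_module_def)
  also have "\<dots> = homology_class p X (x + y)"
  proof (intro equalityI subsetI)
    fix c assume "c \<in> (\<Union>h\<in>homology_class p X x. \<Union>k\<in>homology_class p X y. {h + k})"
    then obtain h k where "h - x \<in> field_boundaries p X" "k - y \<in> field_boundaries p X" "c = h + k"
      by (auto simp: homology_class_def)
    then show "c \<in> homology_class p X (x + y)"
      using boundaries_add[of "h - x" p X "k - y"] by (simp add: homology_class_def add_diff_add)
  next
    fix c assume "c \<in> homology_class p X (x + y)"
    then have "c - y \<in> homology_class p X x"
      by (simp add: homology_class_def algebra_simps)
    then show "c \<in> (\<Union>h\<in>homology_class p X x. \<Union>k\<in>homology_class p X y. {h + k})"
      using homology_class_self[of y p X] by (intro UN_I[of "c - y"] UN_I[of y]) auto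
  qed
  finally show ?thesis .
qed

lemma smult_homology_space:
  "k \<odot>\<^bsub>homology_space p X\<^esub> homology_class p X x = homology_class p X (Poly_Mapping.map ((*) k) x)"
proof -
  have "homology_class p X (Poly_Mapping.map ((*) k) c) = homology_class p X (Poly_Mapping.map ((*) k) x)"
    if "c \<in> homology_class p X x" for c
    unfolding homology_class_eq_iff chain_space.scale_right_diff_distrib[symmetric]
    by (rule boundaries_scale) (use that in \<open>simp add: homology_class_def\<close>)
  then have "(\<Union>c\<in>homology_class p X x. homology_class p X (Poly_Mapping.map ((*) k) c)) =
      homology_class p X (Poly_Mapping.map ((*) k) x)"
    using homology_class_self[of x p X] by blast
  then show ?thesis
    by (simp add: homology_space_def quotient_module_def coset_eq_homology_class)
       (simp add: cycle_module_def)
qed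

lemma vectorspace_homology_space:
  fixes X :: "'x topology"
  shows "vectorspace class_ring (homology_space p X :: ('k::field, ('x, 'k) field_chain set) module)"
proof -
  let ?H = "homology_space p X :: ('k, ('x, 'k) field_chain set) module"
  note H = carrier_homology_space zero_homology_space add_homology_space smult_homology_space
  have F: "field (class_ring :: 'k ring)"
    by (rule class_field)
  have "abelian_group ?H"
  proof (rule abelian_groupI)
    show "\<exists>y\<in>carrier ?H. y \<oplus>\<^bsub>?H\<^esub> x = \<zero>\<^bsub>?H\<^esub>" if x: "x \<in> carrier ?H" for x
    proof -
      obtain z where z: "z \<in> field_cycles p X" "x = homology_class p X z"
        using x unfolding carrier_homology_space by blast
      then show ?thesis
        by (intro bexI[of _ "homology_class p X (- z)"]) (auto simp: H cycles_uminus)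
    qed
  qed (auto simp: H cycles_zero cycles_add add_ac)
  then have "Module.module (class_ring :: 'k ring) ?H"
    by (intro Module.module.intro Module.module_axioms.intro)
       (auto simp: H cycles_scale chain_space.scale_left_distrib chain_space.scale_right_distrib
         intro: F[THEN field.axioms(1), THEN domain.axioms(1)])
  then show ?thesis
    using F by (intro vectorspace.intro)
qed

lemma fin_dim_homology_space:
  fixes X :: "'x topology"
  assumes "finite_dim_homology TYPE('k::field) X"
  shows "vectorspace.fin_dim class_ring (homology_space p X :: ('k, ('x, 'k) field_chain set) module)"
proof -
  let ?H = "homology_space p X :: ('k, ('x, 'k) field_chain set) module"
  interpret H: vectorspace "class_ring :: 'k ring" ?H
    by (rule vectorspace_homology_space)
  obtain B where "finite B" "(field_cycles p X :: ('x, 'k) field_chain set) \<subseteq> chain_space.span (B \<union> field_boundaries p X)"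
    using assms unfolding finite_dim_homology_def by meson
  then obtain Y :: "('x, 'k) field_chain set" where Y: "finite Y" "Y \<subseteq> field_cycles p X"
      "field_cycles p X \<subseteq> chain_space.span (Y \<union> field_boundaries p X)"
    using spanning_set_within_subspace[OF _ subspace_field_cycles field_boundaries_subset_cycles] by metis
  let ?A = "homology_class p X ` Y"
  have A: "?A \<subseteq> carrier ?H"
    using Y(2) by (auto simp: carrier_homology_space)
  interpret S: submodule "class_ring :: 'k ring" "H.span ?A" ?H
    using A by (rule H.span_is_submodule)
  have base: "x \<in> field_cycles p X \<and> homology_class p X x \<in> H.span ?A" if "x \<in> Y \<union> field_boundaries p X" for x
  proof (cases "x \<in> Y")
    case True
    then show ?thesis
      using Y(2) H.in_own_span[OF A] by auto
  next
    case False
    then have "x \<in> field_boundaries p X"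
      using that by simp
    then have "homology_class p X x = \<zero>\<^bsub>?H\<^esub>" "x \<in> field_cycles p X"
      using field_boundaries_subset_cycles by (auto simp: zero_homology_space homology_class_eq_iff)
    then show ?thesis
      using S.zero_closed by simp
  qed
  have "c \<in> field_cycles p X \<and> homology_class p X c \<in> H.span ?A" if "c \<in> chain_space.span (Y \<union> field_boundaries p X)" for c
    using that
  proof (induction rule: chain_space.span_induct)
    case base
    show ?case
    proof (rule chain_space.subspaceI, unfold mem_Collect_eq)
      show "0 \<in> field_cycles p X \<and> homology_class p X 0 \<in> H.span ?A"
        using S.zero_closed by (simp add: cycles_zero zero_homology_space)
      show "x + y \<in> field_cycles p X \<and> homology_class p X (x + y) \<in> H.span ?A"
        if "x \<in> field_cycles p X \<and> homology_class p X x \<in> H.span ?A"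
          "y \<in> field_cycles p X \<and> homology_class p X y \<in> H.span ?A" for x y
        using that S.m_closed by (auto simp: cycles_add simp flip: add_homology_space)
      show "Poly_Mapping.map ((*) k) x \<in> field_cycles p X \<and> homology_class p X (Poly_Mapping.map ((*) k) x) \<in> H.span ?A"
        if "x \<in> field_cycles p X \<and> homology_class p X x \<in> H.span ?A" for k x
        using that S.smult_closed[of k] by (auto simp: cycles_scale simp flip: smult_homology_space)
    qed
  next
    case (step x)
    then show ?case by (rule base)
  qed
  then have "carrier ?H \<subseteq> H.span ?A"
    using Y(3) by (auto simp: carrier_homology_space)
  then have "carrier ?H = H.span ?A"
    using S.subset by blast
  then show ?thesis
    unfolding H.fin_dim_def using Y(1) A by blast
qed

lemma homology_map_class:
  assumes g: "continuous_map X Y g"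
  shows "homology_map p Y g (homology_class p X x) = homology_class p Y (field_chain_map p g x)"
proof -
  have "homology_class p Y (field_chain_map p g c) = homology_class p Y (field_chain_map p g x)"
    if "c \<in> homology_class p X x" for c
  proof -
    obtain u where u: "u \<in> field_chains (Suc p) X" "c - x = field_boundary (Suc p) u"
      using \<open>c \<in> homology_class p X x\<close> by (auto simp: homology_class_def field_boundaries_def)
    have "field_chain_map p g c - field_chain_map p g x = field_boundary (Suc p) (field_chain_map (Suc p) g u)"
      using field_boundary_chain_map[OF u(1), of g] by (simp add: u(2) flip: field_chain_map_diff)
    then show ?thesis
      using field_chain_map_in_field_chains[OF u(1) g] by (simp add: homology_class_eq_iff field_boundaries_def)
  qed
  then show ?thesis
    unfolding homology_map_def coset_eq_homology_class using homology_class_self[of x p X] by blast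
qed

lemma field_chain_map_cycle:
  assumes "x \<in> field_cycles p X" "continuous_map X Y g"
  shows "field_chain_map p g x \<in> field_cycles p Y"
  using assms field_chain_map_in_field_chains[of x p X Y g] field_boundary_chain_map[of x p X g]
  by (simp add: field_cycles_def)

lemma linear_homology_map:
  fixes X :: "'x topology" and Y :: "'y topology"
  assumes g: "continuous_map X Y g"
  shows "linear_map class_ring (homology_space p X :: ('k::field, ('x, 'k) field_chain set) module)
           (homology_space p Y) (homology_map p Y g)"
  unfolding linear_map_def mod_hom_def mod_hom_axioms_def module_hom_def
  using vectorspace_homology_space[of p X, where 'k = 'k] vectorspace_homology_space[of p Y, where 'k = 'k]
  by (auto simp: vectorspace_def carrier_homology_space homology_map_class[OF g] add_homology_space
      smult_homology_space field_chain_map_add field_chain_map_scale cycles_add cycles_scale field_chain_map_cycle[OF _ g])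

lemma homology_map_compose:
  assumes "C \<in> carrier (homology_space p X)" "continuous_map X Y g" "continuous_map Y Z h"
  shows "homology_map p Z h (homology_map p Y g C) = homology_map p Z (h \<circ> g) C"
proof -
  obtain x where "x \<in> field_cycles p X" "C = homology_class p X x"
    using assms(1) by (auto simp: carrier_homology_space)
  then show ?thesis
    by (simp add: homology_map_class[OF assms(2)] homology_map_class[OF assms(3)]
        homology_map_class[OF continuous_map_compose[OF assms(2,3)]] field_chain_map_compose)
qed

lemma homology_map_cong:
  assumes C: "C \<in> carrier (homology_space p X)" and g: "continuous_map X Y g" and h: "continuous_map X Y h"
    and eq: "\<And>x. x \<in> topspace X \<Longrightarrow> g x = h x"
  shows "homology_map p Y g C = homology_map p Y h C"
proof -
  obtain x where "x \<in> field_cycles p X" "C = homology_class p X x"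
    using C by (auto simp: carrier_homology_space)
  then show ?thesis
    using field_chain_map_cong[OF _ eq, of x p X]
    by (simp add: homology_map_class[OF g] homology_map_class[OF h] field_cycles_def)
qed

text \<open>Acyclicity of the cone in degree \<open>p\<close>, for pairs \<open>(0, z)\<close>, gives surjectivity; in degree \<open>p + 1\<close>, for
  pairs whose first component is a difference of two cycles, it gives injectivity.\<close>

lemma bij_betw_homology_map:
  fixes X :: "'x topology" and Y :: "'y topology"
  assumes g: "continuous_map X Y g" and acyclic: "mapping_cone_acyclic TYPE('k::field) X Y g"
  shows "bij_betw (homology_map p Y g) (carrier (homology_space p X :: ('k, ('x, 'k) field_chain set) module))
           (carrier (homology_space p Y))"
  unfolding bij_betw_def
proof
  let ?HX = "homology_space p X :: ('k, ('x, 'k) field_chain set) module"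
  let ?HY = "homology_space p Y :: ('k, ('y, 'k) field_chain set) module"
  show "inj_on (homology_map p Y g) (carrier ?HX)"
  proof (rule inj_onI)
    fix C D assume "C \<in> carrier ?HX" "D \<in> carrier ?HX" and eq: "homology_map p Y g C = homology_map p Y g D"
    then obtain x y where xy: "x \<in> field_cycles p X" "y \<in> field_cycles p X"
        and CD: "C = homology_class p X x" "D = homology_class p X y"
      by (auto simp: carrier_homology_space)
    have "field_chain_map p g (x - y) \<in> field_boundaries p Y"
      using eq unfolding CD homology_map_class[OF g] homology_class_eq_iff field_chain_map_diff .
    then obtain u where u: "u \<in> field_chains (Suc p) Y" "field_boundary (Suc p) u = field_chain_map p g (x - y)"
      by (auto simp: field_boundaries_def)
    have w: "x - y \<in> field_chains (Suc p - Suc 0) X" "field_boundary (Suc p - Suc 0) (x - y) = 0"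
      using xy by (simp_all add: field_cycles_def field_chains_diff field_boundary_diff)
    obtain a where "a \<in> field_chains (Suc p) X" "field_boundary (Suc p) a = x - y"
      by (rule mapping_cone_acyclicE[OF acyclic w(1) u(1) _ w(2)]) (use u(2) in simp_all)
    then have "x - y \<in> field_boundaries p X"
      by (auto simp: field_boundaries_def intro!: image_eqI[of _ _ a])
    then show "C = D"
      by (simp add: CD homology_class_eq_iff)
  qed
  show "homology_map p Y g ` carrier ?HX = carrier ?HY"
  proof
    show "homology_map p Y g ` carrier ?HX \<subseteq> carrier ?HY"
      by (auto simp: carrier_homology_space homology_map_class[OF g] field_chain_map_cycle[OF _ g])
    show "carrier ?HY \<subseteq> homology_map p Y g ` carrier ?HX"
    proof
      fix D assume "D \<in> carrier ?HY"
      then obtain z where z: "z \<in> field_chains p Y" "field_boundary p z = 0" "D = homology_class p Y z"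
        by (auto simp: carrier_homology_space field_cycles_def)
      obtain a b where ab: "a \<in> field_chains p X" "b \<in> field_chains (Suc p) Y" "field_boundary p a = 0"
          "z = field_chain_map p g a + field_boundary (Suc p) b"
        by (rule mapping_cone_acyclicE[OF acyclic, of 0 p z]) (use z in auto)
      have "D = homology_class p Y (field_chain_map p g a)"
        unfolding z(3) homology_class_eq_iff using ab by (simp add: field_boundaries_def)
      then have "D = homology_map p Y g (homology_class p X a)"
        by (simp add: homology_map_class[OF g])
      moreover have "homology_class p X a \<in> carrier ?HX"
        using ab by (simp add: carrier_homology_space field_cycles_def)
      ultimately show "D \<in> homology_map p Y g ` carrier ?HX"
        by (rule image_eqI)
    qed
  qed
qed

section \<open>Isomorphic persistence modules\<close>

lemma linear_map_inv_into:
  assumes f: "linear_map R A B f" and bij: "bij_betw f (carrier A) (carrier B)"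
  shows "linear_map R B A (inv_into (carrier A) f)"
proof -
  interpret f: linear_map R A B f
    by (rule f)
  let ?g = "inv_into (carrier A) f"
  have g: "?g y \<in> carrier A" "f (?g y) = y" if "y \<in> carrier B" for y
    using bij that by (auto simp: bij_betw_def inv_into_into f_inv_into_f)
  have eq: "?g y = x" if "x \<in> carrier A" "f x = y" for x y
    using bij that by (auto simp: bij_betw_def)
  show ?thesis
    unfolding linear_map_def mod_hom_def mod_hom_axioms_def module_hom_def
  proof (intro conjI CollectI)
    show "vectorspace R B" "vectorspace R A" "Module.module R B" "Module.module R A"
      by unfold_locales
    show "?g \<in> carrier B \<rightarrow> carrier A"
      using g by blast
    show "\<forall>m1 m2. m1 \<in> carrier B \<and> m2 \<in> carrier B \<longrightarrow> ?g (m1 \<oplus>\<^bsub>B\<^esub> m2) = ?g m1 \<oplus>\<^bsub>A\<^esub> ?g m2"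
      by (intro allI impI eq) (auto simp: g)
    show "\<forall>r m. r \<in> carrier R \<and> m \<in> carrier B \<longrightarrow> ?g (r \<odot>\<^bsub>B\<^esub> m) = r \<odot>\<^bsub>A\<^esub> ?g m"
      by (intro allI impI eq) (auto simp: g)
  qed
qed

lemma linear_map_comp:
  assumes f: "linear_map R A B f" and g: "linear_map R B C g"
  shows "linear_map R A C (g \<circ> f)"
proof -
  interpret f: linear_map R A B f
    by (rule f)
  interpret g: linear_map R B C g
    by (rule g)
  show ?thesis
    unfolding linear_map_def mod_hom_def mod_hom_axioms_def module_hom_def
    by (intro conjI CollectI) (unfold_locales, auto)
qed

lemma pmodule_isomorphic_sym:
  assumes V: "fin_dim_persistence_module n V" and iso: "pmodule_isomorphic n V W"
  shows "pmodule_isomorphic n W V"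
proof -
  obtain h where h: "\<And>i. i \<in> {1..n} \<Longrightarrow> linear_map class_ring (pspace V i) (pspace W i) (h i)"
    and bij: "\<And>i. i \<in> {1..n} \<Longrightarrow> bij_betw (h i) (carrier (pspace V i)) (carrier (pspace W i))"
    and comm: "\<And>i x. i \<in> {1..<n} \<Longrightarrow> x \<in> carrier (pspace V i) \<Longrightarrow> h (i + 1) (pmap V i x) = pmap W i (h i x)"
    using iso unfolding pmodule_isomorphic_def by blast
  let ?k = "\<lambda>i. inv_into (carrier (pspace V i)) (h i)"
  show ?thesis
    unfolding pmodule_isomorphic_def
  proof (intro exI[of _ ?k] conjI ballI)
    fix i assume i: "i \<in> {1..n}"
    show "linear_map class_ring (pspace W i) (pspace V i) (?k i)"
      by (rule linear_map_inv_into[OF h[OF i] bij[OF i]])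
    show "bij_betw (?k i) (carrier (pspace W i)) (carrier (pspace V i))"
      by (rule bij_betw_inv_into[OF bij[OF i]])
  next
    fix i y assume i: "i \<in> {1..<n}" and y: "y \<in> carrier (pspace W i)"
    have i': "i \<in> {1..n}" "i + 1 \<in> {1..n}"
      using i by auto
    define x where "x = ?k i y"
    have x: "x \<in> carrier (pspace V i)" "h i x = y"
      using bij[OF i'(1)] y by (auto simp: x_def bij_betw_def inv_into_into f_inv_into_f)
    have "linear_map class_ring (pspace V i) (pspace V (i + 1)) (pmap V i)"
      using V i by (simp add: fin_dim_persistence_module_def)
    then have "pmap V i x \<in> carrier (pspace V (i + 1))"
      using x(1) by (auto simp: linear_map_def mod_hom_def mod_hom_axioms_def module_hom_def)
    then have "?k (i + 1) (h (i + 1) (pmap V i x)) = pmap V i x"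
      using bij[OF i'(2)] by (simp add: bij_betw_def)
    then show "?k (i + 1) (pmap W i y) = pmap V i (?k i y)"
      using comm[OF i x(1)] x(2) by (simp add: x_def)
  qed
qed

lemma pmodule_isomorphic_trans:
  assumes UV: "pmodule_isomorphic n U V" and VW: "pmodule_isomorphic n V W"
  shows "pmodule_isomorphic n U W"
proof -
  obtain h where h: "\<And>i. i \<in> {1..n} \<Longrightarrow> linear_map class_ring (pspace U i) (pspace V i) (h i)"
    "\<And>i. i \<in> {1..n} \<Longrightarrow> bij_betw (h i) (carrier (pspace U i)) (carrier (pspace V i))"
    "\<And>i x. i \<in> {1..<n} \<Longrightarrow> x \<in> carrier (pspace U i) \<Longrightarrow> h (i + 1) (pmap U i x) = pmap V i (h i x)"
    using UV unfolding pmodule_isomorphic_def by blast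
  obtain k where k: "\<And>i. i \<in> {1..n} \<Longrightarrow> linear_map class_ring (pspace V i) (pspace W i) (k i)"
    "\<And>i. i \<in> {1..n} \<Longrightarrow> bij_betw (k i) (carrier (pspace V i)) (carrier (pspace W i))"
    "\<And>i x. i \<in> {1..<n} \<Longrightarrow> x \<in> carrier (pspace V i) \<Longrightarrow> k (i + 1) (pmap V i x) = pmap W i (k i x)"
    using VW unfolding pmodule_isomorphic_def by blast
  show ?thesis
    unfolding pmodule_isomorphic_def
  proof (intro exI[of _ "\<lambda>i. k i \<circ> h i"] conjI ballI)
    fix i assume i: "i \<in> {1..n}"
    show "linear_map class_ring (pspace U i) (pspace W i) (k i \<circ> h i)"
      by (rule linear_map_comp[OF h(1)[OF i] k(1)[OF i]])
    show "bij_betw (k i \<circ> h i) (carrier (pspace U i)) (carrier (pspace W i))"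
      by (rule bij_betw_trans[OF h(2)[OF i] k(2)[OF i]])
  next
    fix i x assume i: "i \<in> {1..<n}" and x: "x \<in> carrier (pspace U i)"
    then have "h i x \<in> carrier (pspace V i)"
      using h(2)[of i] by (auto simp: bij_betw_def)
    then show "(k (i + 1) \<circ> h (i + 1)) (pmap U i x) = pmap W i ((k i \<circ> h i) x)"
      using h(3)[OF i x] k(3)[OF i] by simp
  qed
qed

text \<open>The two modules have the same interval decompositions, so the definite description in the definition
  of the diagram denotes the same multiset for both.\<close>

lemma persistence_diagram_isomorphic:
  assumes V: "fin_dim_persistence_module n V" and iso: "pmodule_isomorphic n V W"
  shows "persistence_diagram n V = persistence_diagram n W"
proof -
  have "interval_decomposition n V D \<longleftrightarrow> interval_decomposition n W D" for D
    using pmodule_isomorphic_trans[OF iso] pmodule_isomorphic_trans[OF pmodule_isomorphic_sym[OF V iso]]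
    unfolding interval_decomposition_def by blast
  then show ?thesis
    by (simp add: persistence_diagram_def)
qed

section \<open>The topology of a disjoint family\<close>

text \<open>Since distinct members are disjoint, only sets cut out of \<open>A\<close> itself contribute to \<open>W \<inter> A\<close>.\<close>

lemma openin_family_topology_iff:
  assumes "disjoint \<A>"
  shows "openin (family_topology X \<A>) W \<longleftrightarrow> W \<subseteq> \<Union>\<A> \<and> (\<forall>A\<in>\<A>. \<exists>U. openin X U \<and> W \<inter> A = A \<inter> U)"
  (is "?lhs \<longleftrightarrow> ?rhs")
proof
  assume ?lhs
  then obtain \<U> where \<U>: "\<U> \<subseteq> {S. \<exists>A\<in>\<A>. \<exists>U. openin X U \<and> S = A \<inter> U}" "\<Union>\<U> = W"
    unfolding openin_family_topology[OF assms] union_of_def by blast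
  show ?rhs
  proof (intro conjI ballI)
    show "W \<subseteq> \<Union>\<A>"
      using \<U> by blast
    fix A assume A: "A \<in> \<A>"
    let ?U = "\<Union>{U. openin X U \<and> A \<inter> U \<in> \<U>}"
    have "openin X ?U"
      by (intro openin_Union) blast
    moreover have "W \<inter> A \<subseteq> A \<inter> ?U"
    proof
      fix x assume x: "x \<in> W \<inter> A"
      then obtain S where S: "S \<in> \<U>" "x \<in> S"
        using \<U>(2) by blast
      then obtain B U where B: "B \<in> \<A>" "openin X U" "S = B \<inter> U"
        using \<U>(1) by blast
      have "A = B"
        using A B x S assms unfolding disjoint_def by blast
      then show "x \<in> A \<inter> ?U"
        using S B x by blast
    qed
    moreover have "A \<inter> ?U \<subseteq> W \<inter> A"
      using \<U>(2) by blast
    ultimately show "\<exists>U. openin X U \<and> W \<inter> A = A \<inter> U"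
      by blast
  qed
next
  assume R: ?rhs
  let ?\<U> = "{S. (\<exists>A\<in>\<A>. \<exists>U. openin X U \<and> S = A \<inter> U) \<and> S \<subseteq> W}"
  have "W \<subseteq> \<Union>?\<U>"
  proof
    fix x assume x: "x \<in> W"
    then obtain A where A: "A \<in> \<A>" "x \<in> A"
      using R by blast
    then obtain U where "openin X U" "W \<inter> A = A \<inter> U"
      using R by blast
    then have "W \<inter> A \<in> ?\<U>"
      using A by blast
    then show "x \<in> \<Union>?\<U>"
      using x A by blast
  qed
  then have eq: "\<Union>?\<U> = W"
    by blast
  have sub: "?\<U> \<subseteq> {S. \<exists>A\<in>\<A>. \<exists>U. openin X U \<and> S = A \<inter> U}"
    by (intro subsetI CollectI) (elim CollectE conjE)
  show ?lhs
    unfolding openin_family_topology[OF assms] union_of_def arbitrary_def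
    by (intro exI[of _ ?\<U>] conjI TrueI sub eq)
qed

lemma continuous_map_family_topology:
  assumes \<A>: "disjoint \<A>" "\<Union>\<A> \<subseteq> topspace X" and \<B>: "disjoint \<B>" "\<Union>\<B> \<subseteq> topspace Y"
    and f: "continuous_map X Y f" and AB: "\<And>A. A \<in> \<A> \<Longrightarrow> \<exists>B\<in>\<B>. f ` A \<subseteq> B"
  shows "continuous_map (family_topology X \<A>) (family_topology Y \<B>) f"
  unfolding continuous_map_def topspace_family_topology[OF \<A>] topspace_family_topology[OF \<B>]
proof (intro conjI allI impI)
  show "f \<in> \<Union>\<A> \<rightarrow> \<Union>\<B>"
    using AB by blast
  fix W assume W: "openin (family_topology Y \<B>) W"
  show "openin (family_topology X \<A>) {x \<in> \<Union>\<A>. f x \<in> W}"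
    unfolding openin_family_topology_iff[OF \<A>(1)]
  proof (intro conjI ballI)
    fix A assume A: "A \<in> \<A>"
    obtain B where B: "B \<in> \<B>" "f ` A \<subseteq> B"
      using AB[OF A] by blast
    obtain U where U: "openin Y U" "W \<inter> B = B \<inter> U"
      using W B(1) unfolding openin_family_topology_iff[OF \<B>(1)] by blast
    have "openin X {x \<in> topspace X. f x \<in> U}"
      by (rule openin_continuous_map_preimage[OF f U(1)])
    moreover have "{x \<in> \<Union>\<A>. f x \<in> W} \<inter> A = A \<inter> {x \<in> topspace X. f x \<in> U}"
      using A B(2) U(2) \<A>(2) by blast
    ultimately show "\<exists>U. openin X U \<and> {x \<in> \<Union>\<A>. f x \<in> W} \<inter> A = A \<inter> U"
      by (intro exI conjI)
  qed (auto intro: subsetI)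
qed

text \<open>Within a single member the family topology can be forgotten.\<close>

lemma subtopology_family_topology:
  assumes "disjoint \<A>" "A \<in> \<A>" "S \<subseteq> A"
  shows "subtopology (family_topology X \<A>) S = subtopology X S"
  unfolding topology_eq
proof
  fix V
  show "openin (subtopology (family_topology X \<A>) S) V \<longleftrightarrow> openin (subtopology X S) V"
  proof
    assume "openin (subtopology (family_topology X \<A>) S) V"
    then obtain W where W: "openin (family_topology X \<A>) W" "V = W \<inter> S"
      by (auto simp: openin_subtopology)
    obtain U where "openin X U" "W \<inter> A = A \<inter> U"
      using W(1) assms(2) unfolding openin_family_topology_iff[OF assms(1)] by blast
    moreover from this have "V = U \<inter> S"
      using W(2) assms(3) by blast
    ultimately show "openin (subtopology X S) V"
      by (auto simp: openin_subtopology)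
  next
    assume "openin (subtopology X S) V"
    then obtain U where U: "openin X U" "V = U \<inter> S"
      by (auto simp: openin_subtopology)
    have "openin (family_topology X \<A>) (A \<inter> U)"
      unfolding openin_family_topology[OF assms(1)]
      by (rule arbitrary_union_of_inc) (use U(1) assms(2) in blast)
    moreover have "V = (A \<inter> U) \<inter> S"
      using U(2) assms(3) by blast
    ultimately show "openin (subtopology (family_topology X \<A>) S) V"
      by (auto simp: openin_subtopology)
  qed
qed

section \<open>Polytopes in barycentric coordinates\<close>

lemma topspace_alexandrov_topology [simp]: "topspace (alexandrov_topology K) = K"
proof
  show "topspace (alexandrov_topology K) \<subseteq> K"
    using openin_topspace[of "alexandrov_topology K"] unfolding openin_alexandrov_topology by blast
  have "openin (alexandrov_topology K) K"
    by (simp add: openin_alexandrov_topology)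
  then show "K \<subseteq> topspace (alexandrov_topology K)"
    by (rule openin_subset)
qed

lemma topspace_polytope_topology:
  assumes "finite_simplicial_complex K"
  shows "topspace (polytope_topology K) = polytope_of K"
  using Metric_space.topspace_mtopology[OF Metric_space_polytope[OF assms]]
  by (simp add: polytope_topology_def)

lemma simplex_of_complex:
  assumes "finite_simplicial_complex K" "\<sigma> \<in> K"
  shows finite_simplex: "finite \<sigma>" and simplex_nonempty: "\<sigma> \<noteq> {}"
    and face_in_complex: "\<tau> \<noteq> {} \<Longrightarrow> \<tau> \<subseteq> \<sigma> \<Longrightarrow> \<tau> \<in> K"
proof -
  have *: "finite \<sigma> \<and> \<sigma> \<noteq> {} \<and> (\<forall>\<tau>. \<tau> \<noteq> {} \<and> \<tau> \<subseteq> \<sigma> \<longrightarrow> \<tau> \<in> K)"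
    using conjunct2[OF assms(1)[unfolded finite_simplicial_complex_def]] assms(2) by (rule bspec)
  show "finite \<sigma>"
    using * by (rule conjunct1)
  show "\<sigma> \<noteq> {}"
    using * by (elim conjE)
  show "\<tau> \<in> K" if "\<tau> \<noteq> {}" "\<tau> \<subseteq> \<sigma>"
    using conjunct2[OF conjunct2[OF *], rule_format, of \<tau>] that by blast
qed

lemma finite_vertices:
  assumes "finite_simplicial_complex K"
  shows "finite (\<Union>K)"
  using conjunct1[OF assms[unfolded finite_simplicial_complex_def]] finite_simplex[OF assms]
  by (rule finite_Union)

lemma polytope_coordinate_outside: "x \<in> polytope_of K \<Longrightarrow> v \<notin> \<Union>K \<Longrightarrow> x v = 0"
  unfolding polytope_of_def closed_simplex_def by blast

lemma continuous_map_coordinate: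
  assumes K: "finite_simplicial_complex K"
  shows "continuous_map (polytope_topology K) euclideanreal (\<lambda>x. x v)"
  unfolding continuous_map_def topspace_polytope_topology[OF K]
proof (intro conjI allI impI)
  interpret Metric_space "polytope_of K" "polytope_dist K"
    by (rule Metric_space_polytope[OF K])
  fix V :: "real set" assume "openin euclideanreal V"
  then have V: "open V" by simp
  show "openin (polytope_topology K) {x \<in> polytope_of K. x v \<in> V}"
    unfolding polytope_topology_def openin_mtopology
  proof (intro conjI allI impI)
    fix x assume x: "x \<in> {x \<in> polytope_of K. x v \<in> V}"
    then obtain e where e: "e > 0" "ball (x v) e \<subseteq> V"
      using V open_contains_ball by blast
    have "y v \<in> V" if y: "y \<in> mball x e" for y
    proof -
      have "\<bar>x v - y v\<bar> \<le> polytope_dist K x y"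
      proof (cases "v \<in> \<Union>K")
        case True
        have "\<bar>x v - y v\<bar> \<le> L2_set (\<lambda>v. \<bar>x v - y v\<bar>) (\<Union>K)"
          by (rule member_le_L2_set[OF finite_vertices[OF K] True])
        then show ?thesis
          by (simp add: polytope_dist_def L2_set_def)
      next
        case False
        have "x v = 0"
          by (rule polytope_coordinate_outside[OF _ False]) (use x in simp)
        moreover have "y v = 0"
          by (rule polytope_coordinate_outside[OF _ False]) (use y in simp)
        ultimately show ?thesis
          by (simp add: polytope_dist_def L2_set_nonneg)
      qed
      also have "\<dots> < e"
        using y by simp
      finally show ?thesis
        using e(2) by (auto simp: dist_real_def)
    qed
    then show "\<exists>r>0. mball x r \<subseteq> {x \<in> polytope_of K. x v \<in> V}"
      using e(1) by (intro exI[of _ e]) auto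
  qed auto
qed simp

text \<open>As there are only finitely many vertices, the metric of the polytope gives coordinatewise
  convergence.\<close>

lemma continuous_map_into_polytope:
  assumes K: "finite_simplicial_complex K"
    and f: "\<And>z. z \<in> topspace Z \<Longrightarrow> f z \<in> polytope_of K"
    and cont: "\<And>v. continuous_map Z euclideanreal (\<lambda>z. f z v)"
  shows "continuous_map Z (polytope_topology K) f"
proof -
  interpret Metric_space "polytope_of K" "polytope_dist K"
    by (rule Metric_space_polytope[OF K])
  show ?thesis
    unfolding polytope_topology_def continuous_map_to_metric
  proof (intro ballI allI impI)
    fix x and e :: real assume x: "x \<in> topspace Z" and e: "e > 0"
    have zero: "polytope_dist K (f x) (f x) = 0"
      by (simp add: polytope_dist_def L2_set_def)
    have "continuous_map Z euclideanreal (\<lambda>z. polytope_dist K (f x) (f z))"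
      unfolding polytope_dist_def L2_set_def
      by (intro continuous_map_sqrt continuous_map_sum continuous_map_real_pow continuous_map_diff cont
          finite_vertices[OF K]) simp
    then have "openin Z {z \<in> topspace Z. polytope_dist K (f x) (f z) \<in> {..<e}}"
      by (rule openin_continuous_map_preimage) simp
    moreover have "x \<in> {z \<in> topspace Z. polytope_dist K (f x) (f z) \<in> {..<e}}"
      by (simp add: zero x e)
    moreover have "f z \<in> mball (f x) e" if "z \<in> {z \<in> topspace Z. polytope_dist K (f x) (f z) \<in> {..<e}}" for z
      using that f[of z] f[OF x] by simp
    ultimately show "\<exists>U. openin Z U \<and> x \<in> U \<and> (\<forall>y\<in>U. f y \<in> mball (f x) e)"
      by (intro exI[of _ "{z \<in> topspace Z. polytope_dist K (f x) (f z) \<in> {..<e}}"] conjI ballI)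
  qed
qed

text \<open>For a point of a polytope this is the simplex whose open cell contains it.\<close>

definition support :: "('a \<Rightarrow> real) \<Rightarrow> 'a set" where
  "support x = {v. x v \<noteq> 0}"

lemma open_cellI:
  assumes "\<And>v. v \<in> \<sigma> \<Longrightarrow> 0 < x v" "\<And>v. v \<notin> \<sigma> \<Longrightarrow> x v = 0" "(\<Sum>v\<in>\<sigma>. x v) = 1"
  shows "x \<in> open_cell \<sigma>"
  unfolding open_cell_def closed_simplex_def using assms by (simp add: less_imp_le)

lemma open_cellD:
  assumes "x \<in> open_cell \<sigma>"
  shows "v \<in> \<sigma> \<Longrightarrow> 0 < x v" and "v \<notin> \<sigma> \<Longrightarrow> x v = 0" and "(\<Sum>v\<in>\<sigma>. x v) = 1"
  using assms unfolding open_cell_def closed_simplex_def by simp_all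

lemma support_open_cell:
  assumes "x \<in> open_cell \<sigma>"
  shows "support x = \<sigma>"
proof (rule Set.set_eqI)
  show "v \<in> support x \<longleftrightarrow> v \<in> \<sigma>" for v
    using open_cellD(1,2)[OF assms, of v] unfolding support_def by (cases "v \<in> \<sigma>") auto
qed

lemma open_cell_support:
  assumes "x \<in> closed_simplex \<sigma>" "finite \<sigma>"
  shows "x \<in> open_cell (support x)" "support x \<subseteq> \<sigma>" "support x \<noteq> {}"
proof -
  have pos: "0 \<le> x v" if "v \<in> \<sigma>" for v
    using assms(1) that unfolding closed_simplex_def by simp
  have zero: "x v = 0" if "v \<notin> \<sigma>" for v
    using assms(1) that unfolding closed_simplex_def by simp
  show sub: "support x \<subseteq> \<sigma>"
    using zero unfolding support_def by blast
  have "(\<Sum>v\<in>support x. x v) = (\<Sum>v\<in>\<sigma>. x v)"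
    by (rule sum.mono_neutral_left[OF assms(2) sub]) (simp add: support_def)
  also have "\<dots> = 1"
    using assms(1) unfolding closed_simplex_def by simp
  finally have sum: "(\<Sum>v\<in>support x. x v) = 1" .
  then show "support x \<noteq> {}"
    by auto
  show "x \<in> open_cell (support x)"
  proof (rule open_cellI)
    show "0 < x v" if "v \<in> support x" for v
      using that pos[OF subsetD[OF sub that]] unfolding support_def by simp
    show "x v = 0" if "v \<notin> support x" for v
      using that unfolding support_def by simp
  qed (rule sum)
qed

text \<open>Every point of the polytope lies in exactly one open cell, that of its support.\<close>

lemma polytope_of_iff_open_cell:
  assumes "finite_simplicial_complex K"
  shows "x \<in> polytope_of K \<longleftrightarrow> support x \<in> K \<and> x \<in> open_cell (support x)"
proof
  assume "x \<in> polytope_of K"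
  then obtain \<sigma> where \<sigma>: "\<sigma> \<in> K" "x \<in> closed_simplex \<sigma>"
    by (auto simp: polytope_of_def)
  note cell = open_cell_support[OF \<sigma>(2) finite_simplex[OF assms \<sigma>(1)]]
  show "support x \<in> K \<and> x \<in> open_cell (support x)"
    using face_in_complex[OF assms \<sigma>(1) cell(3,2)] cell(1) by (rule conjI)
next
  assume "support x \<in> K \<and> x \<in> open_cell (support x)"
  then show "x \<in> polytope_of K"
    unfolding polytope_of_def open_cell_def by blast
qed

lemma solid_eq:
  assumes K: "finite_simplicial_complex K" and M: "M \<subseteq> K"
  shows "solid M = {x \<in> polytope_of K. support x \<in> M}"
proof (intro equalityI subsetI)
  fix x assume "x \<in> solid M"
  then obtain \<sigma> where "\<sigma> \<in> M" "x \<in> open_cell \<sigma>"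
    unfolding solid_def by blast
  then have "support x \<in> M" "x \<in> open_cell (support x)"
    by (simp_all only: support_open_cell)
  then show "x \<in> {x \<in> polytope_of K. support x \<in> M}"
    unfolding polytope_of_iff_open_cell[OF K] using M by blast
next
  fix x assume "x \<in> {x \<in> polytope_of K. support x \<in> M}"
  then show "x \<in> solid M"
    unfolding polytope_of_iff_open_cell[OF K] solid_def by blast
qed

lemma disjoint_solids:
  assumes "disjoint \<M>"
  shows "disjoint (solid ` \<M>)"
proof -
  have *: "support x \<in> M" if "x \<in> solid M" for x and M :: "'a set set"
    using that support_open_cell by (auto simp: solid_def)
  show ?thesis
    unfolding disjoint_def
  proof (intro ballI impI)
    fix A B assume "A \<in> solid ` \<M>" "B \<in> solid ` \<M>" "A \<noteq> B"
    then obtain M N where "M \<in> \<M>" "N \<in> \<M>" "M \<noteq> N" "A = solid M" "B = solid N"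
      by blast
    then show "A \<inter> B = {}"
      using * assms unfolding disjoint_def by blast
  qed
qed

text \<open>The preimage of an upper set is a union of open stars, and an open star is given by finitely many
  conditions on single coordinates.\<close>

lemma continuous_map_support:
  assumes K: "finite_simplicial_complex K"
  shows "continuous_map (polytope_topology K) (alexandrov_topology K) support"
  unfolding continuous_map_def topspace_polytope_topology[OF K] topspace_alexandrov_topology
proof (intro conjI allI impI)
  show "support \<in> polytope_of K \<rightarrow> K"
    using polytope_of_iff_open_cell[OF K] by blast
  fix U assume "openin (alexandrov_topology K) U"
  then have U: "U \<subseteq> K" "\<And>\<sigma> \<tau>. \<sigma> \<in> U \<Longrightarrow> \<tau> \<in> K \<Longrightarrow> \<sigma> \<subseteq> \<tau> \<Longrightarrow> \<tau> \<in> U"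
    by (auto simp: openin_alexandrov_topology)
  let ?star = "\<lambda>\<sigma>. {x \<in> polytope_of K. \<sigma> \<subseteq> support x}"
  have "openin (polytope_topology K) (?star \<sigma>)" if "\<sigma> \<in> U" for \<sigma>
  proof -
    have \<sigma>: "finite \<sigma>" "\<sigma> \<noteq> {}"
      using finite_simplex[OF K subsetD[OF U(1) that]] simplex_nonempty[OF K subsetD[OF U(1) that]] .
    have "openin (polytope_topology K) {x \<in> topspace (polytope_topology K). x v \<in> - {0}}" for v
      by (rule openin_continuous_map_preimage[OF continuous_map_coordinate[OF K]]) auto
    then have "openin (polytope_topology K) (\<Inter>v\<in>\<sigma>. {x \<in> polytope_of K. x v \<noteq> 0})"
      using \<sigma> by (intro openin_Inter) (auto simp: topspace_polytope_topology[OF K])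
    moreover have "(\<Inter>v\<in>\<sigma>. {x \<in> polytope_of K. x v \<noteq> 0}) = ?star \<sigma>"
      using \<sigma>(2) by (auto simp: support_def)
    ultimately show ?thesis by simp
  qed
  then have "openin (polytope_topology K) (\<Union>\<sigma>\<in>U. ?star \<sigma>)"
    by (intro openin_Union) auto
  moreover have "(\<Union>\<sigma>\<in>U. ?star \<sigma>) = {x \<in> polytope_of K. support x \<in> U}"
    using U(2) polytope_of_iff_open_cell[OF K] by blast
  ultimately show "openin (polytope_topology K) {x \<in> polytope_of K. support x \<in> U}"
    by simp
qed

definition barycenter :: "'a set \<Rightarrow> 'a \<Rightarrow> real" where
  "barycenter \<sigma> v = (if v \<in> \<sigma> then 1 / card \<sigma> else 0)"

lemma barycenter_in_open_cell: "finite \<sigma> \<Longrightarrow> \<sigma> \<noteq> {} \<Longrightarrow> barycenter \<sigma> \<in> open_cell \<sigma>"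
  by (rule open_cellI) (auto simp: barycenter_def card_gt_0_iff)

lemma segment_in_open_cell:
  assumes x: "x \<in> open_cell \<tau>" and b: "b \<in> open_cell \<sigma>" and sub: "\<sigma> \<subseteq> \<tau>" "finite \<tau>" and t: "0 \<le> t" "t < (1::real)"
  shows "(\<lambda>v. (1 - t) * x v + t * b v) \<in> open_cell \<tau>"
proof -
  note x' = open_cellD[OF x] and b' = open_cellD[OF b]
  have "0 \<le> b v" for v
    using b'(1,2)[of v] by (cases "v \<in> \<sigma>") auto
  then have pos: "0 < (1 - t) * x v + t * b v" if "v \<in> \<tau>" for v
    using x'(1)[OF that] t by (intro add_pos_nonneg) auto
  have zero: "(1 - t) * x v + t * b v = 0" if "v \<notin> \<tau>" for v
  proof -
    have "v \<notin> \<sigma>"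
      using that sub(1) by blast
    then show ?thesis
      using x'(2)[OF that] b'(2)[of v] by simp
  qed
  have "(\<Sum>v\<in>\<sigma>. b v) = (\<Sum>v\<in>\<tau>. b v)"
    by (rule sum.mono_neutral_left[OF sub(2,1)]) (use b'(2) in blast)
  then have "(\<Sum>v\<in>\<tau>. (1 - t) * x v + t * b v) = 1"
    using x'(3) b'(3) by (simp add: sum.distrib flip: sum_distrib_left)
  then show ?thesis
    by (intro open_cellI pos zero)
qed

text \<open>The straight line from a point to the barycentre of \<open>\<sigma>\<close> stays in the open cell of the point, since
  \<open>\<sigma>\<close> is a face of that cell, until it arrives in the open cell of \<open>\<sigma>\<close> at time 1.\<close>

lemma contractible_open_star:
  assumes K: "finite_simplicial_complex K" and \<sigma>: "\<sigma> \<in> U" and U: "U \<subseteq> K" "\<And>\<tau>. \<tau> \<in> U \<Longrightarrow> \<sigma> \<subseteq> \<tau>"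
  shows "contractible_space (subtopology (polytope_topology K) {x \<in> polytope_of K. support x \<in> U})"
proof -
  let ?S = "{x \<in> polytope_of K. support x \<in> U}"
  let ?Z = "subtopology (polytope_topology K) ?S"
  let ?P = "prod_topology (top_of_set {0..1::real}) ?Z"
  let ?b = "barycenter \<sigma>"
  let ?h = "\<lambda>(t, x). \<lambda>v. (1 - t) * x v + t * ?b v"
  have topZ: "topspace ?Z = ?S"
    by (auto simp: topspace_polytope_topology[OF K])
  have fin: "finite \<tau>" "\<tau> \<noteq> {}" if "\<tau> \<in> U" for \<tau>
    using finite_simplex[OF K subsetD[OF U(1) that]] simplex_nonempty[OF K subsetD[OF U(1) that]] .
  have b: "?b \<in> open_cell \<sigma>"
    using fin[OF \<sigma>] by (rule barycenter_in_open_cell)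
  have in_S: "x \<in> ?S" if "x \<in> open_cell \<tau>" "\<tau> \<in> U" for x \<tau>
    using that U(1) support_open_cell[OF that(1)] unfolding polytope_of_iff_open_cell[OF K] by auto
  have h: "?h (t, x) \<in> ?S" if t: "0 \<le> t" "t \<le> 1" and x: "x \<in> ?S" for t x
  proof (cases "t = 1")
    case True
    then show ?thesis
      using in_S[OF b \<sigma>] by simp
  next
    case False
    have x': "x \<in> open_cell (support x)" "support x \<in> U"
      using x unfolding polytope_of_iff_open_cell[OF K] by blast+
    have "?h (t, x) \<in> open_cell (support x)"
      using segment_in_open_cell[OF x'(1) b U(2)[OF x'(2)] fin(1)[OF x'(2)] t(1)] False t(2) by simp
    then show ?thesis
      using in_S x'(2) by blast
  qed
  have "continuous_map ?P ?Z ?h"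
    unfolding continuous_map_in_subtopology
  proof
    show "?h \<in> topspace ?P \<rightarrow> ?S"
      unfolding topspace_prod_topology topZ using h by auto
    show "continuous_map ?P (polytope_topology K) ?h"
    proof (rule continuous_map_into_polytope[OF K])
      show "?h z \<in> polytope_of K" if "z \<in> topspace ?P" for z
        using that h unfolding topspace_prod_topology topZ by auto
      fix v
      have fst: "continuous_map ?P euclideanreal fst"
        by (rule continuous_map_into_fulltopology[OF continuous_map_fst])
      have coord: "continuous_map ?Z euclideanreal (\<lambda>x. x v)"
        by (rule continuous_map_from_subtopology[OF continuous_map_coordinate[OF K]])
      have snd: "continuous_map ?P euclideanreal (\<lambda>z. snd z v)"
        by (rule continuous_map_compose[OF continuous_map_snd coord, unfolded comp_def])
      have "continuous_map ?P euclideanreal (\<lambda>z. (1 - fst z) * snd z v + fst z * ?b v)"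
        by (intro continuous_map_add continuous_map_diff continuous_map_real_mult fst snd) auto
      then show "continuous_map ?P euclideanreal (\<lambda>z. ?h z v)"
        by (simp add: case_prod_beta)
    qed
  qed
  moreover have "?h (0, x) = id x" "?h (1, x) = ?b" for x
    by auto
  ultimately have "homotopic_with (\<lambda>x. True) ?Z ?Z id (\<lambda>x. ?b)"
    unfolding homotopic_with_def by (intro exI[of _ ?h] conjI allI) auto
  then show ?thesis
    unfolding contractible_space_def by blast
qed

text \<open>The image coordinates are sums of coordinates of \<open>x\<close>, which are positive on \<open>\<sigma>\<close>, so none of the
  vertices of \<open>\<phi> ` \<sigma>\<close> is lost by cancellation.\<close>

lemma polytope_map_open_cell:
  assumes K: "finite_simplicial_complex K" and \<sigma>: "\<sigma> \<in> K" and x: "x \<in> open_cell \<sigma>"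
  shows "polytope_map K \<phi> x \<in> open_cell (\<phi> ` \<sigma>)"
proof -
  have fin: "finite \<sigma>"
    by (rule finite_simplex[OF K \<sigma>])
  note x' = open_cellD[OF x]
  have eq: "polytope_map K \<phi> x w = (\<Sum>v | v \<in> \<sigma> \<and> \<phi> v = w. x v)" for w
    unfolding polytope_map_def
  proof (rule sum.mono_neutral_right)
    show "finite {v \<in> \<Union>K. \<phi> v = w}"
      using finite_vertices[OF K] by (rule rev_finite_subset) blast
    show "{v. v \<in> \<sigma> \<and> \<phi> v = w} \<subseteq> {v \<in> \<Union>K. \<phi> v = w}"
      using \<sigma> by blast
    show "\<forall>v\<in>{v \<in> \<Union>K. \<phi> v = w} - {v. v \<in> \<sigma> \<and> \<phi> v = w}. x v = 0"
      using x'(2) by blast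
  qed
  have pos: "0 < polytope_map K \<phi> x w" if "w \<in> \<phi> ` \<sigma>" for w
    unfolding eq by (rule sum_pos) (use fin that x'(1) in auto)
  have zero: "polytope_map K \<phi> x w = 0" if "w \<notin> \<phi> ` \<sigma>" for w
  proof -
    have "{v. v \<in> \<sigma> \<and> \<phi> v = w} = {}"
      using that by auto
    then show ?thesis
      unfolding eq by (simp only: sum.empty)
  qed
  have "(\<Sum>w\<in>\<phi> ` \<sigma>. polytope_map K \<phi> x w) = 1"
    unfolding eq using sum.image_gen[OF fin, of x \<phi>] x'(3) by (simp only:)
  then show ?thesis
    by (intro open_cellI pos zero)
qed

lemma support_polytope_map:
  assumes K: "finite_simplicial_complex K" and x: "x \<in> polytope_of K"
  shows "support (polytope_map K \<phi> x) = \<phi> ` support x"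
proof -
  have "support x \<in> K" "x \<in> open_cell (support x)"
    using x unfolding polytope_of_iff_open_cell[OF K] by blast+
  then show ?thesis
    by (rule support_open_cell[OF polytope_map_open_cell[OF K]])
qed

lemma polytope_map_in_polytope:
  assumes K: "finite_simplicial_complex K" and L: "finite_simplicial_complex L"
    and \<phi>: "simplicial_map K L \<phi>" and x: "x \<in> polytope_of K"
  shows "polytope_map K \<phi> x \<in> polytope_of L"
proof -
  have x': "support x \<in> K" "x \<in> open_cell (support x)"
    using x unfolding polytope_of_iff_open_cell[OF K] by blast+
  then have "\<phi> ` support x \<in> L"
    using \<phi> unfolding simplicial_map_def by blast
  then show ?thesis
    unfolding polytope_of_iff_open_cell[OF L] support_polytope_map[OF K x]
    using polytope_map_open_cell[OF K x'] by (rule conjI)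
qed

lemma continuous_map_polytope_map:
  assumes K: "finite_simplicial_complex K" and L: "finite_simplicial_complex L" and \<phi>: "simplicial_map K L \<phi>"
  shows "continuous_map (polytope_topology K) (polytope_topology L) (polytope_map K \<phi>)"
proof (rule continuous_map_into_polytope[OF L])
  show "polytope_map K \<phi> x \<in> polytope_of L" if "x \<in> topspace (polytope_topology K)" for x
    using that unfolding topspace_polytope_topology[OF K] by (rule polytope_map_in_polytope[OF K L \<phi>])
  show "continuous_map (polytope_topology K) euclideanreal (\<lambda>x. polytope_map K \<phi> x w)" for w
    unfolding polytope_map_def
    by (intro continuous_map_sum continuous_map_coordinate[OF K] finite_subset[OF _ finite_vertices[OF K]]) blast
qed

lemma continuous_map_simplicial_map:
  assumes "simplicial_map K L \<phi>"
  shows "continuous_map (alexandrov_topology K) (alexandrov_topology L) ((`) \<phi>)"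
  unfolding continuous_map_def topspace_alexandrov_topology
proof (intro conjI allI impI)
  have \<phi>: "\<phi> ` \<sigma> \<in> L" if "\<sigma> \<in> K" for \<sigma>
    using assms that unfolding simplicial_map_def by (rule bspec)
  then show "(`) \<phi> \<in> K \<rightarrow> L"
    by (rule Pi_I)
  fix U assume "openin (alexandrov_topology L) U"
  then have U: "\<forall>\<sigma>\<in>U. \<forall>\<tau>\<in>L. \<sigma> \<subseteq> \<tau> \<longrightarrow> \<tau> \<in> U"
    unfolding openin_alexandrov_topology by (rule conjunct2)
  show "openin (alexandrov_topology K) {\<sigma> \<in> K. \<phi> ` \<sigma> \<in> U}"
    unfolding openin_alexandrov_topology
  proof (intro conjI ballI impI)
    fix \<sigma> \<tau> assume \<sigma>: "\<sigma> \<in> {\<sigma> \<in> K. \<phi> ` \<sigma> \<in> U}" and \<tau>: "\<tau> \<in> K" "\<sigma> \<subseteq> \<tau>"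
    have "\<phi> ` \<sigma> \<in> U"
      using \<sigma> by simp
    then have "\<phi> ` \<tau> \<in> U"
      by (rule U[THEN bspec, THEN bspec, OF _ \<phi>[OF \<tau>(1)], THEN mp, OF _ image_mono[OF \<tau>(2)]])
    then show "\<tau> \<in> {\<sigma> \<in> K. \<phi> ` \<sigma> \<in> U}"
      using \<tau>(1) by simp
  qed (rule Collect_restrict)
qed

section \<open>Morse sets and their solids\<close>

lemma minimal_open_family_alexandrov:
  assumes \<M>: "disjoint \<M>" and M: "M \<in> \<M>" "M \<subseteq> K" "\<sigma> \<in> M"
    and U: "minimal_open (family_topology (alexandrov_topology K) \<M>) \<sigma> U"
  shows "U \<subseteq> M" and "\<And>\<tau>. \<tau> \<in> U \<Longrightarrow> \<sigma> \<subseteq> \<tau>"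
proof -
  let ?V = "M \<inter> {\<tau> \<in> K. \<sigma> \<subseteq> \<tau>}"
  have star: "openin (alexandrov_topology K) {\<tau> \<in> K. \<sigma> \<subseteq> \<tau>}"
    unfolding openin_alexandrov_topology by blast
  have "openin (family_topology (alexandrov_topology K) \<M>) ?V"
    unfolding openin_family_topology[OF \<M>]
    by (rule arbitrary_union_of_inc, rule bexI[OF _ M(1)], rule exI, rule conjI[OF star refl])
  moreover have "\<sigma> \<in> ?V"
    using M(2,3) by blast
  ultimately have "U \<subseteq> ?V"
    using U[unfolded minimal_open_def, THEN conjunct2, THEN conjunct2] by blast
  then show "U \<subseteq> M" "\<And>\<tau>. \<tau> \<in> U \<Longrightarrow> \<sigma> \<subseteq> \<tau>"
    by blast+
qed

locale morse_family =
  fixes K :: "'a set set" and \<M> :: "'a set set set"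
  assumes K: "finite_simplicial_complex K" and \<M>: "disjoint \<M>" "\<Union>\<M> \<subseteq> K"
begin

abbreviation cells :: "'a set topology" where
  "cells \<equiv> family_topology (alexandrov_topology K) \<M>"

abbreviation solids :: "('a \<Rightarrow> real) topology" where
  "solids \<equiv> family_topology (polytope_topology K) (solid ` \<M>)"

lemma member_subset: "M \<in> \<M> \<Longrightarrow> M \<subseteq> K"
  using \<M>(2) by blast

lemma topspace_cells: "topspace cells = \<Union>\<M>"
  by (rule topspace_family_topology[OF \<M>(1)]) (simp only: topspace_alexandrov_topology \<M>(2))

lemma solids_subset: "\<Union>(solid ` \<M>) \<subseteq> topspace (polytope_topology K)"
  unfolding topspace_polytope_topology[OF K] using solid_eq[OF K member_subset] by blast

lemma topspace_solids: "topspace solids = \<Union>(solid ` \<M>)"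
  by (rule topspace_family_topology[OF disjoint_solids[OF \<M>(1)] solids_subset])

lemma solid_iff_support: "M \<in> \<M> \<Longrightarrow> x \<in> solid M \<longleftrightarrow> x \<in> polytope_of K \<and> support x \<in> M"
  using solid_eq[OF K member_subset] by blast

lemma finite_cells: "finite (topspace cells)"
  unfolding topspace_cells
  using \<M>(2) conjunct1[OF K[unfolded finite_simplicial_complex_def]] by (rule finite_subset)

lemma continuous_map_support_solids: "continuous_map solids cells support"
proof (rule continuous_map_family_topology[OF disjoint_solids[OF \<M>(1)] solids_subset \<M>(1) _ continuous_map_support[OF K]])
  show "\<Union>\<M> \<subseteq> topspace (alexandrov_topology K)"
    by (simp only: topspace_alexandrov_topology \<M>(2))
  fix A assume "A \<in> solid ` \<M>"
  then obtain M where "M \<in> \<M>" "A = solid M"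
    by blast
  then show "\<exists>B\<in>\<M>. support ` A \<subseteq> B"
    using solid_iff_support by blast
qed

lemma support_surjective:
  assumes "\<sigma> \<in> topspace cells"
  shows "\<exists>x\<in>topspace solids. support x = \<sigma>"
proof -
  obtain M where M: "M \<in> \<M>" "\<sigma> \<in> M"
    using assms unfolding topspace_cells by blast
  then have \<sigma>: "\<sigma> \<in> K"
    using member_subset by blast
  have b: "barycenter \<sigma> \<in> open_cell \<sigma>"
    by (rule barycenter_in_open_cell[OF finite_simplex[OF K \<sigma>] simplex_nonempty[OF K \<sigma>]])
  then have "barycenter \<sigma> \<in> topspace solids"
    unfolding topspace_solids solid_def using M by blast
  then show ?thesis
    using support_open_cell[OF b] by blast
qed

lemma contractible_support_fibre:
  assumes "minimal_open cells \<sigma> U"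
  shows "contractible_space (subtopology solids {x \<in> topspace solids. support x \<in> U})"
proof -
  have "\<sigma> \<in> U" "openin cells U"
    using assms unfolding minimal_open_def by blast+
  then have "\<sigma> \<in> topspace cells"
    using openin_subset by blast
  then obtain M where M: "M \<in> \<M>" "\<sigma> \<in> M"
    unfolding topspace_cells by blast
  note U = minimal_open_family_alexandrov[OF \<M>(1) M(1) member_subset[OF M(1)] M(2) assms]
  have S: "{x \<in> topspace solids. support x \<in> U} = {x \<in> polytope_of K. support x \<in> U}"
  proof (intro equalityI subsetI)
    fix x assume "x \<in> {x \<in> topspace solids. support x \<in> U}"
    then show "x \<in> {x \<in> polytope_of K. support x \<in> U}"
      using solids_subset unfolding topspace_solids topspace_polytope_topology[OF K] by blast
  next
    fix x assume x: "x \<in> {x \<in> polytope_of K. support x \<in> U}"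
    then have "x \<in> solid M"
      using U(1) unfolding solid_iff_support[OF M(1)] by blast
    then show "x \<in> {x \<in> topspace solids. support x \<in> U}"
      using M(1) x unfolding topspace_solids by blast
  qed
  have "{x \<in> polytope_of K. support x \<in> U} \<subseteq> solid M"
    using U(1) unfolding solid_eq[OF K member_subset[OF M(1)]] by blast
  then have "subtopology solids {x \<in> polytope_of K. support x \<in> U} =
      subtopology (polytope_topology K) {x \<in> polytope_of K. support x \<in> U}"
    by (rule subtopology_family_topology[OF disjoint_solids[OF \<M>(1)] imageI[OF M(1)]])
  then show ?thesis
    unfolding S using contractible_open_star[OF K \<open>\<sigma> \<in> U\<close> order.trans[OF U(1) member_subset[OF M(1)]] U(2)]
    by (simp only:)
qed

lemma mapping_cone_acyclic_support: "mapping_cone_acyclic TYPE('k::field) solids cells support"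
  by (rule mapping_cone_acyclic_finite_space[OF finite_cells continuous_map_support_solids
        contractible_support_fibre support_surjective])

lemma finite_dim_homology_solids: "finite_dim_homology TYPE('k::field) solids"
  by (rule finite_dim_homology_over_finite_space[OF finite_cells continuous_map_support_solids
        contractible_support_fibre])

lemma finite_dim_homology_cells: "finite_dim_homology TYPE('k::field) cells"
proof (rule finite_dim_homology_over_finite_space[OF finite_cells continuous_map_id])
  fix \<sigma> U assume U: "minimal_open cells \<sigma> U"
  then have "openin cells U"
    unfolding minimal_open_def by (rule conjunct1)
  then have "{\<tau> \<in> topspace cells. id \<tau> \<in> U} = U"
    unfolding id_apply using openin_subset by blast
  then show "contractible_space (subtopology cells {\<tau> \<in> topspace cells. id \<tau> \<in> U})"
    using contractible_minimal_open[OF U] by (simp only:)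
qed

end

theorem theorem6p5:
  fixes n p :: nat
    and K :: "nat \<Rightarrow> 'a set set"
    and F :: "nat \<Rightarrow> 'a set \<Rightarrow> 'a set set"
    and \<M> :: "nat \<Rightarrow> 'a set set set"
    and \<phi> :: "nat \<Rightarrow> 'a \<Rightarrow> 'a"
  assumes "\<forall>i\<in>{1..n}. finite_simplicial_complex (K i)"
    and "\<forall>i\<in>{1..n}. combinatorial_dynamical_system (K i) (F i)"
    and "\<forall>i\<in>{1..n}. morse_decomposition (K i) (F i) (\<M> i)"
    and "\<forall>i\<in>{1..<n}. simplicial_map (K i) (K (i + 1)) (\<phi> i)"
    and "\<forall>i\<in>{1..<n}. \<forall>\<sigma>\<in>K i. (`) (\<phi> i) ` F i \<sigma> \<subseteq> F (i + 1) (\<phi> i ` \<sigma>)"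
    and "\<forall>i\<in>{1..<n}. \<forall>M\<in>\<M> i. \<exists>M'\<in>\<M> (i + 1). (`) (\<phi> i) ` M \<subseteq> M'"
  shows
    "let V = (homology_pmodule p
                (\<lambda>i. family_topology (alexandrov_topology (K i)) (\<M> i))
                (\<lambda>i. (`) (\<phi> i))
                :: ('k::field, ('a set, 'k) field_chain set) pmodule);
         W = (homology_pmodule p
                (\<lambda>i. family_topology (polytope_topology (K i)) (solid ` \<M> i))
                (\<lambda>i. polytope_map (K i) (\<phi> i))
                :: ('k, ('a \<Rightarrow> real, 'k) field_chain set) pmodule)
     in fin_dim_persistence_module n V \<and> fin_dim_persistence_module n W \<and>
        persistence_diagram n V = persistence_diagram n W"
proof -
  let ?Y = "\<lambda>i. family_topology (alexandrov_topology (K i)) (\<M> i)"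
  let ?X = "\<lambda>i. family_topology (polytope_topology (K i)) (solid ` \<M> i)"
  let ?V = "homology_pmodule p ?Y (\<lambda>i. (`) (\<phi> i)) :: ('k::field, ('a set, 'k) field_chain set) pmodule"
  let ?W = "homology_pmodule p ?X (\<lambda>i. polytope_map (K i) (\<phi> i)) :: ('k, ('a \<Rightarrow> real, 'k) field_chain set) pmodule"
  have family: "morse_family (K i) (\<M> i)" if i: "i \<in> {1..n}" for i
  proof
    show "finite_simplicial_complex (K i)"
      using assms(1) i by (rule bspec)
    have md: "morse_decomposition (K i) (F i) (\<M> i)"
      using assms(3) i by (rule bspec)
    then show "disjoint (\<M> i)"
      unfolding morse_decomposition_def by (rule conjunct1)
    have iso: "\<forall>M\<in>\<M> i. M \<noteq> {} \<and> isolated_invariant_set (K i) (F i) M \<and> M \<subseteq> full_solution_values (K i) (F i)"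
      using md unfolding morse_decomposition_def by (elim conjE)
    show "\<Union>(\<M> i) \<subseteq> K i"
    proof (rule Union_least)
      fix M assume "M \<in> \<M> i"
      then have "isolated_invariant_set (K i) (F i) M"
        using iso by blast
      then show "M \<subseteq> K i"
        unfolding isolated_invariant_set_def by (rule conjunct1)
    qed
  qed
  have succ: "i \<in> {1..n}" "i + 1 \<in> {1..n}" if "i \<in> {1..<n}" for i
    using that by auto
  have f: "continuous_map (?Y i) (?Y (i + 1)) ((`) (\<phi> i))" if i: "i \<in> {1..<n}" for i
  proof -
    interpret K: morse_family "K i" "\<M> i" by (rule family[OF succ(1)[OF i]])
    interpret L: morse_family "K (i + 1)" "\<M> (i + 1)" by (rule family[OF succ(2)[OF i]])
    show ?thesis
    proof (rule continuous_map_family_topology[OF K.\<M>(1) _ L.\<M>(1)])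
      show "continuous_map (alexandrov_topology (K i)) (alexandrov_topology (K (i + 1))) ((`) (\<phi> i))"
        using assms(4)[rule_format, OF i] by (rule continuous_map_simplicial_map)
      show "\<exists>B\<in>\<M> (i + 1). (`) (\<phi> i) ` A \<subseteq> B" if "A \<in> \<M> i" for A
        using assms(6)[rule_format, OF i that] .
    qed (simp_all only: topspace_alexandrov_topology K.\<M>(2) L.\<M>(2))
  qed
  have \<nu>: "continuous_map (?X i) (?X (i + 1)) (polytope_map (K i) (\<phi> i))"
    and square: "\<And>x. x \<in> topspace (?X i) \<Longrightarrow> support (polytope_map (K i) (\<phi> i) x) = \<phi> i ` support x"
    if i: "i \<in> {1..<n}" for i
  proof -
    interpret K: morse_family "K i" "\<M> i" by (rule family[OF succ(1)[OF i]])
    interpret L: morse_family "K (i + 1)" "\<M> (i + 1)" by (rule family[OF succ(2)[OF i]])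
    have \<phi>: "simplicial_map (K i) (K (i + 1)) (\<phi> i)"
      using assms(4)[rule_format, OF i] .
    show sq: "support (polytope_map (K i) (\<phi> i) x) = \<phi> i ` support x" if "x \<in> topspace (?X i)" for x
    proof (rule support_polytope_map[OF K.K])
      show "x \<in> polytope_of (K i)"
        using that K.solids_subset unfolding K.topspace_solids topspace_polytope_topology[OF K.K] by blast
    qed
    show "continuous_map (?X i) (?X (i + 1)) (polytope_map (K i) (\<phi> i))"
    proof (rule continuous_map_family_topology[OF disjoint_solids[OF K.\<M>(1)] K.solids_subset
          disjoint_solids[OF L.\<M>(1)] L.solids_subset continuous_map_polytope_map[OF K.K L.K \<phi>]])
      fix A assume "A \<in> solid ` \<M> i"
      then obtain M where M: "M \<in> \<M> i" "A = solid M"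
        by blast
      then obtain M' where M': "M' \<in> \<M> (i + 1)" "(`) (\<phi> i) ` M \<subseteq> M'"
        using assms(6)[rule_format, OF i] by blast
      have "polytope_map (K i) (\<phi> i) x \<in> solid M'" if "x \<in> A" for x
      proof -
        have x: "x \<in> polytope_of (K i)" "support x \<in> M"
          using that unfolding M(2) K.solid_iff_support[OF M(1)] by blast+
        then show ?thesis
          unfolding L.solid_iff_support[OF M'(1)] support_polytope_map[OF K.K x(1)]
          using polytope_map_in_polytope[OF K.K L.K \<phi> x(1)] M'(2) by blast
      qed
      then show "\<exists>B\<in>solid ` \<M> (i + 1). polytope_map (K i) (\<phi> i) ` A \<subseteq> B"
        using M'(1) by blast
    qed
  qed
  have V: "fin_dim_persistence_module n ?V"
    unfolding fin_dim_persistence_module_def homology_pmodule_def pmodule.simps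
    by (intro conjI ballI vectorspace_homology_space fin_dim_homology_space linear_homology_map f
        morse_family.finite_dim_homology_cells family)
  have W: "fin_dim_persistence_module n ?W"
    unfolding fin_dim_persistence_module_def homology_pmodule_def pmodule.simps
    by (intro conjI ballI vectorspace_homology_space fin_dim_homology_space linear_homology_map \<nu>
        morse_family.finite_dim_homology_solids family)
  have support: "continuous_map (?X i) (?Y i) support" if "i \<in> {1..n}" for i
    by (rule morse_family.continuous_map_support_solids[OF family[OF that]])
  \<comment> \<open>\<open>support\<close> induces the isomorphism; the squares commute already on the level of points.\<close>
  have "pmodule_isomorphic n ?W ?V"
    unfolding pmodule_isomorphic_def homology_pmodule_def pmodule.simps
  proof (intro exI[of _ "\<lambda>i. homology_map p (?Y i) support"] conjI ballI)
    fix i assume i: "i \<in> {1..n}"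
    show "linear_map class_ring (homology_space p (?X i)) (homology_space p (?Y i)) (homology_map p (?Y i) support)"
      by (rule linear_homology_map[OF support[OF i]])
    show "bij_betw (homology_map p (?Y i) support) (carrier (homology_space p (?X i))) (carrier (homology_space p (?Y i)))"
      by (rule bij_betw_homology_map[OF support[OF i] morse_family.mapping_cone_acyclic_support[OF family[OF i]]])
  next
    fix i C assume i: "i \<in> {1..<n}" and C: "C \<in> carrier (homology_space p (?X i) :: ('k, ('a \<Rightarrow> real, 'k) field_chain set) module)"
    note s = support[OF succ(1)[OF i]] support[OF succ(2)[OF i]]
    have "homology_map p (?Y (i + 1)) support (homology_map p (?X (i + 1)) (polytope_map (K i) (\<phi> i)) C) =
        homology_map p (?Y (i + 1)) (support \<circ> polytope_map (K i) (\<phi> i)) C"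
      by (rule homology_map_compose[OF C \<nu>[OF i] s(2)])
    also have "\<dots> = homology_map p (?Y (i + 1)) ((`) (\<phi> i) \<circ> support) C"
      by (rule homology_map_cong[OF C continuous_map_compose[OF \<nu>[OF i] s(2)] continuous_map_compose[OF s(1) f[OF i]]])
         (simp only: comp_apply square[OF i])
    also have "\<dots> = homology_map p (?Y (i + 1)) ((`) (\<phi> i)) (homology_map p (?Y i) support C)"
      by (rule homology_map_compose[OF C s(1) f[OF i], symmetric])
    finally show "homology_map p (?Y (i + 1)) support (homology_map p (?X (i + 1)) (polytope_map (K i) (\<phi> i)) C) =
        homology_map p (?Y (i + 1)) ((`) (\<phi> i)) (homology_map p (?Y i) support C)" .
  qed
  then have "persistence_diagram n ?W = persistence_diagram n ?V"
    by (rule persistence_diagram_isomorphic[OF W])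
  then show ?thesis
    using V W by (simp only: Let_def simp_thms)
qed

end
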